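(* Let $A = k[\mathcal{G}] \times k[G]$ be the biproduct constructed in the context from data $(G, \mathcal{G}, \mu, \theta, \mathbf{U})$, where $\mathcal{G}$ is a finite abelian group. Then $k$ contains a primitive $N^{th}$ root of unity $\lambda$, where $N = |\theta|$ is the order of $\theta$. Assume further that $k$ contains a primitive $|\mathcal{G}|^{th}$ root of unity. Let $A' = k[\mathcal{G}] \times k[\mathbf{U}]$, with projection $\pi' : A' \to k[\mathbf{U}]$, and let $\mathbf{G}$ be the additive version of $\mathcal{G}$. Then there are $\sigma \in \mathrm{Aut}_{\mathrm{Group}}(\mathbf{G})$ of order $N$ and a map $\Phi_{A', \mathbf{G}}$ such that: (a) $\Phi_{A', \mathbf{G}} : \mathrm{Aut}_{\mathrm{Hopf}}(A', \pi') \to \Gamma(\mathbf{G}, \lambda, \sigma)$ is an isomorphism of groups. (b) For $F \in \mathrm{Aut}_{\mathrm{Hopf}}(A', \pi')$, $F_L$ is a coalgebra map if and only if $\Phi_{A', \mathbf{G}}(F) \in \mathrm{Aut}_{\mathrm{Group}}(\mathbf{G})$.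
   Context: Let $k$ be a field. The data. $G$ and $\mathcal{G}$ are groups, $\mu : G \to \mathrm{Aut}_{\mathrm{Group}}(\mathcal{G})$ is a group homomorphism, and $\theta \in \mathrm{Aut}_{\mathrm{Group}}(\mathcal{G})$ has finite orbits on $\mathcal{G}$. $\boldsymbol{\theta} : k[\mathcal{G}] \to k[\mathcal{G}]$ is the linear extension of $\theta$ and is assumed diagonalizable (i.e. $B = k[\mathcal{G}]$ is the sum of the eigenspaces $B_\lambda = \{b : \boldsymbol{\theta}(b) = \lambda b\}$, $\lambda \in k$). Assume $\mu(g) \circ \theta = \theta \circ \mu(g)$ for all $g \in G$, and that there is an isomorphism $\lambda \mapsto \boldsymbol{\lambda}$ from the subgroup $U \subseteq k^\times$ generated by the eigenvalues of $\boldsymbol{\theta}$ onto a subgroup $\mathbf{U}$ of $G$ with $\mathbf{U} \subseteq \mathrm{Ker}(\mu) \cap \mathrm{Z}(G)$. Let $H = k[G]$, $B = k[\mathcal{G}]$ with their usual Hopf algebra structures. $B$ is a left $H$-module by $g \cdot b = \mu(g)(b)$ for $g \in G$, $b \in \mathcal{G}$, and a left $H$-comodule by $\rho(b) = \boldsymbol{\lambda} \otimes b$ for $b \in B_\lambda$. With these structures $B$ is a Hopf algebra in ${}_H^H\mathcal{YD}$ and the biproduct $A = B \times H$ is the Hopf algebra on $B \otimes H$ (tensors written $b \times h$) with product $(b \times h)(b' \times h') = b(h_{(1)}\cdot b') \times h_{(2)}h'$, unit $1 \times 1$, coproduct $\Delta(b \times h) = (b_{(1)} \times b_{(2)(-1)}h_{(1)})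 \otimes (b_{(2)(0)} \times h_{(2)})$, counit $\epsilon \otimes \epsilon$; here $\Delta(c) = c_{(1)} \otimes c_{(2)}$, $\rho(b) = b_{(-1)} \otimes b_{(0)}$. Since $\rho(B) \subseteq k[\mathbf{U}] \otimes B$, the same formulas with $k[\mathbf{U}]$ in place of $k[G]$ define a biproduct $A' = k[\mathcal{G}] \times k[\mathbf{U}]$, a Hopf subalgebra of $A$ (the $k[\mathbf{U}]$-action on $B$ is trivial). $\pi'(b \times h) = \epsilon(b)h$. $\mathrm{Aut}_{\mathrm{Hopf}}(A', \pi')$ is the group of Hopf algebra automorphisms $F$ of $A'$ with $\pi' \circ F = \pi'$. $F_L : B \to B$ is $F_L(b) = \Pi(F(b \times 1))$ where $\Pi(b \times h) = b\epsilon(h)$. The group $\Gamma$. Let $\mathbf{G}$ be a finite abelian group, written additively, $\sigma \in \mathrm{Aut}_{\mathrm{Group}}(\mathbf{G})$ of order $N$, $\lambda \in k^\times$ a primitive $N^{th}$ root of unity. For $\mathbf{m} \in \mathbf{G}$, $|\mathbf{m}|$ is the length of the $(\sigma)$-orbit of $\mathbf{m}$ and $\lambda_{\mathbf{m}} = \lambda^{N/|\mathbf{m}|}$. $\widehat{\mathbf{G}}$ is the group of homomorphisms $\mathbf{G} \to k^\times$. $\mathcal{F}_{\mathbf{G}, \sigma, \lambda}$ is the set of pairs $(\tau, \alpha)$, $\tau \in \mathrm{Sym}(\mathbf{G})$ (permutations of the set $\mathbf{G}$), $\alpha \in \widehat{\mathbf{G}}$, such that $\tau \circ \sigma = \sigma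 \circ \tau$; $\alpha \circ \sigma = \alpha$; $\alpha^N = 1$; and $\tau(\mathbf{s} - \mathbf{m}) = \tau(\mathbf{s}) - \tau(\sigma^{\ell_\alpha(\mathbf{s}, \mathbf{m})}(\mathbf{m}))$ for all $\mathbf{s}, \mathbf{m} \in \mathbf{G}$, where $\ell_\alpha(\mathbf{s}, \mathbf{m})$ is the integer determined by $0 \leq \ell_\alpha(\mathbf{s}, \mathbf{m}) < |\mathbf{m}|$ and $(\alpha(\mathbf{s})/\alpha(\mathbf{m}))^{N/|\mathbf{m}|} = \lambda_{\mathbf{m}}^{\ell_\alpha(\mathbf{s}, \mathbf{m})}$. $\Gamma(\mathbf{G}, \lambda, \sigma) = \{\tau \mid (\tau, \alpha) \in \mathcal{F}_{\mathbf{G}, \sigma, \lambda} \text{ for some } \alpha \in \widehat{\mathbf{G}}\}$, a subgroup of $\mathrm{Sym}(\mathbf{G})$. *)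

theory Defs
  imports "HOL-Algebra.Algebra" "HOL-Library.Poly_Mapping"
begin

section \<open>Free vector spaces and their tensor products\<close>

text \<open>
  A vector space over \<open>k\<close> with basis \<open>S\<close> is the set of finitely supported functions
  with support in \<open>S\<close>.  The tensor product of the spaces with bases \<open>S\<close> and \<open>T\<close> is the space
  with basis \<open>S \<times> T\<close>, where \<open>x \<otimes> y\<close> is the basis vector \<open>(x, y)\<close>.  Linear and bilinear maps
  are given by their values on basis vectors.
\<close>

abbreviation bvec :: "'x \<Rightarrow> ('x \<Rightarrow>\<^sub>0 'k::field)"
  where "bvec x \<equiv> Poly_Mapping.single x 1"

definition fspan :: "'x set \<Rightarrow> ('x \<Rightarrow>\<^sub>0 'k::field) set"
  where "fspan S = {f. Poly_Mapping.keys f \<subseteq> S}"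

definition scale :: "'k::field \<Rightarrow> ('x \<Rightarrow>\<^sub>0 'k) \<Rightarrow> ('x \<Rightarrow>\<^sub>0 'k)"
  where "scale c f = Poly_Mapping.map ((*) c) f"

definition linear_on :: "('x \<Rightarrow>\<^sub>0 'k::field) set \<Rightarrow> (('x \<Rightarrow>\<^sub>0 'k) \<Rightarrow> ('y \<Rightarrow>\<^sub>0 'k)) \<Rightarrow> bool"
  where "linear_on V F \<longleftrightarrow>
    (\<forall>f\<in>V. \<forall>g\<in>V. F (f + g) = F f + F g) \<and> (\<forall>c. \<forall>f\<in>V. F (scale c f) = scale c (F f))"

definition lin_ext :: "('x \<Rightarrow> ('y \<Rightarrow>\<^sub>0 'k::field)) \<Rightarrow> ('x \<Rightarrow>\<^sub>0 'k) \<Rightarrow> ('y \<Rightarrow>\<^sub>0 'k)"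
  where "lin_ext \<phi> f = (\<Sum>x\<in>Poly_Mapping.keys f. scale (Poly_Mapping.lookup f x) (\<phi> x))"

definition lin_form :: "('x \<Rightarrow> 'k::field) \<Rightarrow> ('x \<Rightarrow>\<^sub>0 'k) \<Rightarrow> 'k"
  where "lin_form \<phi> f = (\<Sum>x\<in>Poly_Mapping.keys f. Poly_Mapping.lookup f x * \<phi> x)"

definition bilin_ext ::
    "('x \<Rightarrow> 'y \<Rightarrow> ('z \<Rightarrow>\<^sub>0 'k::field)) \<Rightarrow> ('x \<Rightarrow>\<^sub>0 'k) \<Rightarrow> ('y \<Rightarrow>\<^sub>0 'k) \<Rightarrow> ('z \<Rightarrow>\<^sub>0 'k)"
  where "bilin_ext \<phi> f g = lin_ext (\<lambda>x. lin_ext (\<phi> x) g) f"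

definition tens :: "('x \<Rightarrow>\<^sub>0 'k::field) \<Rightarrow> ('y \<Rightarrow>\<^sub>0 'k) \<Rightarrow> ('x \<times> 'y \<Rightarrow>\<^sub>0 'k)"
  where "tens = bilin_ext (\<lambda>x y. bvec (x, y))"

definition tens_map ::
    "(('x \<Rightarrow>\<^sub>0 'k::field) \<Rightarrow> ('u \<Rightarrow>\<^sub>0 'k)) \<Rightarrow> (('y \<Rightarrow>\<^sub>0 'k) \<Rightarrow> ('v \<Rightarrow>\<^sub>0 'k))
      \<Rightarrow> ('x \<times> 'y \<Rightarrow>\<^sub>0 'k) \<Rightarrow> ('u \<times> 'v \<Rightarrow>\<^sub>0 'k)"
  where "tens_map F F' = lin_ext (\<lambda>(x, y). tens (F (bvec x)) (F' (bvec y)))"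

lemma lookup_scale [simp]: "Poly_Mapping.lookup (scale c f) x = c * Poly_Mapping.lookup f x"
  unfolding scale_def by transfer (simp add: when_def)

lemma scale_simps [simp]: "scale 1 f = f" "scale 0 f = 0" "scale c 0 = 0"
  by (rule poly_mapping_eqI; simp)+

lemma scale_scale: "scale c (scale d f) = scale (c * d) f"
  by (rule poly_mapping_eqI) (simp add: mult.assoc)

lemma scale_diff: "scale c (f - g) = scale c f - scale c g"
  by (rule poly_mapping_eqI) (simp add: lookup_minus algebra_simps)

lemma scale_add: "scale c (f + g) = scale c f + scale c g"
  by (rule poly_mapping_eqI) (simp add: lookup_add algebra_simps)

lemma scale_sum: "scale c (sum f A) = (\<Sum>x\<in>A. scale c (f x))"
  by (induction A rule: infinite_finite_induct) (auto simp: scale_add)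

lemma lin_ext_bvec [simp]: "lin_ext \<phi> (bvec x) = \<phi> x"
  by (simp add: lin_ext_def)

lemma lin_form_bvec [simp]: "lin_form \<phi> (bvec x) = \<phi> x"
  by (simp add: lin_form_def)

lemma bilin_ext_bvec [simp]: "bilin_ext \<phi> (bvec x) (bvec y) = \<phi> x y"
  by (simp add: bilin_ext_def)

lemma tens_bvec [simp]: "tens (bvec x) (bvec y) = bvec (x, y)"
  by (simp add: tens_def)

lemma lin_ext_superset:
  assumes "finite S" "Poly_Mapping.keys f \<subseteq> S"
  shows "lin_ext \<phi> f = (\<Sum>x\<in>S. scale (Poly_Mapping.lookup f x) (\<phi> x))"
  unfolding lin_ext_def using assms
  by (intro sum.mono_neutral_left) (auto simp: in_keys_iff)

lemma lin_ext_add: "lin_ext \<phi> (f + g) = lin_ext \<phi> f + lin_ext \<phi> g"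
proof -
  have dist: "scale (a + b) h = scale a h + scale b h" for a b and h :: "'a \<Rightarrow>\<^sub>0 'b"
    by (rule poly_mapping_eqI) (simp add: lookup_add algebra_simps)
  let ?S = "Poly_Mapping.keys f \<union> Poly_Mapping.keys g"
  show ?thesis
    using keys_add[of f g]
    by (simp add: lin_ext_superset[of ?S f] lin_ext_superset[of ?S g]
        lin_ext_superset[of ?S "f + g"] lookup_add dist sum.distrib)
qed

lemma lin_ext_scale: "lin_ext \<phi> (scale c f) = scale c (lin_ext \<phi> f)"
proof -
  have "Poly_Mapping.keys (scale c f) \<subseteq> Poly_Mapping.keys f"
    by (auto simp: in_keys_iff)
  then show ?thesis
    by (simp add: lin_ext_superset[of "Poly_Mapping.keys f"] scale_sum scale_scale)
qed

lemma lin_ext_zero [simp]: "lin_ext \<phi> 0 = 0"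
  by (simp add: lin_ext_def)

lemma lin_ext_sum: "lin_ext \<phi> (sum f A) = (\<Sum>x\<in>A. lin_ext \<phi> (f x))"
  by (induction A rule: infinite_finite_induct) (auto simp: lin_ext_add)


section \<open>Hopf algebras and their morphisms\<close>

text \<open>
  The antipode of a Hopf algebra is determined by its bialgebra structure and is preserved
  by every bialgebra map, so it is not part of the data.
\<close>

record (overloaded) ('x, 'k) hopf =
  hbasis :: "'x set"
  hmult :: "('x \<Rightarrow>\<^sub>0 'k) \<Rightarrow> ('x \<Rightarrow>\<^sub>0 'k) \<Rightarrow> ('x \<Rightarrow>\<^sub>0 'k)"
  hone :: "'x \<Rightarrow>\<^sub>0 'k"
  hcomult :: "('x \<Rightarrow>\<^sub>0 'k) \<Rightarrow> ('x \<times> 'x \<Rightarrow>\<^sub>0 'k)"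
  hcounit :: "('x \<Rightarrow>\<^sub>0 'k) \<Rightarrow> 'k"

abbreviation hspace :: "('x, 'k::field) hopf \<Rightarrow> ('x \<Rightarrow>\<^sub>0 'k) set"
  where "hspace A \<equiv> fspan (hbasis A)"

definition coalg_map ::
    "('x, 'k::field) hopf \<Rightarrow> ('y, 'k) hopf \<Rightarrow> (('x \<Rightarrow>\<^sub>0 'k) \<Rightarrow> ('y \<Rightarrow>\<^sub>0 'k)) \<Rightarrow> bool"
  where "coalg_map A C F \<longleftrightarrow>
    F \<in> hspace A \<rightarrow> hspace C \<and> linear_on (hspace A) F \<and>
    (\<forall>x\<in>hspace A. hcomult C (F x) = tens_map F F (hcomult A x)) \<and>
    (\<forall>x\<in>hspace A. hcounit C (F x) = hcounit A x)"

definition hopf_map ::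
    "('x, 'k::field) hopf \<Rightarrow> ('y, 'k) hopf \<Rightarrow> (('x \<Rightarrow>\<^sub>0 'k) \<Rightarrow> ('y \<Rightarrow>\<^sub>0 'k)) \<Rightarrow> bool"
  where "hopf_map A C F \<longleftrightarrow>
    coalg_map A C F \<and> F (hone A) = hone C \<and>
    (\<forall>x\<in>hspace A. \<forall>y\<in>hspace A. F (hmult A x y) = hmult C (F x) (F y))"

text \<open>
  The group of Hopf algebra automorphisms \<open>F\<close> with \<open>p \<circ> F = p\<close>.
  As in \<^const>\<open>BijGroup\<close>, automorphisms are extensional functions and the product is composition.
\<close>

definition Aut_Hopf ::
    "('x, 'k::field) hopf \<Rightarrow> (('x \<Rightarrow>\<^sub>0 'k) \<Rightarrow> ('y \<Rightarrow>\<^sub>0 'k)) \<Rightarrow> (('x \<Rightarrow>\<^sub>0 'k) \<Rightarrow> ('x \<Rightarrow>\<^sub>0 'k)) monoid"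
  where "Aut_Hopf A p = BijGroup (hspace A)
    \<lparr>carrier := {F \<in> Bij (hspace A). hopf_map A A F \<and> (\<forall>x\<in>hspace A. p (F x) = p x)}\<rparr>"

definition group_algebra :: "('a, 'm) monoid_scheme \<Rightarrow> ('a, 'k::field) hopf"
  where "group_algebra G = \<lparr>
    hbasis = carrier G,
    hmult = bilin_ext (\<lambda>x y. bvec (x \<otimes>\<^bsub>G\<^esub> y)),
    hone = bvec \<one>\<^bsub>G\<^esub>,
    hcomult = lin_ext (\<lambda>x. bvec (x, x)),
    hcounit = lin_form (\<lambda>x. 1)\<rparr>"


section \<open>Biproducts\<close>

text \<open>
  The biproduct \<open>B \<times> H\<close> for an action \<open>H \<otimes> B \<rightarrow> B\<close> and a coaction \<open>B \<rightarrow> H \<otimes> B\<close>,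
  with product \<open>(b \<times> h)(b' \<times> h') = b(h\<^sub>1 \<cdot> b') \<times> h\<^sub>2h'\<close> and coproduct
  \<open>\<Delta>(b \<times> h) = (b\<^sub>1 \<times> (b\<^sub>2)\<^bsub>(-1)\<^esub> h\<^sub>1) \<otimes> ((b\<^sub>2)\<^bsub>(0)\<^esub> \<times> h\<^sub>2)\<close>; every Sweedler sum is a nested
  linear extension over the corresponding tensor.
\<close>

definition biproduct ::
    "('b, 'k::field) hopf \<Rightarrow> ('h, 'k) hopf
      \<Rightarrow> (('h \<Rightarrow>\<^sub>0 'k) \<Rightarrow> ('b \<Rightarrow>\<^sub>0 'k) \<Rightarrow> ('b \<Rightarrow>\<^sub>0 'k)) \<Rightarrow> (('b \<Rightarrow>\<^sub>0 'k) \<Rightarrow> ('h \<times> 'b \<Rightarrow>\<^sub>0 'k))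
      \<Rightarrow> ('b \<times> 'h, 'k) hopf"
  where "biproduct B H act coact = \<lparr>
    hbasis = hbasis B \<times> hbasis H,
    hmult = bilin_ext (\<lambda>(b, h) (b', h').
      lin_ext (\<lambda>(h1, h2). tens (hmult B (bvec b) (act (bvec h1) (bvec b')))
                              (hmult H (bvec h2) (bvec h')))
        (hcomult H (bvec h))),
    hone = tens (hone B) (hone H),
    hcomult = lin_ext (\<lambda>(b, h).
      lin_ext (\<lambda>(b1, b2).
        lin_ext (\<lambda>(b2m, b20).
          lin_ext (\<lambda>(h1, h2).
              tens (tens (bvec b1) (hmult H (bvec b2m) (bvec h1))) (bvec (b20, h2)))
            (hcomult H (bvec h)))
          (coact (bvec b2)))
        (hcomult B (bvec b))),
    hcounit = lin_form (\<lambda>(b, h). hcounit B (bvec b) * hcounit H (bvec h))\<rparr>"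

definition bip_proj ::
    "('b, 'k::field) hopf \<Rightarrow> ('b \<times> 'h \<Rightarrow>\<^sub>0 'k) \<Rightarrow> ('h \<Rightarrow>\<^sub>0 'k)"
  where "bip_proj B = lin_ext (\<lambda>(b, h). scale (hcounit B (bvec b)) (bvec h))"

definition bip_left_proj ::
    "('h, 'k::field) hopf \<Rightarrow> ('b \<times> 'h \<Rightarrow>\<^sub>0 'k) \<Rightarrow> ('b \<Rightarrow>\<^sub>0 'k)"
  where "bip_left_proj H = lin_ext (\<lambda>(b, h). scale (hcounit H (bvec h)) (bvec b))"

definition left_part ::
    "('h, 'k::field) hopf \<Rightarrow> (('b \<times> 'h \<Rightarrow>\<^sub>0 'k) \<Rightarrow> ('b \<times> 'h \<Rightarrow>\<^sub>0 'k)) \<Rightarrow> ('b \<Rightarrow>\<^sub>0 'k) \<Rightarrow> ('b \<Rightarrow>\<^sub>0 'k)"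
  where "left_part H F b = bip_left_proj H (F (tens b (hone H)))"


section \<open>The biproduct attached to a group automorphism\<close>

definition units_group :: "'k::field monoid"
  where "units_group = \<lparr>carrier = UNIV - {0}, monoid.mult = (*), one = 1\<rparr>"

definition primitive_root :: "nat \<Rightarrow> 'k::field \<Rightarrow> bool"
  where "primitive_root n x \<longleftrightarrow> n > 0 \<and> x ^ n = 1 \<and> (\<forall>m. 0 < m \<and> m < n \<longrightarrow> x ^ m \<noteq> 1)"

definition aut_orbit :: "('a, 'm) monoid_scheme \<Rightarrow> ('a \<Rightarrow> 'a) \<Rightarrow> 'a \<Rightarrow> 'a set"
  where "aut_orbit \<G> \<theta> x = orbit (subgroup_generated (AutoGroup \<G>) {\<theta>}) (\<lambda>f. f) x"

definition eigenspace ::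
    "('a, 'm) monoid_scheme \<Rightarrow> ('a \<Rightarrow> 'a) \<Rightarrow> 'k::field \<Rightarrow> ('a \<Rightarrow>\<^sub>0 'k) set"
  where "eigenspace \<G> \<theta> l =
    {b \<in> fspan (carrier \<G>). lin_ext (\<lambda>x. bvec (\<theta> x)) b = scale l b}"

definition eigen_decomp ::
    "('a, 'm) monoid_scheme \<Rightarrow> ('a \<Rightarrow> 'a) \<Rightarrow> ('a \<Rightarrow>\<^sub>0 'k::field) \<Rightarrow> ('k \<Rightarrow> ('a \<Rightarrow>\<^sub>0 'k)) \<Rightarrow> bool"
  where "eigen_decomp \<G> \<theta> b c \<longleftrightarrow>
    (\<forall>l. c l \<in> eigenspace \<G> \<theta> l) \<and> finite {l. c l \<noteq> 0} \<and> b = (\<Sum>l | c l \<noteq> 0. c l)"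

definition eigenvalue_group :: "('a, 'm) monoid_scheme \<Rightarrow> ('a \<Rightarrow> 'a) \<Rightarrow> 'k::field monoid"
  where "eigenvalue_group \<G> \<theta> =
    subgroup_generated units_group {l. eigenspace \<G> \<theta> l \<noteq> {0}}"

definition group_action_ext ::
    "('g \<Rightarrow> 'a \<Rightarrow> 'a) \<Rightarrow> ('g \<Rightarrow>\<^sub>0 'k::field) \<Rightarrow> ('a \<Rightarrow>\<^sub>0 'k) \<Rightarrow> ('a \<Rightarrow>\<^sub>0 'k)"
  where "group_action_ext \<mu> = bilin_ext (\<lambda>g x. bvec (\<mu> g x))"

text \<open>
  The coaction with \<open>b \<mapsto> e l \<otimes> b\<close> on the \<open>l\<close>-eigenspace.  It is defined through the
  decomposition into eigenvectors; see lemma \<open>eigen_coaction_eigenvector\<close> below.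
\<close>

definition eigen_coaction ::
    "('a, 'm) monoid_scheme \<Rightarrow> ('a \<Rightarrow> 'a) \<Rightarrow> ('k::field \<Rightarrow> 'g) \<Rightarrow> ('a \<Rightarrow>\<^sub>0 'k) \<Rightarrow> ('g \<times> 'a \<Rightarrow>\<^sub>0 'k)"
  where "eigen_coaction \<G> \<theta> e b =
    (let c = (THE c. eigen_decomp \<G> \<theta> b c) in \<Sum>l | c l \<noteq> 0. tens (bvec (e l)) (c l))"

text \<open>
  Here \<open>\<^bold>U\<close> is the image of the embedding \<open>e\<close> of the group generated by the eigenvalues.
  Elements of the automorphism groups are extensional functions, as in \<^const>\<open>AutoGroup\<close>.
\<close>

locale biproduct_data =
  fixes G :: "'g monoid" and \<G> :: "'a monoid" and \<mu> :: "'g \<Rightarrow> 'a \<Rightarrow> 'a" and \<theta> :: "'a \<Rightarrow> 'a"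
    and \<U> :: "'g set" and e :: "'k::field \<Rightarrow> 'g"
  assumes group_G: "group G"
    and group_\<G>: "group \<G>"
    and \<mu>_hom: "\<mu> \<in> hom G (AutoGroup \<G>)"
    and \<theta>_auto: "\<theta> \<in> auto \<G>"
    and finite_orbits: "x \<in> carrier \<G> \<Longrightarrow> finite (aut_orbit \<G> \<theta> x)"
    and diagonalizable:
      "b \<in> fspan (carrier \<G>) \<Longrightarrow> \<exists>c :: 'k \<Rightarrow> ('a \<Rightarrow>\<^sub>0 'k). eigen_decomp \<G> \<theta> b c"
    and commute: "g \<in> carrier G \<Longrightarrow> x \<in> carrier \<G> \<Longrightarrow> \<mu> g (\<theta> x) = \<theta> (\<mu> g x)"
    and \<U>_subgroup: "subgroup \<U> G"
    and e_iso: "e \<in> iso (eigenvalue_group \<G> \<theta>) (G\<lparr>carrier := \<U>\<rparr>)"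
    and \<U>_kernel: "\<U> \<subseteq> kernel G (AutoGroup \<G>) \<mu>"
    and \<U>_central: "u \<in> \<U> \<Longrightarrow> g \<in> carrier G \<Longrightarrow> u \<otimes>\<^bsub>G\<^esub> g = g \<otimes>\<^bsub>G\<^esub> u"

text \<open>
  For \<open>K = G\<close> this is the biproduct \<open>k[\<G>] \<times> k[G]\<close>; for \<open>K = \<^bold>U\<close>, viewed as
  a group, it is its Hopf subalgebra \<open>k[\<G>] \<times> k[\<^bold>U]\<close>.
\<close>

definition group_biproduct ::
    "('g, 'n) monoid_scheme \<Rightarrow> ('a, 'm) monoid_scheme \<Rightarrow> ('g \<Rightarrow> 'a \<Rightarrow> 'a) \<Rightarrow> ('a \<Rightarrow> 'a)
      \<Rightarrow> ('k::field \<Rightarrow> 'g) \<Rightarrow> ('a \<times> 'g, 'k) hopf"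
  where "group_biproduct K \<G> \<mu> \<theta> e =
    biproduct (group_algebra \<G>) (group_algebra K) (group_action_ext \<mu>) (eigen_coaction \<G> \<theta> e)"

lemma group_biproduct_mult_bvec:
  "hmult (group_biproduct K \<G> \<mu> \<theta> e) (bvec (x, g)) (bvec (y, h)) =
    bvec (x \<otimes>\<^bsub>\<G>\<^esub> \<mu> g y, g \<otimes>\<^bsub>K\<^esub> h)"
  by (simp add: group_biproduct_def biproduct_def group_algebra_def group_action_ext_def)

lemma eigenspace_diff_scale:
  assumes "b \<in> eigenspace \<G> \<theta> l"
  shows "lin_ext (\<lambda>x. bvec (\<theta> x)) b - scale r b = scale (l - r) b"
  using assms unfolding eigenspace_def
  by (intro poly_mapping_eqI) (simp add: lookup_minus algebra_simps)

lemma eigenspace_closed: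
  assumes "b \<in> eigenspace \<G> \<theta> l"
  shows "scale r b \<in> eigenspace \<G> \<theta> l"
proof -
  have "Poly_Mapping.keys (scale r b) \<subseteq> Poly_Mapping.keys b"
    by (auto simp: in_keys_iff)
  then show ?thesis
    using assms by (auto simp: eigenspace_def fspan_def lin_ext_scale scale_scale mult.commute)
qed

lemma eigenspace_diff:
  assumes "b \<in> eigenspace \<G> \<theta> l" "b' \<in> eigenspace \<G> \<theta> l"
  shows "b - b' \<in> eigenspace \<G> \<theta> l"
proof -
  have "Poly_Mapping.keys (b - b') \<subseteq> Poly_Mapping.keys b \<union> Poly_Mapping.keys b'"
    by (auto simp: in_keys_iff lookup_minus)
  moreover have "lin_ext (\<lambda>x. bvec (\<theta> x)) b =
      lin_ext (\<lambda>x. bvec (\<theta> x)) (b - b') + lin_ext (\<lambda>x. bvec (\<theta> x)) b'"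
    by (simp add: lin_ext_add [symmetric])
  ultimately show ?thesis
    using assms by (auto simp: eigenspace_def fspan_def scale_diff algebra_simps)
qed

lemma eigenspaces_independent:
  fixes c :: "'k::field \<Rightarrow> ('a \<Rightarrow>\<^sub>0 'k)"
  assumes "finite L" "\<And>l. l \<in> L \<Longrightarrow> c l \<in> eigenspace \<G> \<theta> l" "sum c L = 0" "l \<in> L"
  shows "c l = 0"
  using assms
proof (induction L arbitrary: c l rule: finite_induct)
  case (insert r L)
  let ?T = "lin_ext (\<lambda>x. bvec (\<theta> x)) :: ('a \<Rightarrow>\<^sub>0 'k) \<Rightarrow> _"
  have "(\<Sum>l\<in>insert r L. scale (l - r) (c l)) = (\<Sum>l\<in>insert r L. ?T (c l) - scale r (c l))"
    using insert.prems(1) by (intro sum.cong refl eigenspace_diff_scale [symmetric])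
  also have "\<dots> = ?T (sum c (insert r L)) - scale r (sum c (insert r L))"
    unfolding lin_ext_sum scale_sum by (rule sum_subtractf)
  also have "\<dots> = 0"
    unfolding insert.prems(2) by simp
  finally have "(\<Sum>l\<in>L. scale (l - r) (c l)) = 0"
    using insert.hyps by simp
  then have *: "scale (l - r) (c l) = 0" if "l \<in> L" for l
    using insert.IH[of "\<lambda>l. scale (l - r) (c l)" l] insert.prems(1) that eigenspace_closed by blast
  have c0: "c l = 0" if "l \<in> L" for l
  proof -
    have "l - r \<noteq> 0" using that insert.hyps(2) by auto
    moreover have "scale (inverse (l - r)) (scale (l - r) (c l)) = 0"
      using *[OF that] by simp
    ultimately show ?thesis
      by (simp add: scale_scale)
  qed
  then have "sum c L = 0" by simp
  then have "c r = 0"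
    using insert.prems(2) insert.hyps by simp
  then show ?case
    using c0 insert.prems(3) by blast
qed simp

lemma eigen_decomp_unique:
  assumes "eigen_decomp \<G> \<theta> b c" "eigen_decomp \<G> \<theta> b d"
  shows "c = d"
proof
  fix l
  let ?L = "{l. c l \<noteq> 0} \<union> {l. d l \<noteq> 0}"
  have fin: "finite ?L"
    using assms by (simp add: eigen_decomp_def)
  have "sum f ?L = sum f {l. f l \<noteq> 0}" if "f = c \<or> f = d" for f
    using fin that by (intro sum.mono_neutral_right) auto
  then have "sum c ?L = b" "sum d ?L = b"
    using assms by (simp_all add: eigen_decomp_def)
  then have "sum (\<lambda>l. c l - d l) ?L = 0"
    by (simp add: sum_subtractf)
  then have "c l - d l = 0" if "l \<in> ?L"
    using eigenspaces_independent[of ?L "\<lambda>l. c l - d l" \<G> \<theta> l, OF fin] that assms eigenspace_diff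
    unfolding eigen_decomp_def by blast
  then show "c l = d l"
    by (cases "l \<in> ?L") auto
qed

lemma eigen_coaction_eigenvector:
  assumes "b \<in> eigenspace \<G> \<theta> l"
  shows "eigen_coaction \<G> \<theta> e b = tens (bvec (e l)) b"
proof (cases "b = 0")
  case True
  have "0 \<in> eigenspace \<G> \<theta> r" for r :: 'b
    by (simp add: eigenspace_def fspan_def)
  then have "eigen_decomp \<G> \<theta> b (\<lambda>_. 0)"
    by (simp add: eigen_decomp_def True)
  then have "(THE c. eigen_decomp \<G> \<theta> b c) = (\<lambda>_. 0)"
    using eigen_decomp_unique by blast
  then show ?thesis
    by (simp add: eigen_coaction_def True tens_def bilin_ext_def)
next
  case False
  define c where "c = (\<lambda>r. if r = l then b else 0)"
  have supp: "{r. c r \<noteq> 0} = {l}"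
    using False by (auto simp: c_def)
  have "c r \<in> eigenspace \<G> \<theta> r" for r
    using assms by (auto simp: c_def eigenspace_def fspan_def)
  then have "eigen_decomp \<G> \<theta> b c"
    by (simp add: eigen_decomp_def supp) (simp add: c_def)
  then have "(THE c. eigen_decomp \<G> \<theta> b c) = c"
    using eigen_decomp_unique by blast
  then show ?thesis
    by (simp add: eigen_coaction_def supp) (simp add: c_def)
qed


section \<open>The permutation group attached to an automorphism\<close>

text \<open>
  The finite abelian group \<open>M\<close> is a group record in the multiplicative notation of the library,
  so \<open>s - m\<close> is written \<open>s \<otimes> inv m\<close>.  Characters are extensional functions.
\<close>

definition characters :: "('a, 'm) monoid_scheme \<Rightarrow> ('a \<Rightarrow> 'k::field) set"
  where "characters M = hom M units_group \<inter> extensional (carrier M)"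

definition twist_exponent ::
    "('a, 'm) monoid_scheme \<Rightarrow> 'k::field \<Rightarrow> ('a \<Rightarrow> 'a) \<Rightarrow> ('a \<Rightarrow> 'k) \<Rightarrow> 'a \<Rightarrow> 'a \<Rightarrow> nat"
  where "twist_exponent M l \<sigma> \<alpha> s m =
    (let N = group.ord (AutoGroup M) \<sigma>; d = card (aut_orbit M \<sigma> m)
     in THE i. i < d \<and> (\<alpha> s / \<alpha> m) ^ (N div d) = (l ^ (N div d)) ^ i)"

definition twist_pairs ::
    "('a, 'm) monoid_scheme \<Rightarrow> ('a \<Rightarrow> 'a) \<Rightarrow> 'k::field \<Rightarrow> (('a \<Rightarrow> 'a) \<times> ('a \<Rightarrow> 'k)) set"
  where "twist_pairs M \<sigma> l =
    {(\<tau>, \<alpha>). \<tau> \<in> Bij (carrier M) \<and> \<alpha> \<in> characters M \<and>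
      (\<forall>m\<in>carrier M. \<tau> (\<sigma> m) = \<sigma> (\<tau> m)) \<and>
      (\<forall>m\<in>carrier M. \<alpha> (\<sigma> m) = \<alpha> m) \<and>
      (\<forall>m\<in>carrier M. \<alpha> m ^ group.ord (AutoGroup M) \<sigma> = 1) \<and>
      (\<forall>s\<in>carrier M. \<forall>m\<in>carrier M.
        \<tau> (s \<otimes>\<^bsub>M\<^esub> inv\<^bsub>M\<^esub> m) =
          \<tau> s \<otimes>\<^bsub>M\<^esub> inv\<^bsub>M\<^esub> (\<tau> ((\<sigma> ^^ twist_exponent M l \<sigma> \<alpha> s m) m)))}"

definition \<Gamma>_group ::
    "('a, 'm) monoid_scheme \<Rightarrow> 'k::field \<Rightarrow> ('a \<Rightarrow> 'a) \<Rightarrow> ('a \<Rightarrow> 'a) monoid"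
  where "\<Gamma>_group M l \<sigma> =
    BijGroup (carrier M) \<lparr>carrier := {\<tau>. \<exists>\<alpha>. (\<tau>, \<alpha>) \<in> twist_pairs M \<sigma> l}\<rparr>"

end

theory Submission
  imports Defs "HOL-Computational_Algebra.Polynomial"
begin

text \<open>
  The group \<open>\<^bold>U\<close> acts trivially on \<open>k[\<G>]\<close>, so as an algebra \<open>A'\<close> is the group algebra of the
  finite abelian group \<open>\<G> \<times> \<^bold>U\<close>.  The field contains enough roots of unity, so by Fourier inversion
  \<open>A'\<close> is the algebra of all functions on the set of its characters, and everything can be
  read off from that finite set of points.

  A primitive \<open>N\<close>-th root of unity exists because \<open>\<theta>\<close> is diagonalizable: if \<open>M\<close> is the exponent of
  the finite group \<open>U\<close> generated by the eigenvalues, then \<open>\<theta>\<^sup>M\<close> is the identity on every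
  eigenspace, so \<open>N\<close> divides \<open>M\<close>; on the other hand every eigenvalue is an \<open>N\<close>-th root of unity, and
  the exponent of a finite abelian group is the order of one of its elements.  Hence \<open>U\<close> is the group
  of all \<open>N\<close>-th roots of unity in \<open>k\<close> (\<open>primitive_root_in_U\<close>, \<open>carrier_U\<close>).

  A finite abelian group whose exponent divides the order of a primitive root of unity in \<open>k\<close> has a
  symmetric nondegenerate bicharacter \<open>\<beta>\<close> (\<open>self_pairing_exists\<close>): a cyclic subgroup of maximal order
  splits off, since one of its faithful characters extends to the whole group.  So the points of
  \<open>A'\<close> are the pairs \<open>(m, v)\<close> with \<open>m \<in> \<G>\<close> and \<open>v \<in> U\<close>, where \<open>(m, v)\<close> sends \<open>x \<times> e(v')\<close> to
  \<open>\<beta> m x \<cdot> v'\<^sup>i\<close> for \<open>v = l\<^sup>i\<close>.  If \<open>x\<close> has components \<open>x\<^sub>r\<close> in the eigenspaces, then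
  \<open>\<Sum>\<^sub>r r\<^sup>i x\<^sub>r = \<theta>\<^sup>i x\<close>; therefore the coproduct of \<open>A'\<close> induces on the points the product
  \<open>(m, v)(m', v') = (m \<sigma>\<^sup>i(m'), v v')\<close>, where \<open>\<sigma>\<close> is the adjoint of \<open>\<theta>\<close> for \<open>\<beta>\<close>
  (\<open>A'_point_hopf\<close>).  In other words \<open>A'\<close> is the Hopf algebra of functions on a semidirect product \<open>S\<close>
  of \<open>\<G>\<close> and \<open>U\<close>, and \<open>\<pi>'\<close> is the restriction of functions to \<open>1 \<times> U\<close>.

  Hopf algebra automorphisms \<open>F\<close> of \<open>A'\<close> with \<open>\<pi>' \<circ> F = \<pi>'\<close> thus correspond to automorphisms of
  \<open>S\<close> that fix \<open>1 \<times> U\<close> pointwise.  Such an automorphism is determined by the images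
  \<open>(\<tau> s, \<alpha> s)\<close> of the points \<open>(s, 1)\<close>, as it sends \<open>(s, v)\<close> to \<open>(\<tau> s, \<alpha> s \<cdot> v)\<close>; and a
  permutation \<open>\<tau>\<close> and a map \<open>\<alpha>\<close> give an automorphism in this way if and only if \<open>\<alpha>\<close> is a \<open>\<sigma>\<close>-invariant
  character with values in \<open>U\<close>, \<open>\<tau>\<close> commutes with \<open>\<sigma>\<close>, and \<open>\<tau>(s m) = \<tau>(s) \<sigma>\<^sup>i(\<tau>(m))\<close> whenever
  \<open>\<alpha> s = l\<^sup>i\<close>.  Replacing \<open>s\<close> by \<open>s m\<^sup>-\<^sup>1\<close> turns the last identity into the one that defines \<open>\<Gamma>\<close>,
  because \<open>\<sigma>\<^sup>i(m)\<close> depends on \<open>i\<close> only modulo the length of the orbit of \<open>m\<close> (\<open>twisted_hom_iff\<close>).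
  The character \<open>\<alpha>\<close> is determined by \<open>\<tau>\<close>, because \<open>\<sigma>\<close> has order \<open>N\<close>.  So \<open>F \<mapsto> \<tau>\<close> is the required
  isomorphism (\<open>\<Phi>_iso\<close>).

  On \<open>k[\<G>]\<close>, the algebra of functions on \<open>\<G>\<close> by means of \<open>\<beta>\<close>, the map \<open>F\<^sub>L\<close> is composition with
  \<open>\<tau>\<^sup>-\<^sup>1\<close>; it is a coalgebra map if and only if \<open>\<tau>\<close> is multiplicative
  (\<open>left_part_coalg_map_iff\<close>).
\<close>


section \<open>Roots of unity in a field\<close>

lemma primitive_root_pow_eq_1_iff:
  assumes "primitive_root n (l::'k::field)"
  shows "l ^ i = 1 \<longleftrightarrow> n dvd i"
proof -
  have "l ^ i = l ^ (i mod n)"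
    using assms
    by (metis (no_types) div_mult_mod_eq power_add power_mult mult.commute mult_1 power_one
        primitive_root_def)
  moreover have "i mod n < n" using assms by (simp add: primitive_root_def)
  ultimately show ?thesis
    using assms unfolding primitive_root_def dvd_eq_mod_eq_0
    by (metis bot_nat_0.not_eq_extremum power_0)
qed

lemma primitive_root_nonzero: "primitive_root n (l::'k::field) \<Longrightarrow> l \<noteq> 0"
  by (auto simp: primitive_root_def power_0_left)

lemma primitive_root_pow_eq_iff:
  assumes "primitive_root n (l::'k::field)"
  shows "l ^ i = l ^ j \<longleftrightarrow> i mod n = j mod n"
proof (induction i j rule: linorder_wlog)
  case (le i j)
  have "l ^ j = l ^ i * l ^ (j - i)" using le by (simp flip: power_add)
  then have "l ^ i = l ^ j \<longleftrightarrow> l ^ (j - i) = 1"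
    using primitive_root_nonzero[OF assms] by simp
  then show ?case
    using le by (metis mod_eq_dvd_iff_nat primitive_root_pow_eq_1_iff[OF assms])
qed metis

lemma primitive_root_pow_order:
  assumes "primitive_root n (l::'k::field)"
  shows "(l ^ i) ^ n = 1"
  using assms by (metis mult.commute power_mult power_one primitive_root_def)

text \<open>
  The powers of \<open>l\<close> are already \<open>n\<close> roots of \<open>x\<^sup>n - 1\<close>, and this polynomial has no more than \<open>n\<close>.
\<close>

lemma primitive_root_exhausts:
  assumes l: "primitive_root n (l::'k::field)" and v: "v ^ n = 1"
  shows "\<exists>i<n. v = l ^ i"
proof -
  let ?p = "monom 1 n - 1 :: 'k poly" and ?R = "(\<lambda>i. l ^ i) ` {..<n}"
  have n: "n > 0" using l by (simp add: primitive_root_def)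
  then have "coeff ?p n = 1" by simp
  then have p: "?p \<noteq> 0" by (metis coeff_0 zero_neq_one)
  have "degree ?p \<le> n" by (simp add: degree_diff_le degree_monom_le)
  then have le: "card {x. poly ?p x = 0} \<le> n" using card_poly_roots_bound[OF p] by linarith
  have "?R \<subseteq> {x. poly ?p x = 0}"
    using primitive_root_pow_order[OF l] by (auto simp: poly_monom)
  moreover have "card ?R = n"
    by (subst card_image) (auto simp: inj_on_def primitive_root_pow_eq_iff[OF l])
  ultimately have "?R = {x. poly ?p x = 0}"
    using le card_seteq[OF poly_roots_finite[OF p]] by metis
  moreover have "poly ?p v = 0" using v by (simp add: poly_monom)
  ultimately show ?thesis by blast
qed

text \<open>
  Every \<open>n\<close>-th root of unity other than 1 is a root of \<open>1 + x + \<dots> + x\<^sup>n\<^sup>-\<^sup>1\<close>.  If \<open>n\<close> were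
  zero in the field, then 1 would be a root too, and a polynomial of degree at most \<open>n - 1\<close> would
  have \<open>n\<close> roots.
\<close>

lemma primitive_root_of_nat_nonzero:
  assumes l: "primitive_root n (l::'k::field)"
  shows "of_nat n \<noteq> (0::'k)"
proof
  assume 0: "of_nat n = (0::'k)"
  let ?p = "\<Sum>i<n. monom 1 i :: 'k poly" and ?R = "(\<lambda>i. l ^ i) ` {..<n}"
  have n: "n > 0" using l by (simp add: primitive_root_def)
  have "coeff ?p 0 = 1" using n by (simp add: coeff_sum if_distrib sum.If_cases)
  then have p: "?p \<noteq> 0" by (metis coeff_0 zero_neq_one)
  have "degree ?p \<le> n - 1" by (intro degree_sum_le) (auto intro: order_trans[OF degree_monom_le])
  then have le: "card {x. poly ?p x = 0} < n" using card_poly_roots_bound[OF p] n by linarith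
  have "poly ?p v = 0" if v: "v ^ n = 1" for v
  proof (cases "v = 1")
    case True then show ?thesis using 0 by (simp add: poly_sum poly_monom)
  next
    case False
    have "(\<Sum>i<n. v ^ i) = 0" using False v by (simp add: geometric_sum)
    then show ?thesis by (simp add: poly_sum poly_monom)
  qed
  then have "?R \<subseteq> {x. poly ?p x = 0}"
    using primitive_root_pow_order[OF l] by blast
  moreover have "card ?R = n"
    by (subst card_image) (auto simp: inj_on_def primitive_root_pow_eq_iff[OF l])
  ultimately show False
    using le card_mono[OF poly_roots_finite[OF p], of ?R] by simp
qed

lemma primitive_root_power:
  assumes "primitive_root (d * m) (l::'k::field)"
  shows "primitive_root m (l ^ d)"
  using assms by (auto simp: primitive_root_def simp flip: power_mult)


section \<open>Characters and self-duality of finite abelian groups\<close>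

lemma (in comm_group) ord_mult_coprime:
  assumes a: "a \<in> carrier G" and b: "b \<in> carrier G" and co: "coprime (ord a) (ord b)"
  shows "ord (a \<otimes> b) = ord a * ord b"
proof (rule dvd_antisym)
  show "ord (a \<otimes> b) dvd ord a * ord b" by (rule abelian_ord_mul_divides[OF a b])
  have *: "ord x dvd k" if "x \<in> carrier G" "y \<in> carrier G" "coprime (ord x) (ord y)"
    "(x \<otimes> y) [^] k = \<one>" for x y and k :: nat
  proof -
    have "x [^] (k * ord y) = (x \<otimes> y) [^] (k * ord y)"
      using that by (simp add: pow_mult_distrib m_comm nat_pow_closed mult.commute[of k] flip: nat_pow_pow)
    also have "\<dots> = \<one>" using that by (simp flip: nat_pow_pow)
    finally have "ord x dvd k * ord y" using that by (simp add: pow_eq_id)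
    then show ?thesis using that(3) by (simp add: coprime_dvd_mult_left_iff)
  qed
  have "(a \<otimes> b) [^] ord (a \<otimes> b) = \<one>" using a b by simp
  then show "ord a * ord b dvd ord (a \<otimes> b)"
    using *[OF a b co] *[OF b a] co a b by (simp add: divides_mult m_comm coprime_commute)
qed

text \<open>
  An element of maximal order works: if the order of \<open>y\<close> contains a higher power of a prime \<open>p\<close> than
  that of \<open>x\<close>, then exchanging the \<open>p\<close>-part of \<open>x\<close> for that of \<open>y\<close> gives an element of larger order.
\<close>

lemma (in comm_group) max_order_element:
  assumes fin: "finite (carrier G)"
  obtains x where "x \<in> carrier G" "ord x > 0" "\<And>y. y \<in> carrier G \<Longrightarrow> y [^] ord x = \<one>"
proof -
  have pos: "ord y > 0" if "y \<in> carrier G" for y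
    using ord_ge_1[OF fin that] by simp
  have "ord ` carrier G \<noteq> {}" "finite (ord ` carrier G)" using fin by auto
  from Max_in[OF this(2,1)] obtain x where x: "x \<in> carrier G" "ord x = Max (ord ` carrier G)" by auto
  have max: "ord y \<le> ord x" if "y \<in> carrier G" for y using x(2) fin that by simp
  have "ord y dvd ord x" if y: "y \<in> carrier G" for y
  proof (rule ccontr)
    assume "\<not> ord y dvd ord x"
    then obtain p where p: "Factorial_Ring.prime p" "multiplicity p (ord x) < multiplicity p (ord y)"
      using multiplicity_le_imp_dvd[of "ord y" "ord x"] pos[OF y] pos[OF x(1)]
      by (metis not_le neq0_conv)
    define a where "a = multiplicity p (ord x)"
    define b where "b = multiplicity p (ord y)"
    have ab: "a < b" using p(2) by (simp add: a_def b_def)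
    obtain c where c: "ord x = p ^ a * c" using multiplicity_dvd[of p "ord x"] by (auto simp: a_def)
    obtain d where d: "ord y = p ^ b * d" using multiplicity_dvd[of p "ord y"] by (auto simp: b_def)
    have nz: "p ^ a \<noteq> 0" "d \<noteq> 0" "c > 0" "p > 1"
      using p(1) d c pos[OF y] pos[OF x(1)] prime_gt_1_nat[OF p(1)] by (auto intro!: Nat.gr0I)
    have "\<not> p dvd c"
    proof
      assume "p dvd c"
      then have "p ^ Suc a dvd ord x" by (simp add: c mult_dvd_mono mult.commute)
      then have "Suc a \<le> multiplicity p (ord x)"
        using pos[OF x(1)] nz(4) by (intro multiplicity_geI) auto
      then show False by (simp add: a_def)
    qed
    then have "coprime (p ^ b) c"
      using prime_imp_coprime[OF p(1), of c] by simp
    then have co: "coprime c (p ^ b)" by (rule coprime_commute[THEN iffD1])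
    \<comment> \<open>Their orders are the part of the order of \<open>x\<close> prime to \<open>p\<close> and the \<open>p\<close>-part of the order of \<open>y\<close>.\<close>
    let ?x = "x [^] (p ^ a)" and ?y = "y [^] d"
    have ox: "ord ?x = c" using ord_pow[OF x(1), of "p ^ a"] c nz by simp
    have oy: "ord ?y = p ^ b" using ord_pow[OF y, of d] d nz by simp
    have "ord (?x \<otimes> ?y) = c * p ^ b"
      using ord_mult_coprime[of ?x ?y] co x(1) y by (simp add: ox oy)
    moreover have "c * p ^ b > ord x" 
      using nz ab unfolding c by (simp add: mult.commute)
    ultimately show False using max[of "?x \<otimes> ?y"] x(1) y by simp
  qed
  then show ?thesis using that[OF x(1) pos[OF x(1)]] by (simp add: pow_eq_id)
qed

lemma units_group_simps [simp]:
  "carrier units_group = UNIV - {0}" "x \<otimes>\<^bsub>units_group\<^esub> y = x * y" "\<one>\<^bsub>units_group\<^esub> = 1"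
  by (simp_all add: units_group_def)

lemma comm_group_units_group: "comm_group (units_group :: 'k::field monoid)"
proof (rule comm_groupI)
  fix x :: 'k assume "x \<in> carrier units_group"
  then show "\<exists>y\<in>carrier units_group. y \<otimes>\<^bsub>units_group\<^esub> x = \<one>\<^bsub>units_group\<^esub>"
    by (intro bexI[of _ "inverse x"]) auto
qed auto

lemma units_group_inv: "x \<noteq> 0 \<Longrightarrow> inv\<^bsub>units_group\<^esub> x = inverse (x :: 'k::field)"
  by (rule group.inv_equality[OF comm_group.axioms(2)[OF comm_group_units_group]]) auto

lemma units_group_pow [simp]: "x [^]\<^bsub>units_group\<^esub> (n::nat) = (x::'k::field) ^ n"
  by (induction n) (auto simp: nat_pow_def units_group_def)

lemma hom_units_group_iff:
  "f \<in> hom G units_group \<longleftrightarrow>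
    (\<forall>x\<in>carrier G. f x \<noteq> 0) \<and> (\<forall>x\<in>carrier G. \<forall>y\<in>carrier G. f (x \<otimes>\<^bsub>G\<^esub> y) = f x * f y)"
  by (auto simp: hom_def)

lemma (in group) units_hom_one:
  "f \<in> hom G units_group \<Longrightarrow> f \<one> = (1::'k::field)"
  unfolding hom_units_group_iff by (metis l_one mult_cancel_right1 one_closed)

lemma (in group) units_hom_pow:
  assumes "f \<in> hom G units_group" "x \<in> carrier G"
  shows "f (x [^] (n::nat)) = (f x ^ n :: 'k::field)"
  using assms units_hom_one[OF assms(1)] by (induction n) (auto simp: hom_units_group_iff)

lemma (in group) units_hom_inv:
  assumes "f \<in> hom G units_group" "x \<in> carrier G"
  shows "f (inv x) = (inverse (f x) :: 'k::field)"
proof -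
  have "f (inv x) * f x = 1"
    using assms units_hom_one[OF assms(1)] by (metis hom_units_group_iff inv_closed l_inv)
  then show ?thesis by (metis inverse_unique mult.commute)
qed

lemma (in comm_group) subgroup_comm_group:
  assumes "subgroup H G"
  shows "comm_group (G\<lparr>carrier := H\<rparr>)"
  using subgroup.subset[OF assms] m_comm
  by (intro group.group_comm_groupI[OF subgroup.subgroup_is_group[OF assms is_group]]) auto

text \<open>
  A value \<open>c\<close> at \<open>y\<close> that is compatible with the powers of \<open>y\<close> in \<open>H\<close> determines the extension
  \<open>h y\<^sup>i \<mapsto> \<eta> h \<cdot> c\<^sup>i\<close> to the subgroup generated by \<open>H\<close> and \<open>y\<close>.  With \<open>H\<close> trivial this also
  produces characters of cyclic groups.
\<close>

lemma (in comm_group) character_extension_step: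
  fixes \<eta> :: "'a \<Rightarrow> 'k::field"
  assumes fin: "finite (carrier G)" and H: "subgroup H G"
    and \<eta>: "\<eta> \<in> hom (G\<lparr>carrier := H\<rparr>) units_group"
    and y: "y \<in> carrier G" and c: "c \<noteq> 0"
    and compat: "\<And>i::nat. y [^] i \<in> H \<Longrightarrow> \<eta> (y [^] i) = c ^ i"
  shows "\<exists>H' \<eta>'. subgroup H' G \<and> H \<subseteq> H' \<and> y \<in> H' \<and>
    \<eta>' \<in> hom (G\<lparr>carrier := H'\<rparr>) units_group \<and> (\<forall>h\<in>H. \<eta>' h = \<eta> h) \<and> \<eta>' y = c"
proof -
  interpret H: subgroup H G by (rule H)
  have HG: "h \<in> carrier G" if "h \<in> H" for h using that H.subset by blast
  have \<eta>m: "\<eta> (a \<otimes> b) = \<eta> a * \<eta> b" "\<eta> a \<noteq> 0" if "a \<in> H" "b \<in> H" for a b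
    using \<eta> that by (auto simp: hom_units_group_iff)
  have \<eta>1: "\<eta> \<one> = 1" using \<eta>m[of \<one> \<one>] by simp
  \<comment> \<open>Natural exponents suffice, because \<open>y\<close> has finite order.\<close>
  define H' where "H' = {h \<otimes> y [^] (i::nat) |h i. h \<in> H}"
  define \<eta>' where "\<eta>' z = (SOME v. \<exists>h\<in>H. \<exists>i::nat. z = h \<otimes> y [^] i \<and> v = \<eta> h * c ^ i)" for z
  have wd: "\<eta> h * c ^ i = \<eta> h' * c ^ j"
    if "h \<in> H" "h' \<in> H" "h \<otimes> y [^] i = h' \<otimes> y [^] j" for h h' and i j :: nat
    using that
  proof (induction i j arbitrary: h h' rule: linorder_wlog)
    case (le i j)
    have "h \<otimes> y [^] i = (h' \<otimes> y [^] (j - i)) \<otimes> y [^] i"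
      using le y HG by (simp add: m_assoc nat_pow_mult)
    then have h: "h = h' \<otimes> y [^] (j - i)"
      using le.prems y HG by (metis m_closed nat_pow_closed r_cancel)
    then have "y [^] (j - i) = inv h' \<otimes> h"
      using le.prems y HG by (simp flip: m_assoc)
    then have yi: "y [^] (j - i) \<in> H" using le.prems by simp
    then have "\<eta> h = \<eta> h' * c ^ (j - i)" using h \<eta>m(1) le.prems compat by simp
    then show ?case using le.hyps by (simp flip: power_add)
  next
    case (sym i j)
    then show ?case by metis
  qed
  have \<eta>': "\<eta>' (h \<otimes> y [^] i) = \<eta> h * c ^ i" if "h \<in> H" for h and i :: nat
    unfolding \<eta>'_def
  proof (rule some_equality)
    show "\<exists>h'\<in>H. \<exists>j::nat. h \<otimes> y [^] i = h' \<otimes> y [^] j \<and> \<eta> h * c ^ i = \<eta> h' * c ^ j"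
      using that by blast
  next
    fix v assume "\<exists>h'\<in>H. \<exists>j::nat. h \<otimes> y [^] i = h' \<otimes> y [^] j \<and> v = \<eta> h' * c ^ j"
    then obtain h' and j :: nat where "h' \<in> H" "h \<otimes> y [^] i = h' \<otimes> y [^] j" "v = \<eta> h' * c ^ j"
      by blast
    then show "v = \<eta> h * c ^ i" using wd[OF that] by simp
  qed
  have prod: "(h \<otimes> y [^] i) \<otimes> (h' \<otimes> y [^] j) = (h \<otimes> h') \<otimes> y [^] (i + j)"
    if "h \<in> H" "h' \<in> H" for h h' and i j :: nat
    using that HG y by (simp add: nat_pow_mult[symmetric] m_ac)
  have H'G: "H' \<subseteq> carrier G" using HG y by (auto simp: H'_def)
  have "subgroup H' G"
  proof (rule subgroupI)
    show "H' \<noteq> {}" using H.one_closed unfolding H'_def by blast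
  next
    fix a assume "a \<in> H'"
    then obtain h and i :: nat where a: "a = h \<otimes> y [^] i" "h \<in> H" by (auto simp: H'_def)
    have "y [^] (ord y * i - i) \<otimes> y [^] i = y [^] (ord y * i)"
      using y ord_ge_1[OF fin y] by (simp add: nat_pow_mult)
    also have "\<dots> = \<one>" using y by (simp flip: nat_pow_pow)
    finally have "inv (y [^] i) = y [^] (ord y * i - i)" using y by (simp add: inv_equality)
    then have "inv a = inv h \<otimes> y [^] (ord y * i - i)"
      using a HG y by (simp add: inv_mult)
    then show "inv a \<in> H'" using a H.m_inv_closed by (auto simp: H'_def)
  next
    fix a b assume "a \<in> H'" "b \<in> H'"
    then show "a \<otimes> b \<in> H'" using prod H.m_closed by (fastforce simp: H'_def)
  qed (rule H'G)
  moreover have HH': "H \<subseteq> H'"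
  proof
    fix h assume "h \<in> H"
    then have "h = h \<otimes> y [^] (0::nat)" using HG by simp
    then show "h \<in> H'" using \<open>h \<in> H\<close> unfolding H'_def by blast
  qed
  moreover have "y \<in> H'"
  proof -
    have "y = \<one> \<otimes> y [^] (1::nat)" using y by simp
    then show ?thesis using H.one_closed unfolding H'_def by blast
  qed
  moreover have "\<eta>' \<in> hom (G\<lparr>carrier := H'\<rparr>) units_group"
    unfolding hom_units_group_iff
  proof (intro conjI ballI)
    fix a assume "a \<in> carrier (G\<lparr>carrier := H'\<rparr>)"
    then show "\<eta>' a \<noteq> 0" using \<eta>' \<eta>m(2) c by (auto simp: H'_def)
  next
    fix a b assume "a \<in> carrier (G\<lparr>carrier := H'\<rparr>)" "b \<in> carrier (G\<lparr>carrier := H'\<rparr>)"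
    then obtain h h' i j where "a = h \<otimes> y [^] (i::nat)" "b = h' \<otimes> y [^] (j::nat)" "h \<in> H" "h' \<in> H"
      by (auto simp: H'_def)
    then show "\<eta>' (a \<otimes>\<^bsub>G\<lparr>carrier := H'\<rparr>\<^esub> b) = \<eta>' a * \<eta>' b"
      using prod \<eta>' \<eta>m(1) H.m_closed by (simp add: power_add mult_ac)
  qed
  moreover have "\<eta>' h = \<eta> h" if "h \<in> H" for h
    using \<eta>'[OF that, of 0] HG[OF that] by simp
  moreover have "\<eta>' y = c"
    using \<eta>'[OF H.one_closed, of 1] y \<eta>1 by simp
  ultimately show ?thesis by blast
qed

text \<open>
  Start with the character of the cyclic group of \<open>x\<close> that sends \<open>x\<close> to \<open>\<omega>\<close>, and extend it to a
  maximal subgroup \<open>H\<close>.  If \<open>d\<close> is minimal with \<open>y\<^sup>d \<in> H\<close>, then \<open>d\<close> divides the exponent \<open>n\<close> of the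
  group, which is the order of \<open>x\<close>.  The value at \<open>y\<^sup>d\<close> is an \<open>(n/d)\<close>-th root of unity, so it is the
  \<open>d\<close>-th power of a power of \<open>\<omega>\<close>, and the extension step applies to \<open>H\<close> and \<open>y\<close>.  By
  maximality \<open>y \<in> H\<close>.
\<close>

lemma (in comm_group) character_with_value:
  assumes fin: "finite (carrier G)" and exp: "\<And>y. y \<in> carrier G \<Longrightarrow> y [^] ord x = \<one>"
    and x: "x \<in> carrier G" and \<omega>: "primitive_root (ord x) (\<omega> :: 'k::field)"
  obtains \<eta> where "\<eta> \<in> hom G units_group" "\<eta> x = \<omega>"
proof -
  have \<omega>0: "\<omega> \<noteq> 0" by (rule primitive_root_nonzero[OF \<omega>])
  define \<S> where "\<S> = {H. subgroup H G \<and> x \<in> H \<and>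
    (\<exists>\<eta>. \<eta> \<in> hom (G\<lparr>carrier := H\<rparr>) units_group \<and> \<eta> x = \<omega>)}"
  have "\<S> \<subseteq> Pow (carrier G)" by (auto simp: \<S>_def dest: subgroup.subset)
  then have fin\<S>: "finite \<S>" using fin by (meson finite_Pow_iff finite_subset)
  have triv: "(\<lambda>_. 1) \<in> hom (G\<lparr>carrier := {\<one>}\<rparr>) (units_group :: 'k monoid)"
    by (simp add: hom_units_group_iff)
  have triv_compat: "1 = \<omega> ^ i" if "x [^] i \<in> {\<one>}" for i :: nat
    using that x by (simp add: pow_eq_id primitive_root_pow_eq_1_iff[OF \<omega>])
  obtain H0 and \<eta>0 :: "'a \<Rightarrow> 'k" where "subgroup H0 G" "x \<in> H0"
    "\<eta>0 \<in> hom (G\<lparr>carrier := H0\<rparr>) units_group" "\<eta>0 x = \<omega>"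
    using character_extension_step[OF fin triv_subgroup triv x \<omega>0 triv_compat] by blast
  then have "H0 \<in> \<S>" by (auto simp: \<S>_def)
  then have "\<S> \<noteq> {}" by blast
  from finite_has_maximal[OF fin\<S> this]
  obtain H where HS: "H \<in> \<S>" and max: "\<And>H'. H' \<in> \<S> \<Longrightarrow> H \<subseteq> H' \<Longrightarrow> H = H'" by blast
  then obtain \<eta> where H: "subgroup H G" "x \<in> H" "\<eta> \<in> hom (G\<lparr>carrier := H\<rparr>) units_group" "\<eta> x = \<omega>"
    by (auto simp: \<S>_def)
  interpret H: subgroup H G by (rule H)
  interpret GH: group "G\<lparr>carrier := H\<rparr>" by (rule H.subgroup_is_group) (rule is_group)
  have pow: "\<eta> (a [^] i) = \<eta> a ^ i" if "a \<in> H" for a and i :: nat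
    using GH.units_hom_pow[OF H(3)] that nat_pow_consistent[of a i H] by simp
  have "y \<in> H" if y: "y \<in> carrier G" for y
  proof -
    define d where "d = (LEAST i. i > 0 \<and> y [^] (i::nat) \<in> H)"
    have ox: "ord x > 0" using \<omega> by (simp add: primitive_root_def)
    have ex: "ord x > 0 \<and> y [^] ord x \<in> H" using exp[OF y] ox by simp
    have d: "d > 0" "y [^] d \<in> H" using LeastI[of "\<lambda>i. i > 0 \<and> y [^] i \<in> H", OF ex] by (auto simp: d_def)
    have dvd: "d dvd i" if i: "y [^] i \<in> H" for i :: nat
    proof (rule ccontr)
      assume "\<not> d dvd i"
      then have r: "i mod d > 0" by (simp add: dvd_eq_mod_eq_0)
      have "y [^] i = (y [^] d) [^] (i div d) \<otimes> y [^] (i mod d)"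
        using y by (simp add: nat_pow_pow nat_pow_mult)
      then have "y [^] (i mod d) = inv ((y [^] d) [^] (i div d)) \<otimes> y [^] i"
        using y by (simp flip: m_assoc)
      moreover have "(y [^] d) [^] k \<in> H" for k :: nat
        using d(2) by (induction k) auto
      ultimately have "y [^] (i mod d) \<in> H" using i by simp
      then have "(LEAST i. i > 0 \<and> y [^] i \<in> H) \<le> i mod d" using r by (intro Least_le) simp
      then show False using mod_less_divisor[OF d(1), of i] by (simp add: d_def)
    qed
    have "d dvd ord x" using dvd ex by blast
    then obtain q where q: "ord x = d * q" by blast
    have "\<eta> (y [^] d) ^ q = \<eta> \<one>"
      using pow[OF d(2), of q] y exp[OF y] by (simp add: nat_pow_pow q)
    then have eq: "\<eta> (y [^] d) ^ q = 1" using GH.units_hom_one[OF H(3)] by simp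
    then have "\<eta> (y [^] d) ^ ord x = 1" by (metis q mult.commute power_mult power_one)
    then obtain j where j: "\<eta> (y [^] d) = \<omega> ^ j" using primitive_root_exhausts[OF \<omega>] by blast
    have "\<omega> ^ (j * q) = 1" using eq by (simp add: j power_mult)
    then have "d * q dvd j * q" using primitive_root_pow_eq_1_iff[OF \<omega>] q by simp
    then have "d dvd j" using ox q by simp
    then obtain r where r: "j = d * r" by blast
    have compat: "\<eta> (y [^] i) = (\<omega> ^ r) ^ i" if i: "y [^] i \<in> H" for i :: nat
    proof -
      obtain t where t: "i = d * t" using dvd[OF i] by blast
      have "\<eta> (y [^] i) = \<eta> ((y [^] d) [^] t)" using y by (simp add: nat_pow_pow t)
      also have "\<dots> = (\<omega> ^ r) ^ i"
        using pow[OF d(2)] by (simp add: j r t ac_simps flip: power_mult)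
      finally show ?thesis .
    qed
    have "\<omega> ^ r \<noteq> 0" using \<omega>0 by simp
    obtain H' and \<eta>' :: "'a \<Rightarrow> 'k" where H': "subgroup H' G" "H \<subseteq> H'" "y \<in> H'"
      "\<eta>' \<in> hom (G\<lparr>carrier := H'\<rparr>) units_group" "\<And>h. h \<in> H \<Longrightarrow> \<eta>' h = \<eta> h"
      using character_extension_step[OF fin H(1) H(3) y \<open>\<omega> ^ r \<noteq> 0\<close> compat] by blast
    then have "H' \<in> \<S>" using H by (auto simp: \<S>_def)
    then show ?thesis using max H' by blast
  qed
  then have "H = carrier G" using H.subset by blast
  then show ?thesis using that H by simp
qed

definition self_pairing :: "('a, 'm) monoid_scheme \<Rightarrow> ('a \<Rightarrow> 'a \<Rightarrow> 'k::field) \<Rightarrow> bool"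
  where "self_pairing G \<beta> \<longleftrightarrow>
    (\<forall>x\<in>carrier G. \<beta> x \<in> hom G units_group) \<and>
    (\<forall>x\<in>carrier G. \<forall>y\<in>carrier G. \<beta> x y = \<beta> y x) \<and>
    (\<forall>x\<in>carrier G. (\<forall>y\<in>carrier G. \<beta> x y = 1) \<longrightarrow> x = \<one>\<^bsub>G\<^esub>)"

text \<open>
  Since \<open>\<eta>\<close> is faithful on the cyclic group of \<open>x\<close>, and all values of \<open>\<eta>\<close> are powers of \<open>\<eta> x\<close>, the
  group is the direct product of that cyclic group and the kernel \<open>K\<close> of \<open>\<eta>\<close>.  The pairing
  is the product of \<open>(x ^ i, x ^ j) \<mapsto> (\<eta> x) ^ (i j)\<close> and the given pairing on \<open>K\<close>.
\<close>

lemma (in comm_group) self_pairing_split_cyclic: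
  fixes \<eta> :: "'a \<Rightarrow> 'k::field"
  defines "K \<equiv> {y \<in> carrier G. \<eta> y = 1}"
  assumes x: "x \<in> carrier G" "\<And>y. y \<in> carrier G \<Longrightarrow> y [^] ord x = \<one>"
    and \<eta>: "\<eta> \<in> hom G units_group" and \<omega>': "primitive_root (ord x) (\<eta> x)"
    and \<beta>: "self_pairing (G\<lparr>carrier := K\<rparr>) (\<beta> :: 'a \<Rightarrow> 'a \<Rightarrow> 'k)"
  obtains \<beta>' :: "'a \<Rightarrow> 'a \<Rightarrow> 'k" where "self_pairing G \<beta>'"
proof -
  define \<omega> where "\<omega> = \<eta> x"
  note \<omega> = \<omega>'[folded \<omega>_def]
  have \<eta>m: "\<eta> (a \<otimes> b) = \<eta> a * \<eta> b" if "a \<in> carrier G" "b \<in> carrier G" for a b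
    using \<eta> that by (simp add: hom_units_group_iff)
  have K: "subgroup K G"
    using \<eta>m units_hom_one[OF \<eta>] units_hom_inv[OF \<eta>]
    by (auto simp: K_def intro!: subgroupI)
  interpret K: comm_group "G\<lparr>carrier := K\<rparr>"
    using K by (rule subgroup_comm_group)
  define ix where "ix y = (LEAST i. \<eta> y = \<omega> ^ i)" for y
  have ix: "\<eta> y = \<omega> ^ ix y" if "y \<in> carrier G" for y
  proof -
    have "\<eta> y ^ ord x = 1" using units_hom_pow[OF \<eta> that] x(2)[OF that] units_hom_one[OF \<eta>] by metis
    then show ?thesis
      using primitive_root_exhausts[OF \<omega>] unfolding ix_def by (metis (mono_tags, lifting) LeastI)
  qed
  have xpow: "x [^] i = x [^] j" if "\<omega> ^ i = \<omega> ^ j" for i j :: nat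
  proof -
    have "i mod ord x = j mod ord x" using that primitive_root_pow_eq_iff[OF \<omega>] by blast
    moreover have "x [^] k = x [^] (k mod ord x)" for k
    proof -
      have "x [^] k = (x [^] ord x) [^] (k div ord x) \<otimes> x [^] (k mod ord x)"
        unfolding nat_pow_pow[OF x(1)] nat_pow_mult[OF x(1)] by simp
      then show ?thesis using x(1) by simp
    qed
    ultimately show ?thesis by metis
  qed
  \<comment> \<open>The component of \<open>y\<close> in \<open>K\<close>; the one in the cyclic group of \<open>x\<close> is \<open>x\<^sup>i\<close> for \<open>i = ix y\<close>.\<close>
  define \<kappa> where "\<kappa> y = y \<otimes> inv (x [^] ix y)" for y
  have \<kappa>K: "\<kappa> y \<in> K" if "y \<in> carrier G" for y
    using that x(1) \<eta>m units_hom_inv[OF \<eta>] units_hom_pow[OF \<eta>] ix[OF that] primitive_root_nonzero[OF \<omega>]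
    by (simp add: \<kappa>_def K_def \<omega>_def[symmetric])
  have \<kappa>m: "\<kappa> (y \<otimes> z) = \<kappa> y \<otimes> \<kappa> z" if "y \<in> carrier G" "z \<in> carrier G" for y z
  proof -
    have "\<omega> ^ ix (y \<otimes> z) = \<omega> ^ (ix y + ix z)"
      using ix[OF that(1)] ix[OF that(2)] ix[of "y \<otimes> z"] \<eta>m[OF that] that by (simp add: power_add)
    then have "x [^] ix (y \<otimes> z) = x [^] ix y \<otimes> x [^] ix z"
      using xpow[of "ix (y \<otimes> z)" "ix y + ix z"] x(1) by (simp add: nat_pow_mult)
    then show ?thesis using that x(1) by (simp add: \<kappa>_def inv_mult m_ac)
  qed
  define \<beta>' where "\<beta>' y z = \<omega> ^ (ix y * ix z) * \<beta> (\<kappa> y) (\<kappa> z)" for y z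
  have \<beta>'\<eta>: "\<beta>' y z = \<eta> z ^ ix y * \<beta> (\<kappa> y) (\<kappa> z)" if "z \<in> carrier G" for y z
    using ix[OF that] by (simp add: \<beta>'_def mult.commute flip: power_mult)
  have "self_pairing G \<beta>'"
    unfolding self_pairing_def
  proof (intro conjI ballI impI)
    fix y assume y: "y \<in> carrier G"
    then have "\<beta> (\<kappa> y) \<in> hom (G\<lparr>carrier := K\<rparr>) units_group"
      using \<beta> \<kappa>K by (simp add: self_pairing_def)
    then show "\<beta>' y \<in> hom G units_group"
      using \<eta> \<kappa>K by (simp add: hom_units_group_iff \<beta>'\<eta> \<kappa>m power_mult_distrib mult_ac)
  next
    fix y z assume "y \<in> carrier G" "z \<in> carrier G"
    then show "\<beta>' y z = \<beta>' z y"
      using \<beta> \<kappa>K by (simp add: \<beta>'_def self_pairing_def mult.commute)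
  next
    fix y assume y: "y \<in> carrier G" and rad: "\<forall>z\<in>carrier G. \<beta>' y z = 1"
    have \<beta>1: "\<beta> k \<one> = 1" if "k \<in> K" for k
      using \<beta> that K.units_hom_one[of "\<beta> k"] by (simp add: self_pairing_def)
    have "x [^] ix x = x [^] (1::nat)" using ix[OF x(1)] \<omega>_def[symmetric] by (intro xpow) simp
    then have "\<kappa> x = \<one>" using x(1) by (simp add: \<kappa>_def)
    then have "\<omega> ^ ix y = 1"
      using \<beta>'\<eta>[OF x(1), of y] rad x(1) \<beta>1[OF \<kappa>K[OF y]] by (simp add: \<omega>_def)
    then have yK: "y \<in> K" using ix[OF y] y by (simp add: K_def)
    have \<kappa>id: "\<kappa> z = z" if "z \<in> K" for z
    proof -
      have "x [^] ix z = x [^] (0::nat)" using that ix[of z] by (intro xpow) (simp add: K_def)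
      then show ?thesis using that by (simp add: \<kappa>_def K_def)
    qed
    have "\<beta> y z = 1" if "z \<in> K" for z
      using rad that \<kappa>id yK \<beta>'\<eta>[of z y] by (simp add: K_def)
    then show "y = \<one>" using \<beta> yK by (simp add: self_pairing_def)
  qed
  then show ?thesis by (rule that)
qed

text \<open>
  Stated with a multiple \<open>E\<close> of the exponent in place of the group order, so that the
  hypotheses pass to the subgroups met in the induction.
\<close>

lemma self_pairing_exists:
  assumes "comm_group G" "finite (carrier G)" "primitive_root E (w::'k::field)"
    and "\<And>x. x \<in> carrier G \<Longrightarrow> x [^]\<^bsub>G\<^esub> E = \<one>\<^bsub>G\<^esub>"
  shows "\<exists>\<beta> :: 'a \<Rightarrow> 'a \<Rightarrow> 'k. self_pairing (G :: ('a, 'm) monoid_scheme) \<beta>"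
  using assms
proof (induction "card (carrier G)" arbitrary: G rule: less_induct)
  case less
  interpret comm_group G by (rule less.prems)
  note fin = less.prems(2) and w = less.prems(3) and E = less.prems(4)
  obtain x where x: "x \<in> carrier G" "ord x > 0"
    "\<And>y. y \<in> carrier G \<Longrightarrow> y [^]\<^bsub>G\<^esub> ord x = \<one>\<^bsub>G\<^esub>"
    using max_order_element[OF fin] by blast
  show ?case
  proof (cases "ord x = 1")
    case True
    then have "carrier G \<subseteq> {\<one>\<^bsub>G\<^esub>}" using x(3) by force
    then show ?thesis
      by (intro exI[of _ "\<lambda>_ _. 1"]) (auto simp: self_pairing_def hom_units_group_iff)
  next
    case False
    have "ord x dvd E" using E[OF x(1)] x(1) by (simp add: pow_eq_id)
    then obtain q where "E = q * ord x" by (metis dvd_def mult.commute)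
    then have \<omega>: "primitive_root (ord x) (w ^ q)"
      using primitive_root_power[of q "ord x" w] w by simp
    obtain \<eta> where \<eta>: "\<eta> \<in> hom G units_group" "\<eta> x = w ^ q"
      using character_with_value[OF fin x(3) x(1) \<omega>] by blast
    define K where "K = {y \<in> carrier G. \<eta> y = 1}"
    have K: "subgroup K G"
      using \<eta>(1) units_hom_one[OF \<eta>(1)] units_hom_inv[OF \<eta>(1)]
      by (auto simp: K_def hom_units_group_iff intro!: subgroupI)
    have "x \<notin> K"
      using False primitive_root_pow_eq_1_iff[OF \<omega>, of 1] \<eta>(2) by (auto simp: K_def)
    then have "K \<subset> carrier G" using x(1) by (auto simp: K_def)
    then have "card K < card (carrier G)" using fin by (rule psubset_card_mono[rotated])
    then have "\<exists>\<beta> :: 'a \<Rightarrow> 'a \<Rightarrow> 'k. self_pairing (G\<lparr>carrier := K\<rparr>) \<beta>"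
      using fin w E subgroup_comm_group[OF K] \<open>K \<subset> carrier G\<close>
      by (intro less.hyps) (auto intro: finite_subset simp flip: nat_pow_consistent)
    then show ?thesis
      using self_pairing_split_cyclic[OF x(1,3) \<eta>(1)] \<omega> \<eta>(2) unfolding K_def by metis
  qed
qed


section \<open>Linear forms and linear maps on free vector spaces\<close>

lemma lin_form_superset:
  assumes "finite S" "Poly_Mapping.keys f \<subseteq> S"
  shows "lin_form \<phi> f = (\<Sum>x\<in>S. Poly_Mapping.lookup f x * \<phi> x)"
  unfolding lin_form_def using assms
  by (intro sum.mono_neutral_left) (auto simp: in_keys_iff)

lemma lin_form_add: "lin_form \<phi> (f + g) = lin_form \<phi> f + lin_form \<phi> g"
proof -
  let ?S = "Poly_Mapping.keys f \<union> Poly_Mapping.keys g"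
  show ?thesis
    using keys_add[of f g]
    by (simp add: lin_form_superset[of ?S f] lin_form_superset[of ?S g]
        lin_form_superset[of ?S "f + g"] lookup_add distrib_right sum.distrib)
qed

lemma lin_form_scale: "lin_form \<phi> (scale c f) = c * lin_form \<phi> f"
proof -
  have "Poly_Mapping.keys (scale c f) \<subseteq> Poly_Mapping.keys f"
    by (auto simp: in_keys_iff)
  then show ?thesis
    by (simp add: lin_form_superset[of "Poly_Mapping.keys f"] sum_distrib_left mult.assoc)
qed

lemma lin_form_zero [simp]: "lin_form \<phi> 0 = 0"
  by (simp add: lin_form_def)

lemma lin_form_sum: "lin_form \<phi> (sum f A) = (\<Sum>x\<in>A. lin_form \<phi> (f x))"
  by (induction A rule: infinite_finite_induct) (auto simp: lin_form_add)

lemma lin_form_lin_ext: "lin_form \<phi> (lin_ext \<psi> f) = lin_form (\<lambda>x. lin_form \<phi> (\<psi> x)) f"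
  unfolding lin_ext_def lin_form_sum lin_form_scale by (simp add: lin_form_def)

lemma lin_form_bilin_ext:
  "lin_form \<phi> (bilin_ext \<psi> f g) = lin_form (\<lambda>x. lin_form (\<lambda>y. lin_form \<phi> (\<psi> x y)) g) f"
  by (simp add: bilin_ext_def lin_form_lin_ext)

lemma lin_ext_lin_ext: "lin_ext \<phi> (lin_ext \<psi> f) = lin_ext (\<lambda>x. lin_ext \<phi> (\<psi> x)) f"
  unfolding lin_ext_def[of \<psi>] lin_ext_sum lin_ext_scale by (simp add: lin_ext_def)

lemma lin_ext_fspan_cong:
  "f \<in> fspan S \<Longrightarrow> (\<And>x. x \<in> S \<Longrightarrow> \<phi> x = \<psi> x) \<Longrightarrow> lin_ext \<phi> f = lin_ext \<psi> f"
  unfolding lin_ext_def fspan_def by (intro sum.cong) auto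

lemma lin_form_cong:
  "(\<And>x. x \<in> Poly_Mapping.keys f \<Longrightarrow> \<phi> x = \<psi> x) \<Longrightarrow> lin_form \<phi> f = lin_form \<psi> f"
  by (simp add: lin_form_def)

lemma lin_form_fspan_cong:
  "f \<in> fspan S \<Longrightarrow> (\<And>x. x \<in> S \<Longrightarrow> \<phi> x = \<psi> x) \<Longrightarrow> lin_form \<phi> f = lin_form \<psi> f"
  by (rule lin_form_cong) (auto simp: fspan_def)

lemma lin_form_mult_left: "lin_form (\<lambda>x. c * \<phi> x) f = c * lin_form \<phi> f"
  by (simp add: lin_form_def sum_distrib_left mult.left_commute)

lemma lin_form_mult_right: "lin_form (\<lambda>x. \<phi> x * c) f = lin_form \<phi> f * c"
  by (simp add: lin_form_def sum_distrib_right mult.assoc)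

lemma lin_form_tens:
  "lin_form (\<lambda>(x, y). \<phi> x * \<psi> y) (tens f g) = lin_form \<phi> f * lin_form \<psi> g"
  by (simp add: tens_def lin_form_bilin_ext lin_form_mult_left lin_form_mult_right)

lemma lin_form_tens_map:
  "lin_form (\<lambda>(x, y). \<phi> x * \<psi> y) (tens_map F F' z) =
    lin_form (\<lambda>(x, y). lin_form \<phi> (F (bvec x)) * lin_form \<psi> (F' (bvec y))) z"
  unfolding tens_map_def lin_form_lin_ext
  by (rule lin_form_cong) (auto simp: lin_form_tens)

lemma fspan_bvec [simp]: "(bvec x :: 'x \<Rightarrow>\<^sub>0 'k::field) \<in> fspan S \<longleftrightarrow> x \<in> S"
  by (simp add: fspan_def)

lemma fspan_lookup: "f \<in> fspan S \<Longrightarrow> x \<notin> S \<Longrightarrow> Poly_Mapping.lookup f x = 0"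
  by (auto simp: fspan_def in_keys_iff)

lemma fspan_zero [simp]: "0 \<in> fspan S"
  by (simp add: fspan_def)

lemma fspan_add: "f \<in> fspan S \<Longrightarrow> g \<in> fspan S \<Longrightarrow> f + g \<in> fspan S"
  using keys_add[of f g] by (auto simp: fspan_def)

lemma fspan_scale: "f \<in> fspan S \<Longrightarrow> scale c f \<in> fspan S"
  by (auto simp: fspan_def in_keys_iff subset_iff)

lemma fspan_sum: "(\<And>x. x \<in> A \<Longrightarrow> f x \<in> fspan S) \<Longrightarrow> sum f A \<in> fspan S"
  by (induction A rule: infinite_finite_induct) (auto intro: fspan_add)

lemma fspan_lin_ext:
  "f \<in> fspan S \<Longrightarrow> (\<And>x. x \<in> S \<Longrightarrow> \<psi> x \<in> fspan T) \<Longrightarrow> lin_ext \<psi> f \<in> fspan T"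
  unfolding lin_ext_def by (intro fspan_sum fspan_scale) (auto simp: fspan_def)

lemma fspan_tens: "f \<in> fspan S \<Longrightarrow> g \<in> fspan T \<Longrightarrow> tens f g \<in> fspan (S \<times> T)"
  unfolding tens_def bilin_ext_def
  by (intro fspan_lin_ext[of f S] fspan_lin_ext[of g T]) auto

lemma fspan_tens_map:
  assumes "z \<in> fspan (S \<times> T)" "\<And>x. x \<in> S \<Longrightarrow> F (bvec x) \<in> fspan S'"
    "\<And>y. y \<in> T \<Longrightarrow> F' (bvec y) \<in> fspan T'"
  shows "tens_map F F' z \<in> fspan (S' \<times> T')"
  unfolding tens_map_def using assms by (intro fspan_lin_ext[of z]) (auto intro!: fspan_tens)

lemma basis_expansion: "f = (\<Sum>x\<in>Poly_Mapping.keys f. scale (Poly_Mapping.lookup f x) (bvec x))"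
proof (rule poly_mapping_eqI)
  fix y
  show "Poly_Mapping.lookup f y =
    Poly_Mapping.lookup (\<Sum>x\<in>Poly_Mapping.keys f. scale (Poly_Mapping.lookup f x) (bvec x)) y"
    by (simp add: lookup_sum lookup_single when_def if_distrib sum.delta' in_keys_iff cong: if_cong)
qed

lemma lin_ext_bvec_id: "lin_ext bvec f = f"
  using basis_expansion[of f] by (simp add: lin_ext_def)

lemma bilin_ext_fspan_cong:
  assumes "f \<in> fspan S" "g \<in> fspan T" "\<And>x y. x \<in> S \<Longrightarrow> y \<in> T \<Longrightarrow> \<phi> x y = \<psi> x y"
  shows "bilin_ext \<phi> f g = bilin_ext \<psi> f g"
  unfolding bilin_ext_def
  using assms by (intro lin_ext_fspan_cong[OF assms(1)] lin_ext_fspan_cong[OF assms(2)]) auto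

lemma lin_form_lin_ext_fspan_cong:
  assumes "f \<in> fspan S" "\<And>x. x \<in> S \<Longrightarrow> lin_form \<phi> (\<psi> x) = \<chi> x"
  shows "lin_form \<phi> (lin_ext \<psi> f) = lin_form \<chi> f"
  unfolding lin_form_lin_ext using assms by (intro lin_form_fspan_cong) auto

lemma linear_on_sum:
  assumes F: "linear_on (fspan S) F" and A: "\<And>x. x \<in> A \<Longrightarrow> f x \<in> fspan S"
  shows "F (\<Sum>x\<in>A. scale (c x) (f x)) = (\<Sum>x\<in>A. scale (c x) (F (f x)))"
  using A
proof (induction A rule: infinite_finite_induct)
  case (insert a A)
  then show ?case
    using F fspan_sum[of A "\<lambda>x. scale (c x) (f x)" S] by (simp add: linear_on_def fspan_scale)
next
  case empty
  have "F (scale 0 0) = scale 0 (F 0)" using F unfolding linear_on_def by (metis fspan_zero)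
  then show ?case by simp
next
  case (infinite A)
  have "F (scale 0 0) = scale 0 (F 0)" using F unfolding linear_on_def by (metis fspan_zero)
  then show ?case using infinite by simp
qed

lemma linear_on_eq_lin_ext:
  assumes "linear_on (fspan S) F" "f \<in> fspan S"
  shows "F f = lin_ext (\<lambda>x. F (bvec x)) f"
  using linear_on_sum[OF assms(1), of "Poly_Mapping.keys f" bvec "Poly_Mapping.lookup f"] assms(2)
  by (subst (1) basis_expansion) (auto simp: lin_ext_def fspan_def)

lemma linear_on_lin_form:
  assumes "linear_on (fspan S) F" "f \<in> fspan S"
  shows "lin_form \<phi> (F f) = lin_form (\<lambda>x. lin_form \<phi> (F (bvec x))) f"
  using linear_on_eq_lin_ext[OF assms] by (simp add: lin_form_lin_ext)


section \<open>Perfect pairings and Fourier inversion\<close>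

lemma (in comm_group) sum_character:
  fixes \<chi> :: "'a \<Rightarrow> 'k::field"
  assumes fin: "finite (carrier G)" and \<chi>: "\<chi> \<in> hom G units_group"
    and y: "y \<in> carrier G" "\<chi> y \<noteq> 1"
  shows "(\<Sum>x\<in>carrier G. \<chi> x) = 0"
proof -
  have "bij_betw (\<lambda>x. y \<otimes> x) (carrier G) (carrier G)"
    using y by (intro bij_betwI[of _ _ _ "\<lambda>x. inv y \<otimes> x"]) (auto simp flip: m_assoc)
  then have "(\<Sum>x\<in>carrier G. \<chi> x) = (\<Sum>x\<in>carrier G. \<chi> (y \<otimes> x))"
    by (rule sum.reindex_bij_betw[symmetric])
  also have "\<dots> = \<chi> y * (\<Sum>x\<in>carrier G. \<chi> x)"
    using \<chi> y by (simp add: hom_units_group_iff sum_distrib_left)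
  finally show ?thesis using y(2) by (simp add: mult_cancel_right1)
qed

text \<open>
  The groups \<open>P\<close> and \<open>Y\<close> are character groups of each other.  The elements of \<open>P\<close> are used as
  points, at which the elements of the group algebra \<open>k[Y]\<close> are evaluated.
\<close>

locale perfect_pairing = P: comm_group P + Y: comm_group Y
  for P :: "('p, 'm) monoid_scheme" (structure) and Y :: "('x, 'n) monoid_scheme" (structure) +
  fixes B :: "'p \<Rightarrow> 'x \<Rightarrow> 'k::field"
  assumes finP: "finite (carrier P)" and finY: "finite (carrier Y)"
    and char_Y: "p \<in> carrier P \<Longrightarrow> B p \<in> hom Y units_group"
    and char_P: "x \<in> carrier Y \<Longrightarrow> (\<lambda>p. B p x) \<in> hom P units_group"
    and nondeg_P: "p \<in> carrier P \<Longrightarrow> (\<And>x. x \<in> carrier Y \<Longrightarrow> B p x = 1) \<Longrightarrow> p = \<one>\<^bsub>P\<^esub>"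
    and nondeg_Y: "x \<in> carrier Y \<Longrightarrow> (\<And>p. p \<in> carrier P \<Longrightarrow> B p x = 1) \<Longrightarrow> x = \<one>\<^bsub>Y\<^esub>"
    and cardP: "of_nat (card (carrier P)) \<noteq> (0 :: 'k)"
    and cardY: "of_nat (card (carrier Y)) \<noteq> (0 :: 'k)"
begin

definition ev :: "'p \<Rightarrow> ('x \<Rightarrow>\<^sub>0 'k) \<Rightarrow> 'k"
  where "ev p = lin_form (B p)"

lemma B_mult_Y: "p \<in> carrier P \<Longrightarrow> x \<in> carrier Y \<Longrightarrow> y \<in> carrier Y \<Longrightarrow>
    B p (x \<otimes>\<^bsub>Y\<^esub> y) = B p x * B p y"
  using char_Y by (simp add: hom_units_group_iff)

lemma B_mult_P: "p \<in> carrier P \<Longrightarrow> q \<in> carrier P \<Longrightarrow> x \<in> carrier Y \<Longrightarrow>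
    B (p \<otimes>\<^bsub>P\<^esub> q) x = B p x * B q x"
  using char_P by (simp add: hom_units_group_iff)

lemma B_nonzero: "p \<in> carrier P \<Longrightarrow> x \<in> carrier Y \<Longrightarrow> B p x \<noteq> 0"
  using char_Y by (simp add: hom_units_group_iff)

lemma B_one_Y [simp]: "p \<in> carrier P \<Longrightarrow> B p \<one>\<^bsub>Y\<^esub> = 1"
  using char_Y Y.units_hom_one by blast

lemma B_one_P [simp]: "x \<in> carrier Y \<Longrightarrow> B \<one>\<^bsub>P\<^esub> x = 1"
  using char_P P.units_hom_one by blast

lemma B_inv_Y: "p \<in> carrier P \<Longrightarrow> x \<in> carrier Y \<Longrightarrow> B p (inv\<^bsub>Y\<^esub> x) = inverse (B p x)"
  using char_Y Y.units_hom_inv by blast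

lemma B_inv_P: "p \<in> carrier P \<Longrightarrow> x \<in> carrier Y \<Longrightarrow> B (inv\<^bsub>P\<^esub> p) x = inverse (B p x)"
  using char_P P.units_hom_inv by blast

lemma B_inject:
  assumes "p \<in> carrier P" "q \<in> carrier P" "\<And>x. x \<in> carrier Y \<Longrightarrow> B p x = B q x"
  shows "p = q"
proof -
  have "p \<otimes>\<^bsub>P\<^esub> inv\<^bsub>P\<^esub> q = \<one>\<^bsub>P\<^esub>"
    using assms by (intro nondeg_P) (auto simp: B_mult_P B_inv_P B_nonzero)
  then show ?thesis using assms by (metis P.inv_closed P.inv_equality P.inv_inv)
qed

lemma sum_B_P:
  assumes "x \<in> carrier Y" "y \<in> carrier Y"
  shows "(\<Sum>p\<in>carrier P. B p x / B p y) = (if x = y then of_nat (card (carrier P)) else 0)"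
proof (cases "x = y")
  case True
  then show ?thesis using assms by (simp add: B_nonzero)
next
  case False
  let ?z = "x \<otimes>\<^bsub>Y\<^esub> inv\<^bsub>Y\<^esub> y"
  have z: "?z \<in> carrier Y" using assms by simp
  have "?z \<noteq> \<one>\<^bsub>Y\<^esub>" using False assms by (metis Y.inv_closed Y.inv_equality Y.inv_inv)
  then obtain p where p: "p \<in> carrier P" "B p ?z \<noteq> 1" using nondeg_Y[OF z] by blast
  have "(\<Sum>p\<in>carrier P. B p ?z) = 0"
    using P.sum_character[OF finP char_P[OF z] p] .
  then show ?thesis using False assms by (simp add: B_mult_Y B_inv_Y divide_inverse)
qed

text \<open>
  Stated for an arbitrary character \<open>\<chi>\<close>, since it also serves to show that every character
  is given by a point.
\<close>

lemma sum_character_ratio: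
  assumes \<chi>: "\<chi> \<in> hom Y units_group" and p: "p \<in> carrier P"
    and neq: "x \<in> carrier Y" "B p x \<noteq> \<chi> x"
  shows "(\<Sum>x\<in>carrier Y. B p x / \<chi> x) = 0"
proof -
  have \<chi>0: "\<chi> x \<noteq> 0" if "x \<in> carrier Y" for x using \<chi> that by (simp add: hom_units_group_iff)
  have "(\<lambda>x. B p x / \<chi> x) \<in> hom Y units_group"
    using \<chi> char_Y[OF p] by (simp add: hom_units_group_iff)
  moreover have "B p x / \<chi> x \<noteq> 1" using neq \<chi>0 by simp
  ultimately show ?thesis using Y.sum_character[OF finY] neq(1) by blast
qed

text \<open>
  Fourier inversion: the coefficients can be recovered from the values at the points.
\<close>

lemma ev_eqI:
  assumes "f \<in> fspan (carrier Y)" "g \<in> fspan (carrier Y)"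
    and ev: "\<And>p. p \<in> carrier P \<Longrightarrow> ev p f = ev p g"
  shows "f = g"
proof -
  have fourier: "(\<Sum>p\<in>carrier P. ev p h / B p x) =
      of_nat (card (carrier P)) * Poly_Mapping.lookup h x"
    if "h \<in> fspan (carrier Y)" "x \<in> carrier Y" for h x
  proof -
    have "(\<Sum>p\<in>carrier P. ev p h / B p x) =
        (\<Sum>p\<in>carrier P. \<Sum>y\<in>carrier Y. Poly_Mapping.lookup h y * (B p y / B p x))"
      using that(1) lin_form_superset[OF finY, of h]
      by (simp add: ev_def fspan_def sum_divide_distrib)
    also have "\<dots> = (\<Sum>y\<in>carrier Y. Poly_Mapping.lookup h y * (\<Sum>p\<in>carrier P. B p y / B p x))"
      by (subst sum.swap) (simp add: sum_distrib_left)
    also have "\<dots> = of_nat (card (carrier P)) * Poly_Mapping.lookup h x"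
      using that(2) finY by (simp add: sum_B_P if_distrib sum.delta cong: if_cong)
    finally show ?thesis .
  qed
  show ?thesis
  proof (rule poly_mapping_eqI)
    fix x
    show "Poly_Mapping.lookup f x = Poly_Mapping.lookup g x"
    proof (cases "x \<in> carrier Y")
      case True
      have "(\<Sum>p\<in>carrier P. ev p f / B p x) = (\<Sum>p\<in>carrier P. ev p g / B p x)"
        using ev by simp
      then show ?thesis
        unfolding fourier[OF assms(1) True] fourier[OF assms(2) True] using cardP by simp
    next
      case False
      then show ?thesis using fspan_lookup[OF assms(1)] fspan_lookup[OF assms(2)] by simp
    qed
  qed
qed

text \<open>
  Otherwise \<open>\<Sum>\<^sub>x \<chi>(x)\<^sup>-\<^sup>1 x\<close> would vanish at every point by orthogonality, although its
  coefficient at the unit is 1.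
\<close>

lemma character_is_evaluation:
  assumes \<chi>: "\<chi> \<in> hom Y units_group"
  shows "\<exists>p\<in>carrier P. \<forall>x\<in>carrier Y. \<chi> x = B p x"
proof (rule ccontr)
  assume *: "\<not> ?thesis"
  let ?f = "\<Sum>x\<in>carrier Y. scale (inverse (\<chi> x)) (bvec x)"
  have f: "?f \<in> fspan (carrier Y)" by (intro fspan_sum fspan_scale) simp
  have "ev p ?f = ev p 0" if p: "p \<in> carrier P" for p
  proof -
    obtain x where "x \<in> carrier Y" "B p x \<noteq> \<chi> x" using * p by fastforce
    from sum_character_ratio[OF \<chi> p this] show ?thesis
      by (simp add: ev_def lin_form_sum lin_form_scale divide_inverse mult.commute)
  qed
  then have "?f = 0" using f by (intro ev_eqI) auto
  then have "Poly_Mapping.lookup ?f \<one>\<^bsub>Y\<^esub> = 0" by simp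
  then have "inverse (\<chi> \<one>\<^bsub>Y\<^esub>) = 0"
    using finY by (simp add: lookup_sum lookup_single when_def if_distrib sum.delta' cong: if_cong)
  then show False using Y.units_hom_one[OF \<chi>] by simp
qed

text \<open>
  A combination of the primitive idempotents of \<open>k[Y]\<close>; the inner sum divided by the order of \<open>Y\<close> is
  the idempotent of the point \<open>p\<close>.
\<close>

definition interpolate :: "('p \<Rightarrow> 'k) \<Rightarrow> ('x \<Rightarrow>\<^sub>0 'k)"
  where "interpolate v = (\<Sum>p\<in>carrier P. scale (v p / of_nat (card (carrier Y)))
    (\<Sum>x\<in>carrier Y. scale (inverse (B p x)) (bvec x)))"

lemma interpolate_fspan: "interpolate v \<in> fspan (carrier Y)"
  unfolding interpolate_def by (intro fspan_sum fspan_scale) simp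

lemma ev_interpolate:
  assumes q: "q \<in> carrier P"
  shows "ev q (interpolate v) = v q"
proof -
  have "(\<Sum>x\<in>carrier Y. B q x / B p x) = (if p = q then of_nat (card (carrier Y)) else 0)"
    if p: "p \<in> carrier P" for p
  proof (cases "p = q")
    case True then show ?thesis using q by (simp add: B_nonzero)
  next
    case False
    then obtain x where "x \<in> carrier Y" "B q x \<noteq> B p x" using B_inject p q by metis
    then show ?thesis using sum_character_ratio[OF char_Y[OF p] q] False by simp
  qed
  then have orth: "(\<Sum>x\<in>carrier Y. inverse (B p x) * B q x) = (if p = q then of_nat (card (carrier Y)) else 0)"
    if "p \<in> carrier P" for p using that by (simp add: divide_inverse mult.commute)
  have "ev q (interpolate v) = (\<Sum>p\<in>carrier P. v p / of_nat (card (carrier Y)) *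
      (\<Sum>x\<in>carrier Y. inverse (B p x) * B q x))"
    by (simp add: interpolate_def ev_def lin_form_sum lin_form_scale)
  also have "\<dots> = (\<Sum>p\<in>carrier P. if p = q then v p else 0)"
    by (intro sum.cong refl) (simp add: orth cardY)
  also have "\<dots> = v q" using q finP by simp
  finally show ?thesis .
qed

end

lemma DirProd_is_comm_group:
  assumes "comm_group G" "comm_group H"
  shows "comm_group (G \<times>\<times> H)"
proof -
  interpret G: comm_group G by (rule assms)
  interpret H: comm_group H by (rule assms)
  show ?thesis
    by (rule group.group_comm_groupI[OF DirProd_group])
      (auto intro: G.is_group H.is_group G.m_comm H.m_comm)
qed

lemma perfect_pairing_product:
  fixes B :: "'p \<Rightarrow> 'x \<Rightarrow> 'k::field" and B' :: "'q \<Rightarrow> 'y \<Rightarrow> 'k"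
  assumes "perfect_pairing P Y B" "perfect_pairing P' Y' B'"
  shows "perfect_pairing (P \<times>\<times> P') (Y \<times>\<times> Y') (\<lambda>(p, p') (x, x'). B p x * B' p' x')"
proof -
  interpret A: perfect_pairing P Y B by (rule assms)
  interpret A': perfect_pairing P' Y' B' by (rule assms)
  interpret PP: comm_group "P \<times>\<times> P'" by (rule DirProd_is_comm_group) unfold_locales
  interpret XX: comm_group "Y \<times>\<times> Y'" by (rule DirProd_is_comm_group) unfold_locales
  show ?thesis
  proof
    show "finite (carrier (P \<times>\<times> P'))" "finite (carrier (Y \<times>\<times> Y'))"
      by (simp_all add: A.finP A'.finP A.finY A'.finY)
    show "of_nat (card (carrier (P \<times>\<times> P'))) \<noteq> (0::'k)" "of_nat (card (carrier (Y \<times>\<times> Y'))) \<noteq> (0::'k)"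
      by (simp_all add: A.cardP A'.cardP A.cardY A'.cardY card_cartesian_product)
  next
    fix p assume "p \<in> carrier (P \<times>\<times> P')"
    then show "(\<lambda>(p, p') (x, x'). B p x * B' p' x') p \<in> hom (Y \<times>\<times> Y') units_group"
      by (auto simp: hom_units_group_iff A.B_mult_Y A'.B_mult_Y A.B_nonzero A'.B_nonzero)
  next
    fix x assume "x \<in> carrier (Y \<times>\<times> Y')"
    then show "(\<lambda>p. (\<lambda>(p, p') (x, x'). B p x * B' p' x') p x) \<in> hom (P \<times>\<times> P') units_group"
      by (auto simp: hom_units_group_iff A.B_mult_P A'.B_mult_P A.B_nonzero A'.B_nonzero)
  next
    fix p assume p: "p \<in> carrier (P \<times>\<times> P')"
      and 1: "\<And>x. x \<in> carrier (Y \<times>\<times> Y') \<Longrightarrow> (\<lambda>(p, p') (x, x'). B p x * B' p' x') p x = 1"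
    obtain a b where ab: "p = (a, b)" "a \<in> carrier P" "b \<in> carrier P'" using p by auto
    have "B a x = 1" if "x \<in> carrier Y" for x using 1[of "(x, \<one>\<^bsub>Y'\<^esub>)"] that ab by simp
    moreover have "B' b x = 1" if "x \<in> carrier Y'" for x using 1[of "(\<one>\<^bsub>Y\<^esub>, x)"] that ab by simp
    ultimately show "p = \<one>\<^bsub>P \<times>\<times> P'\<^esub>" using A.nondeg_P A'.nondeg_P ab by simp
  next
    fix x assume x: "x \<in> carrier (Y \<times>\<times> Y')"
      and 1: "\<And>p. p \<in> carrier (P \<times>\<times> P') \<Longrightarrow> (\<lambda>(p, p') (x, x'). B p x * B' p' x') p x = 1"
    obtain a b where ab: "x = (a, b)" "a \<in> carrier Y" "b \<in> carrier Y'" using x by auto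
    have "B p a = 1" if "p \<in> carrier P" for p using 1[of "(p, \<one>\<^bsub>P'\<^esub>)"] that ab by simp
    moreover have "B' p b = 1" if "p \<in> carrier P'" for p using 1[of "(\<one>\<^bsub>P\<^esub>, p)"] that ab by simp
    ultimately show "x = \<one>\<^bsub>Y \<times>\<times> Y'\<^esub>" using A.nondeg_Y A'.nondeg_Y ab by simp
  qed
qed


section \<open>Hopf algebras of functions on a finite set of points\<close>

text \<open>
  A coalgebra structure on \<open>k[Y]\<close> that is dual to a product \<open>\<star>\<close> with unit \<open>u\<close> on the set of points.
  The group \<open>P\<close> is there to express the duality with \<open>Y\<close>; \<open>\<star>\<close> is a second product on its elements.
\<close>

locale point_coalgebra = perfect_pairing P Y B
  for P :: "('p, 'm) monoid_scheme" (structure) and Y :: "('x, 'n) monoid_scheme" (structure)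
    and B :: "'p \<Rightarrow> 'x \<Rightarrow> 'k::field" +
  fixes A :: "('x, 'k) hopf" and star :: "'p \<Rightarrow> 'p \<Rightarrow> 'p" (infixl \<open>\<star>\<close> 70) and u :: 'p
  assumes basis: "hbasis A = carrier Y"
    and comult_closed: "f \<in> hspace A \<Longrightarrow> hcomult A f \<in> fspan (carrier Y \<times> carrier Y)"
    and ev_comult: "p \<in> carrier P \<Longrightarrow> q \<in> carrier P \<Longrightarrow> f \<in> hspace A \<Longrightarrow>
      lin_form (\<lambda>(x, y). B p x * B q y) (hcomult A f) = ev (p \<star> q) f"
    and ev_counit: "f \<in> hspace A \<Longrightarrow> hcounit A f = ev u f"
    and star_closed: "p \<in> carrier P \<Longrightarrow> q \<in> carrier P \<Longrightarrow> p \<star> q \<in> carrier P"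
    and unit_closed: "u \<in> carrier P"
begin

lemma ev_bvec [simp]: "ev p (bvec x) = B p x"
  by (simp add: ev_def)

lemma points_eqI:
  assumes "p \<in> carrier P" "q \<in> carrier P" "\<And>f. f \<in> hspace A \<Longrightarrow> ev p f = ev q f"
  shows "p = q"
proof (rule B_inject[OF assms(1,2)])
  fix x assume "x \<in> carrier Y"
  then show "B p x = B q x" using assms(3)[of "bvec x"] by (simp add: basis)
qed

text \<open>
  The tensor square is the algebra of functions on pairs of points.
\<close>

lemma tensor_eqI:
  assumes f: "f \<in> fspan (carrier Y \<times> carrier Y)" and g: "g \<in> fspan (carrier Y \<times> carrier Y)"
    and eq: "\<And>p q. p \<in> carrier P \<Longrightarrow> q \<in> carrier P \<Longrightarrow>
      lin_form (\<lambda>(x, y). B p x * B q y) f = lin_form (\<lambda>(x, y). B p x * B q y) g"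
  shows "f = g"
proof -
  interpret T: perfect_pairing "P \<times>\<times> P" "Y \<times>\<times> Y" "\<lambda>(p, p') (x, x'). B p x * B p' x'"
    by (intro perfect_pairing_product) unfold_locales
  show ?thesis
    using f g eq by (intro T.ev_eqI) (auto simp: T.ev_def)
qed

lemma ev_tens_map:
  assumes F: "\<And>f. f \<in> hspace A \<Longrightarrow> ev p (F f) = ev p' f" "\<And>f. f \<in> hspace A \<Longrightarrow> ev q (F f) = ev q' f"
    and z: "z \<in> fspan (carrier Y \<times> carrier Y)"
  shows "lin_form (\<lambda>(x, y). B p x * B q y) (tens_map F F z) = lin_form (\<lambda>(x, y). B p' x * B q' y) z"
  unfolding lin_form_tens_map
  using F by (intro lin_form_fspan_cong[OF z]) (auto simp: ev_def basis)

text \<open>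
  Relates single pairs of points, since the image of a general point under the dual of \<open>F\<close> need
  not be known yet.
\<close>

lemma coalg_map_mult_points:
  assumes F: "coalg_map A A F"
    and p: "p \<in> carrier P" "p' \<in> carrier P" "\<And>f. f \<in> hspace A \<Longrightarrow> ev p (F f) = ev p' f"
    and q: "q \<in> carrier P" "q' \<in> carrier P" "\<And>f. f \<in> hspace A \<Longrightarrow> ev q (F f) = ev q' f"
    and f: "f \<in> hspace A"
  shows "ev (p \<star> q) (F f) = ev (p' \<star> q') f"
proof -
  have "F f \<in> hspace A" using F f by (auto simp: coalg_map_def)
  then have "ev (p \<star> q) (F f) = lin_form (\<lambda>(x, y). B p x * B q y) (hcomult A (F f))"
    using ev_comult p q by simp
  also have "\<dots> = lin_form (\<lambda>(x, y). B p' x * B q' y) (hcomult A f)"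
    using F f ev_tens_map[OF p(3) q(3)] comult_closed by (simp add: coalg_map_def)
  also have "\<dots> = ev (p' \<star> q') f" using ev_comult p q f by simp
  finally show ?thesis .
qed

text \<open>
  Transposition exchanges coproduct and product of points.
\<close>

lemma coalg_map_iff_points:
  assumes F: "F \<in> hspace A \<rightarrow> hspace A" "linear_on (hspace A) F"
    and \<rho>: "\<And>p. p \<in> carrier P \<Longrightarrow> \<rho> p \<in> carrier P"
      "\<And>p f. p \<in> carrier P \<Longrightarrow> f \<in> hspace A \<Longrightarrow> ev p (F f) = ev (\<rho> p) f"
  shows "coalg_map A A F \<longleftrightarrow>
    (\<forall>p\<in>carrier P. \<forall>q\<in>carrier P. \<rho> (p \<star> q) = \<rho> p \<star> \<rho> q) \<and> \<rho> u = u"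
proof (intro iffI conjI ballI)
  assume C: "coalg_map A A F"
  fix p q assume pq: "p \<in> carrier P" "q \<in> carrier P"
  show "\<rho> (p \<star> q) = \<rho> p \<star> \<rho> q"
  proof (rule points_eqI)
    fix f assume f: "f \<in> hspace A"
    have "ev (p \<star> q) (F f) = ev (\<rho> p \<star> \<rho> q) f"
      using coalg_map_mult_points[OF C _ _ _ _ _ _ f] pq \<rho> by blast
    then show "ev (\<rho> (p \<star> q)) f = ev (\<rho> p \<star> \<rho> q) f" using \<rho>(2) star_closed pq f by simp
  qed (use pq \<rho>(1) star_closed in blast)+
next
  assume C: "coalg_map A A F"
  show "\<rho> u = u"
  proof (rule points_eqI)
    fix f assume f: "f \<in> hspace A"
    then have "F f \<in> hspace A" using F(1) by blast
    moreover have "hcounit A (F f) = hcounit A f" using C f unfolding coalg_map_def by blast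
    ultimately show "ev (\<rho> u) f = ev u f"
      using f \<rho>(2)[OF unit_closed f] by (simp add: ev_counit)
  qed (use \<rho>(1) unit_closed in blast)+
next
  assume H: "(\<forall>p\<in>carrier P. \<forall>q\<in>carrier P. \<rho> (p \<star> q) = \<rho> p \<star> \<rho> q) \<and> \<rho> u = u"
  have "hcomult A (F f) = tens_map F F (hcomult A f)" if f: "f \<in> hspace A" for f
  proof (rule tensor_eqI)
    have Ff: "F f \<in> hspace A" using F(1) f by blast
    then show "hcomult A (F f) \<in> fspan (carrier Y \<times> carrier Y)" by (rule comult_closed)
    have "F (bvec x) \<in> fspan (carrier Y)" if "x \<in> carrier Y" for x
      using F(1) that by (auto simp: basis)
    then show "tens_map F F (hcomult A f) \<in> fspan (carrier Y \<times> carrier Y)"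
      by (intro fspan_tens_map[OF comult_closed[OF f]])
    fix p q assume pq: "p \<in> carrier P" "q \<in> carrier P"
    have "lin_form (\<lambda>(x, y). B p x * B q y) (hcomult A (F f)) = ev (\<rho> p \<star> \<rho> q) f"
      using ev_comult[OF pq Ff] \<rho>(2)[OF star_closed[OF pq] f] H pq by simp
    also have "\<dots> = lin_form (\<lambda>(x, y). B (\<rho> p) x * B (\<rho> q) y) (hcomult A f)"
      using ev_comult \<rho>(1) pq f by simp
    also have "\<dots> = lin_form (\<lambda>(x, y). B p x * B q y) (tens_map F F (hcomult A f))"
      using ev_tens_map[OF \<rho>(2) \<rho>(2) comult_closed[OF f]] pq by simp
    finally show "lin_form (\<lambda>(x, y). B p x * B q y) (hcomult A (F f)) =
      lin_form (\<lambda>(x, y). B p x * B q y) (tens_map F F (hcomult A f))" .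
  qed
  moreover have "hcounit A (F f) = hcounit A f" if f: "f \<in> hspace A" for f
  proof -
    have "F f \<in> hspace A" using F(1) f by blast
    then show ?thesis using f \<rho>(2)[OF unit_closed f] H by (simp add: ev_counit)
  qed
  ultimately show "coalg_map A A F" using F by (simp add: coalg_map_def)
qed

end

text \<open>
  As an algebra, the Hopf algebra is the group algebra of \<open>Y\<close>; so its algebra maps to \<open>k\<close>
  are the characters of \<open>Y\<close>, that is, the points.
\<close>

locale point_hopf = point_coalgebra P Y B A star u
  for P :: "('p, 'm) monoid_scheme" (structure) and Y :: "('x, 'n) monoid_scheme" (structure)
    and B :: "'p \<Rightarrow> 'x \<Rightarrow> 'k::field" and A :: "('x, 'k) hopf"
    and star :: "'p \<Rightarrow> 'p \<Rightarrow> 'p" (infixl \<open>\<star>\<close> 70) and u :: 'p +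
  assumes mult: "f \<in> hspace A \<Longrightarrow> g \<in> hspace A \<Longrightarrow>
      hmult A f g = hmult (group_algebra Y) f g"
    and one: "hone A = bvec \<one>\<^bsub>Y\<^esub>"
begin

lemma mult_closed: "f \<in> hspace A \<Longrightarrow> g \<in> hspace A \<Longrightarrow> hmult A f g \<in> hspace A"
  unfolding mult group_algebra_def by (auto simp: bilin_ext_def basis intro!: fspan_lin_ext)

lemma ev_mult:
  assumes "p \<in> carrier P" "f \<in> hspace A" "g \<in> hspace A"
  shows "ev p (hmult A f g) = ev p f * ev p g"
proof -
  have "ev p (hmult A f g) = lin_form (\<lambda>x. lin_form (\<lambda>y. B p (x \<otimes>\<^bsub>Y\<^esub> y)) g) f"
    using assms by (simp add: mult group_algebra_def ev_def lin_form_bilin_ext)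
  also have "\<dots> = lin_form (\<lambda>x. lin_form (\<lambda>y. B p x * B p y) g) f"
    using assms by (intro lin_form_fspan_cong[where S = "carrier Y"]) (auto simp: B_mult_Y basis)
  also have "\<dots> = ev p f * ev p g"
    by (simp add: ev_def lin_form_mult_left lin_form_mult_right)
  finally show ?thesis .
qed

text \<open>
  Composing the evaluation at \<open>p\<close> with \<open>F\<close> gives an algebra map to \<open>k\<close>, so a point.
\<close>

lemma hopf_map_points:
  assumes F: "hopf_map A A F" and p: "p \<in> carrier P"
  shows "\<exists>q\<in>carrier P. \<forall>f\<in>hspace A. ev p (F f) = ev q f"
proof -
  have Fc: "F f \<in> hspace A" if "f \<in> hspace A" for f
    using F that by (auto simp: hopf_map_def coalg_map_def)
  define \<chi> where "\<chi> x = ev p (F (bvec x))" for x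
  have \<chi>m: "\<chi> (x \<otimes>\<^bsub>Y\<^esub> y) = \<chi> x * \<chi> y" if "x \<in> carrier Y" "y \<in> carrier Y" for x y
  proof -
    have "hmult A (bvec x) (bvec y) = bvec (x \<otimes>\<^bsub>Y\<^esub> y)"
      using that by (simp add: mult basis group_algebra_def)
    then show ?thesis
      using F that p ev_mult[OF p Fc Fc] unfolding \<chi>_def hopf_map_def
      by (metis basis fspan_bvec)
  qed
  have \<chi>1: "\<chi> \<one>\<^bsub>Y\<^esub> = 1"
    using F p by (simp add: \<chi>_def hopf_map_def one)
  have "\<chi> \<in> hom Y units_group"
    unfolding hom_units_group_iff
  proof (intro conjI ballI)
    fix x assume "x \<in> carrier Y"
    then have "\<chi> x * \<chi> (inv\<^bsub>Y\<^esub> x) = 1" using \<chi>m[of x "inv\<^bsub>Y\<^esub> x"] \<chi>1 by simp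
    then show "\<chi> x \<noteq> 0" by auto
  qed (rule \<chi>m)
  from character_is_evaluation[OF this]
  obtain q where q: "q \<in> carrier P" "\<And>x. x \<in> carrier Y \<Longrightarrow> \<chi> x = B q x" by blast
  have "ev p (F f) = ev q f" if f: "f \<in> hspace A" for f
  proof -
    have "linear_on (fspan (carrier Y)) F" using F by (simp add: hopf_map_def coalg_map_def basis)
    then have "ev p (F f) = lin_form \<chi> f"
      unfolding \<chi>_def ev_def using f linear_on_lin_form[of "carrier Y" F f] by (simp add: basis)
    also have "\<dots> = ev q f"
      unfolding ev_def using f q(2) by (intro lin_form_fspan_cong[where S = "carrier Y"]) (auto simp: basis)
    finally show ?thesis .
  qed
  then show ?thesis using q(1) by blast
qed

text \<open>
  Interpolation makes \<open>f \<circ> \<rho>\<close> an element of the algebra, for every element \<open>f\<close>.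
\<close>

lemma hopf_map_of_points:
  assumes \<rho>: "bij_betw \<rho> (carrier P) (carrier P)"
    and hom: "\<And>p q. p \<in> carrier P \<Longrightarrow> q \<in> carrier P \<Longrightarrow> \<rho> (p \<star> q) = \<rho> p \<star> \<rho> q" "\<rho> u = u"
  shows "\<exists>F. F \<in> Bij (hspace A) \<and> hopf_map A A F \<and>
    (\<forall>p\<in>carrier P. \<forall>f\<in>hspace A. ev p (F f) = ev (\<rho> p) f)"
proof -
  have \<rho>c: "\<rho> p \<in> carrier P" if "p \<in> carrier P" for p using \<rho> that by (auto simp: bij_betw_def)
  define F where "F = (\<lambda>f\<in>hspace A. interpolate (\<lambda>p. ev (\<rho> p) f))"
  have Fc: "F f \<in> hspace A" if "f \<in> hspace A" for f
    using that interpolate_fspan by (simp add: F_def basis)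
  have ev: "ev p (F f) = ev (\<rho> p) f" if "p \<in> carrier P" "f \<in> hspace A" for p f
    using that by (simp add: F_def ev_interpolate)
  have eqI: "f = g" if "f \<in> hspace A" "g \<in> hspace A" "\<And>p. p \<in> carrier P \<Longrightarrow> ev p f = ev p g" for f g
    using that by (intro ev_eqI) (auto simp: basis)
  have lin: "linear_on (hspace A) F"
    unfolding linear_on_def
  proof (intro conjI ballI allI)
    fix f g assume fg: "f \<in> hspace A" "g \<in> hspace A"
    then show "F (f + g) = F f + F g"
      using ev by (intro eqI) (auto simp: Fc fspan_add ev_def lin_form_add)
  next
    fix c f assume "f \<in> hspace A"
    then show "F (scale c f) = scale c (F f)"
      using ev by (intro eqI) (auto simp: Fc fspan_scale ev_def lin_form_scale)
  qed
  have "coalg_map A A F"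
    using coalg_map_iff_points[of F \<rho>] Fc lin \<rho>c ev hom by blast
  moreover have "F (hone A) = hone A"
  proof (rule eqI)
    show one_in: "hone A \<in> hspace A" by (simp add: one basis)
    then show "F (hone A) \<in> hspace A" by (rule Fc)
    fix p assume p: "p \<in> carrier P"
    then have "ev p (F (hone A)) = ev (\<rho> p) (hone A)" using ev one_in by blast
    then show "ev p (F (hone A)) = ev p (hone A)" using p \<rho>c by (simp add: one)
  qed
  moreover have "F (hmult A f g) = hmult A (F f) (F g)" if "f \<in> hspace A" "g \<in> hspace A" for f g
    using that by (intro eqI) (auto simp: Fc mult_closed ev ev_mult \<rho>c)
  ultimately have hopf: "hopf_map A A F" by (simp add: hopf_map_def)
  have "bij_betw F (hspace A) (hspace A)"
    unfolding bij_betw_def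
  proof (intro conjI subset_antisym)
    show "inj_on F (hspace A)"
    proof (rule inj_onI)
      fix f g assume fg: "f \<in> hspace A" "g \<in> hspace A" "F f = F g"
      show "f = g"
      proof (rule eqI[OF fg(1,2)])
        fix p assume "p \<in> carrier P"
        then obtain q where "q \<in> carrier P" "p = \<rho> q" using \<rho> by (auto simp: bij_betw_def)
        then show "ev p f = ev p g" using ev[of q f] ev[of q g] fg by simp
      qed
    qed
    show "F ` hspace A \<subseteq> hspace A" using Fc by blast
    show "hspace A \<subseteq> F ` hspace A"
    proof
      fix g assume g: "g \<in> hspace A"
      define f where "f = interpolate (\<lambda>p. ev (inv_into (carrier P) \<rho> p) g)"
      have f: "f \<in> hspace A" using interpolate_fspan by (simp add: f_def basis)
      have "F f = g"
      proof (rule eqI[OF Fc[OF f] g])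
        fix p assume p: "p \<in> carrier P"
        then have "ev p (F f) = ev (\<rho> p) f" using ev f by blast
        then show "ev p (F f) = ev p g"
          using p \<rho> by (simp add: f_def ev_interpolate \<rho>c bij_betw_inv_into_left)
      qed
      then show "g \<in> F ` hspace A" using f by blast
    qed
  qed
  then have "F \<in> Bij (hspace A)" by (simp add: Bij_def F_def)
  then show ?thesis using hopf ev by blast
qed

lemma hopf_map_compose:
  assumes F: "hopf_map A A F" and F': "hopf_map A A F'"
  shows "hopf_map A A (compose (hspace A) F F')"
proof -
  let ?FF = "compose (hspace A) F F'"
  obtain \<rho> where \<rho>: "\<And>p. p \<in> carrier P \<Longrightarrow> \<rho> p \<in> carrier P"
    "\<And>p f. p \<in> carrier P \<Longrightarrow> f \<in> hspace A \<Longrightarrow> ev p (F f) = ev (\<rho> p) f"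
    using hopf_map_points[OF F] by metis
  obtain \<rho>' where \<rho>': "\<And>p. p \<in> carrier P \<Longrightarrow> \<rho>' p \<in> carrier P"
    "\<And>p f. p \<in> carrier P \<Longrightarrow> f \<in> hspace A \<Longrightarrow> ev p (F' f) = ev (\<rho>' p) f"
    using hopf_map_points[OF F'] by metis
  have maps: "F \<in> hspace A \<rightarrow> hspace A" "F' \<in> hspace A \<rightarrow> hspace A"
    and lin: "linear_on (hspace A) F" "linear_on (hspace A) F'"
    using F F' by (auto simp: hopf_map_def coalg_map_def)
  have Fc: "F f \<in> hspace A" "F' f \<in> hspace A" if "f \<in> hspace A" for f using maps that by auto
  have "coalg_map A A ?FF"
  proof (subst coalg_map_iff_points)
    show "?FF \<in> hspace A \<rightarrow> hspace A" using Fc by (simp add: compose_def)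
    show "linear_on (hspace A) ?FF"
      using lin Fc by (simp add: linear_on_def compose_def fspan_add fspan_scale)
    show "\<rho>' (\<rho> p) \<in> carrier P" if "p \<in> carrier P" for p using \<rho> \<rho>' that by blast
    show "ev p (?FF f) = ev (\<rho>' (\<rho> p)) f" if "p \<in> carrier P" "f \<in> hspace A" for p f
      using \<rho> \<rho>' that Fc by (simp add: compose_def)
    have "(\<forall>p\<in>carrier P. \<forall>q\<in>carrier P. \<rho> (p \<star> q) = \<rho> p \<star> \<rho> q) \<and> \<rho> u = u"
      using coalg_map_iff_points[OF maps(1) lin(1) \<rho>] F by (simp add: hopf_map_def)
    moreover have "(\<forall>p\<in>carrier P. \<forall>q\<in>carrier P. \<rho>' (p \<star> q) = \<rho>' p \<star> \<rho>' q) \<and> \<rho>' u = u"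
      using coalg_map_iff_points[OF maps(2) lin(2) \<rho>'] F' by (simp add: hopf_map_def)
    ultimately show "(\<forall>p\<in>carrier P. \<forall>q\<in>carrier P. \<rho>' (\<rho> (p \<star> q)) = \<rho>' (\<rho> p) \<star> \<rho>' (\<rho> q)) \<and>
        \<rho>' (\<rho> u) = u"
      using \<rho>(1) by simp
  qed
  moreover have "hone A \<in> hspace A" by (simp add: one basis)
  ultimately show ?thesis
    using F F' Fc mult_closed by (simp add: hopf_map_def compose_def)
qed

end


section \<open>Powers and orbits of a group automorphism\<close>

context group
begin

lemma auto_closed: "\<sigma> \<in> auto G \<Longrightarrow> x \<in> carrier G \<Longrightarrow> \<sigma> x \<in> carrier G"
  by (auto simp: auto_def hom_def)

lemma auto_mult:
  "\<sigma> \<in> auto G \<Longrightarrow> x \<in> carrier G \<Longrightarrow> y \<in> carrier G \<Longrightarrow> \<sigma> (x \<otimes> y) = \<sigma> x \<otimes> \<sigma> y"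
  by (auto simp: auto_def hom_def)

lemma funpow_auto_closed: "\<sigma> \<in> auto G \<Longrightarrow> x \<in> carrier G \<Longrightarrow> (\<sigma> ^^ i) x \<in> carrier G"
  by (induction i) (auto simp: auto_closed)

lemma funpow_auto_mult:
  "\<sigma> \<in> auto G \<Longrightarrow> x \<in> carrier G \<Longrightarrow> y \<in> carrier G \<Longrightarrow>
    (\<sigma> ^^ i) (x \<otimes> y) = (\<sigma> ^^ i) x \<otimes> (\<sigma> ^^ i) y"
  by (induction i) (auto simp: auto_mult funpow_auto_closed)

lemma funpow_auto_one: "\<sigma> \<in> auto G \<Longrightarrow> (\<sigma> ^^ i) \<one> = \<one>"
  by (metis funpow_auto_closed funpow_auto_mult l_one one_closed r_cancel)

lemma AutoGroup_pow_apply: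
  assumes \<sigma>: "\<sigma> \<in> auto G" and "x \<in> carrier G"
  shows "(\<sigma> [^]\<^bsub>AutoGroup G\<^esub> (i::nat)) x = (\<sigma> ^^ i) x"
  using assms(2)
proof (induction i arbitrary: x)
  case 0
  then show ?case by (simp add: AutoGroup_def BijGroup_def)
next
  case (Suc i)
  interpret A: group "AutoGroup G" by (rule AutoGroup)
  have "\<sigma> \<in> carrier (AutoGroup G)" using \<sigma> by (simp add: AutoGroup_def)
  then have "\<sigma> [^]\<^bsub>AutoGroup G\<^esub> i \<in> auto G"
    using A.nat_pow_closed[of \<sigma> i] by (simp add: AutoGroup_def)
  then have "\<sigma> [^]\<^bsub>AutoGroup G\<^esub> i \<in> Bij (carrier G)" "\<sigma> \<in> Bij (carrier G)"
    using \<sigma> by (auto simp: auto_def)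
  moreover have "f \<otimes>\<^bsub>AutoGroup G\<^esub> g = compose (carrier G) f g"
    if "f \<in> Bij (carrier G)" "g \<in> Bij (carrier G)" for f g
    using that by (simp add: AutoGroup_def BijGroup_def)
  ultimately have "(\<sigma> [^]\<^bsub>AutoGroup G\<^esub> Suc i) x = (\<sigma> [^]\<^bsub>AutoGroup G\<^esub> i) (\<sigma> x)"
    using Suc.prems unfolding A.nat_pow_Suc by (simp add: compose_eq)
  then show ?case
    using Suc.IH[OF auto_closed[OF \<sigma> Suc.prems]] by (simp add: funpow_swap1)
qed

lemma funpow_auto_id_iff:
  assumes \<sigma>: "\<sigma> \<in> auto G"
  shows "(\<forall>x\<in>carrier G. (\<sigma> ^^ i) x = x) \<longleftrightarrow> group.ord (AutoGroup G) \<sigma> dvd i"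
proof -
  interpret A: group "AutoGroup G" by (rule AutoGroup)
  have \<sigma>': "\<sigma> \<in> carrier (AutoGroup G)" using \<sigma> by (simp add: AutoGroup_def)
  have "\<sigma> [^]\<^bsub>AutoGroup G\<^esub> i \<in> extensional (carrier G)"
    using A.nat_pow_closed[OF \<sigma>', of i] by (simp add: AutoGroup_def auto_def Bij_def)
  moreover have "\<one>\<^bsub>AutoGroup G\<^esub> = (\<lambda>x\<in>carrier G. x)" by (simp add: AutoGroup_def BijGroup_def)
  ultimately have "\<sigma> [^]\<^bsub>AutoGroup G\<^esub> i = \<one>\<^bsub>AutoGroup G\<^esub> \<longleftrightarrow>
      (\<forall>x\<in>carrier G. (\<sigma> [^]\<^bsub>AutoGroup G\<^esub> i) x = x)"
    by (auto intro!: extensionalityI[of _ "carrier G"])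
  then show ?thesis using A.pow_eq_id[OF \<sigma>'] AutoGroup_pow_apply[OF \<sigma>] by simp
qed

lemma auto_ord_pos:
  assumes \<sigma>: "\<sigma> \<in> auto G" and fin: "finite (carrier G)"
  shows "group.ord (AutoGroup G) \<sigma> > 0"
proof -
  interpret A: group "AutoGroup G" by (rule AutoGroup)
  have "auto G \<subseteq> carrier G \<rightarrow>\<^sub>E carrier G"
    by (auto simp: auto_def hom_def Bij_def PiE_def)
  then have "finite (carrier (AutoGroup G))"
    using finite_subset[OF _ finite_PiE[of "carrier G" "\<lambda>_. carrier G"]] fin
    by (auto simp: AutoGroup_def)
  then show ?thesis
    using A.ord_ge_1[of \<sigma>] \<sigma> by (simp add: AutoGroup_def)
qed

lemma funpow_auto_cong:
  assumes "\<sigma> \<in> auto G" "x \<in> carrier G"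
    and "i mod group.ord (AutoGroup G) \<sigma> = j mod group.ord (AutoGroup G) \<sigma>"
  shows "(\<sigma> ^^ i) x = (\<sigma> ^^ j) x"
proof -
  have "(\<sigma> ^^ group.ord (AutoGroup G) \<sigma>) x = x"
    using funpow_auto_id_iff[OF assms(1), of "group.ord (AutoGroup G) \<sigma>"] assms(2) by simp
  from funpow_mod_eq[OF this, of i] funpow_mod_eq[OF this, of j] assms(3) show ?thesis by simp
qed

lemma funpow_auto_inj:
  assumes \<sigma>: "\<sigma> \<in> auto G" "x \<in> carrier G" "y \<in> carrier G" "(\<sigma> ^^ i) x = (\<sigma> ^^ i) y"
  shows "x = y"
  using assms(4)
proof (induction i)
  case (Suc i)
  have "\<sigma> ((\<sigma> ^^ i) x) = \<sigma> ((\<sigma> ^^ i) y)" using Suc.prems by simp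
  then have "(\<sigma> ^^ i) x = (\<sigma> ^^ i) y"
    using \<sigma> funpow_auto_closed[OF \<sigma>(1)] by (auto simp: auto_def Bij_def bij_betw_def inj_on_def)
  then show ?case by (rule Suc.IH)
qed simp

lemma aut_orbit_eq:
  assumes \<sigma>: "\<sigma> \<in> auto G" "x \<in> carrier G" and fin: "finite (carrier G)"
  shows "aut_orbit G \<sigma> x = range (\<lambda>i. (\<sigma> ^^ i) x)"
proof -
  interpret A: group "AutoGroup G" by (rule AutoGroup)
  have \<sigma>': "\<sigma> \<in> carrier (AutoGroup G)" using \<sigma> by (simp add: AutoGroup_def)
  have pos: "group.ord (AutoGroup G) \<sigma> > 0" by (rule auto_ord_pos[OF \<sigma>(1) fin])
  have "range (\<lambda>n::int. \<sigma> [^]\<^bsub>AutoGroup G\<^esub> n) = range (\<lambda>n::nat. \<sigma> [^]\<^bsub>AutoGroup G\<^esub> n)"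
  proof (intro subset_antisym subsetI)
    fix f assume "f \<in> range (\<lambda>n::int. \<sigma> [^]\<^bsub>AutoGroup G\<^esub> n)"
    then obtain n :: int where n: "f = \<sigma> [^]\<^bsub>AutoGroup G\<^esub> n" by blast
    let ?m = "n mod int (group.ord (AutoGroup G) \<sigma>)"
    have "f = \<sigma> [^]\<^bsub>AutoGroup G\<^esub> ?m"
      unfolding n A.int_pow_eq[OF \<sigma>'] by (simp add: mod_eq_dvd_iff[symmetric])
    also have "\<dots> = \<sigma> [^]\<^bsub>AutoGroup G\<^esub> nat ?m"
      using pos by (simp flip: int_pow_int)
    finally show "f \<in> range (\<lambda>n::nat. \<sigma> [^]\<^bsub>AutoGroup G\<^esub> n)" by blast
  next
    fix f assume "f \<in> range (\<lambda>n::nat. \<sigma> [^]\<^bsub>AutoGroup G\<^esub> n)"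
    then obtain n :: nat where "f = \<sigma> [^]\<^bsub>AutoGroup G\<^esub> n" by blast
    then have "f = \<sigma> [^]\<^bsub>AutoGroup G\<^esub> int n" by (simp add: int_pow_int)
    then show "f \<in> range (\<lambda>n::int. \<sigma> [^]\<^bsub>AutoGroup G\<^esub> n)" by blast
  qed
  then have "carrier (subgroup_generated (AutoGroup G) {\<sigma>}) = range (\<lambda>n::nat. \<sigma> [^]\<^bsub>AutoGroup G\<^esub> n)"
    by (simp add: A.carrier_subgroup_generated_by_singleton[OF \<sigma>'])
  then show ?thesis
    unfolding aut_orbit_def orbit_def using AutoGroup_pow_apply[OF \<sigma>] by (auto simp: image_iff) metis
qed

text \<open>
  The orbit of \<open>x\<close> consists of the images of \<open>x\<close> under the powers with exponent below the
  least period \<open>r\<close>, and these are distinct.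
\<close>

lemma funpow_eq_iff_mod_card_orbit:
  assumes \<sigma>: "\<sigma> \<in> auto G" "x \<in> carrier G" and fin: "finite (carrier G)"
  defines "d \<equiv> card (aut_orbit G \<sigma> x)"
  shows "d > 0" "(\<sigma> ^^ i) x = (\<sigma> ^^ j) x \<longleftrightarrow> i mod d = j mod d"
    "d dvd group.ord (AutoGroup G) \<sigma>"
proof -
  let ?N = "group.ord (AutoGroup G) \<sigma>"
  let ?P = "\<lambda>i. i > 0 \<and> (\<sigma> ^^ i) x = x"
  define r where "r = (LEAST i. ?P i)"
  have "?P ?N" using auto_ord_pos[OF \<sigma>(1) fin] funpow_auto_id_iff[OF \<sigma>(1), of ?N] \<sigma>(2) by simp
  then have r: "r > 0" "(\<sigma> ^^ r) x = x" using LeastI[of ?P ?N] by (auto simp: r_def)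
  have min: "(\<sigma> ^^ i) x \<noteq> x" if "0 < i" "i < r" for i
    using that not_less_Least[of i ?P] by (auto simp: r_def)
  have red: "(\<sigma> ^^ i) x = (\<sigma> ^^ (i mod r)) x" for i
    using funpow_mod_eq[OF r(2), of i] by simp
  have inj: "i = j" if "i < r" "j < r" "(\<sigma> ^^ i) x = (\<sigma> ^^ j) x" for i j
    using that
  proof (induction i j rule: linorder_wlog)
    case (le i j)
    have "(\<sigma> ^^ i) ((\<sigma> ^^ (j - i)) x) = (\<sigma> ^^ i) x"
      using le by (metis add_diff_inverse_nat comp_apply funpow_add not_le)
    then have "(\<sigma> ^^ (j - i)) x = x"
      using funpow_auto_inj[OF \<sigma>(1)] funpow_auto_closed[OF \<sigma>] \<sigma>(2) by blast
    moreover have "j - i < r" using le by simp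
    ultimately have "\<not> 0 < j - i" using min by blast
    then show ?case using le by simp
  qed simp
  have eq: "(\<sigma> ^^ i) x = (\<sigma> ^^ j) x \<longleftrightarrow> i mod r = j mod r" for i j
    using red[of i] red[of j] inj[of "i mod r" "j mod r"] mod_less_divisor[OF r(1)] by metis
  have "aut_orbit G \<sigma> x = (\<lambda>i. (\<sigma> ^^ i) x) ` {..<r}"
    unfolding aut_orbit_eq[OF \<sigma> fin] using red r(1) by (force simp: image_iff)
  then have "d = r"
    unfolding d_def by (simp add: card_image inj_on_def inj)
  then show "d > 0" "(\<sigma> ^^ i) x = (\<sigma> ^^ j) x \<longleftrightarrow> i mod d = j mod d"
    using r(1) eq by simp_all
  have "(\<sigma> ^^ ?N) x = (\<sigma> ^^ 0) x" using \<open>?P ?N\<close> by simp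
  then show "d dvd ?N" using eq[of ?N 0] \<open>d = r\<close> by (simp add: dvd_eq_mod_eq_0)
qed

end


section \<open>Eigenvalues of a group automorphism\<close>

lemma eigenvector_funpow:
  assumes "b \<in> eigenspace \<G> \<theta> l"
  shows "lin_ext (\<lambda>x. bvec ((\<theta> ^^ i) x)) b = scale (l ^ i) b"
proof (induction i)
  case 0
  show ?case by (simp add: lin_ext_bvec_id)
next
  case (Suc i)
  have "lin_ext (\<lambda>x. bvec ((\<theta> ^^ Suc i) x)) b =
      lin_ext (\<lambda>x. bvec (\<theta> x)) (lin_ext (\<lambda>x. bvec ((\<theta> ^^ i) x)) b)"
    by (simp add: lin_ext_lin_ext)
  also have "\<dots> = scale (l ^ Suc i) b"
    using assms by (simp add: Suc lin_ext_scale scale_scale eigenspace_def mult.commute)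
  finally show ?case .
qed

text \<open>
  The coaction separates the components of \<open>b\<close> in the eigenspaces, and a character of \<open>\<^bold>U\<close> weights them
  with powers of the eigenvalues; this evaluates the sum of the weighted components.
\<close>

lemma eigen_decomp_funpow:
  assumes "eigen_decomp \<G> \<theta> b c"
  shows "lin_ext (\<lambda>x. bvec ((\<theta> ^^ i) x)) b = (\<Sum>l | c l \<noteq> 0. scale (l ^ i) (c l))"
proof -
  have b: "b = (\<Sum>l | c l \<noteq> 0. c l)" using assms by (simp add: eigen_decomp_def)
  show ?thesis
    unfolding b lin_ext_sum
    using assms by (intro sum.cong refl eigenvector_funpow[of _ \<G>]) (simp add: eigen_decomp_def)
qed

locale finite_biproduct_data = biproduct_data G \<G> \<mu> \<theta> \<U> e
  for G :: "'g monoid" and \<G> :: "'a monoid" and \<mu> :: "'g \<Rightarrow> 'a \<Rightarrow> 'a" and \<theta> :: "'a \<Rightarrow> 'a"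
    and \<U> :: "'g set" and e :: "'k::field \<Rightarrow> 'g" +
  assumes comm_\<G>: "comm_group \<G>" and finite_\<G>: "finite (carrier \<G>)"
begin

sublocale comm_group \<G> by (rule comm_\<G>)

definition N :: nat where "N = group.ord (AutoGroup \<G>) \<theta>"

abbreviation U :: "'k monoid" where "U \<equiv> eigenvalue_group \<G> \<theta>"

lemma N_pos: "N > 0"
  unfolding N_def by (rule auto_ord_pos[OF \<theta>_auto finite_\<G>])

lemma eigenvalue_pow_N:
  assumes "eigenspace \<G> \<theta> l \<noteq> {0 :: 'a \<Rightarrow>\<^sub>0 'k}"
  shows "l ^ N = 1"
proof -
  have "0 \<in> eigenspace \<G> \<theta> l" by (simp add: eigenspace_def)
  then obtain b where b: "b \<in> eigenspace \<G> \<theta> l" "b \<noteq> 0" using assms by blast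
  then have "scale (l ^ N) b = lin_ext (\<lambda>x. bvec ((\<theta> ^^ N) x)) b"
    by (simp add: eigenvector_funpow)
  also have "\<dots> = lin_ext bvec b"
    using funpow_auto_id_iff[OF \<theta>_auto, of N] b
    by (intro lin_ext_fspan_cong[where S = "carrier \<G>"]) (auto simp: eigenspace_def N_def)
  finally have eq: "scale (l ^ N) b = b" by (simp add: lin_ext_bvec_id)
  obtain x where "Poly_Mapping.lookup b x \<noteq> 0" using b(2) by (metis poly_mapping_eqI lookup_zero)
  moreover have "l ^ N * Poly_Mapping.lookup b x = Poly_Mapping.lookup b x"
    using arg_cong[OF eq, of "\<lambda>f. Poly_Mapping.lookup f x"] by simp
  ultimately show ?thesis by simp
qed

text \<open>
  \<open>\<theta>\<^sup>M\<close> is the identity on each eigenspace, and the eigenspaces span \<open>k[\<G>]\<close>.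
\<close>

lemma N_dvd_of_eigenvalues:
  assumes "\<And>l :: 'k. eigenspace \<G> \<theta> l \<noteq> {0} \<Longrightarrow> l ^ M = 1"
  shows "N dvd M"
proof -
  have "(\<theta> ^^ M) x = x" if x: "x \<in> carrier \<G>" for x
  proof -
    obtain c :: "'k \<Rightarrow> ('a \<Rightarrow>\<^sub>0 'k)" where c: "eigen_decomp \<G> \<theta> (bvec x) c"
      using diagonalizable[of "bvec x"] x by auto
    have "bvec ((\<theta> ^^ M) x) = (\<Sum>l | c l \<noteq> 0. scale (l ^ M) (c l))"
      using eigen_decomp_funpow[OF c, of M] by simp
    also have "\<dots> = (\<Sum>l | c l \<noteq> 0. c l)"
    proof (intro sum.cong refl)
      fix l assume "l \<in> {l. c l \<noteq> 0}"
      then have "eigenspace \<G> \<theta> l \<noteq> {0}" using c by (auto simp: eigen_decomp_def)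
      then show "scale (l ^ M) (c l) = c l" using assms by simp
    qed
    also have "\<dots> = bvec x" using c by (simp add: eigen_decomp_def)
    finally have "(bvec ((\<theta> ^^ M) x) :: 'a \<Rightarrow>\<^sub>0 'k) = bvec x" .
    then show ?thesis by (metis keys_single singleton_inject zero_neq_one)
  qed
  then show ?thesis using funpow_auto_id_iff[OF \<theta>_auto, of M] by (simp add: N_def)
qed

lemma U_group: "comm_group U"
  unfolding eigenvalue_group_def
  by (rule group.abelian_subgroup_generated) (auto intro: comm_group_units_group comm_group.axioms)

lemma U_simps [simp]: "v \<otimes>\<^bsub>U\<^esub> v' = v * v'" "\<one>\<^bsub>U\<^esub> = 1" "v [^]\<^bsub>U\<^esub> (i::nat) = v ^ i"
  by (simp_all add: eigenvalue_group_def pow_subgroup_generated)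

lemma eigenvalue_in_U:
  assumes "eigenspace \<G> \<theta> l \<noteq> {0 :: 'a \<Rightarrow>\<^sub>0 'k}"
  shows "l \<in> carrier U"
proof -
  have "l \<noteq> 0" using eigenvalue_pow_N[OF assms] N_pos by (auto simp: power_0_left)
  then show ?thesis
    using assms by (auto simp: eigenvalue_group_def carrier_subgroup_generated intro!: generate.incl)
qed

lemma U_pow_N: "v \<in> carrier U \<Longrightarrow> v ^ N = 1"
proof -
  assume "v \<in> carrier U"
  then have "v \<in> generate units_group (carrier units_group \<inter> {l. eigenspace \<G> \<theta> l \<noteq> {0}})"
    by (simp add: eigenvalue_group_def carrier_subgroup_generated)
  then show ?thesis
  proof induction
    case (inv h)
    then show ?case using eigenvalue_pow_N[of h] by (simp add: units_group_inv power_inverse)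
  qed (auto simp: eigenvalue_pow_N power_mult_distrib)
qed

lemma finite_U: "finite (carrier U)"
proof -
  let ?p = "monom 1 N - 1 :: 'k poly"
  have "coeff ?p N = 1" using N_pos by simp
  then have "?p \<noteq> 0" by (metis coeff_0 zero_neq_one)
  moreover have "carrier U \<subseteq> {v. poly ?p v = 0}"
    using U_pow_N by (auto simp: poly_monom)
  ultimately show ?thesis using finite_subset poly_roots_finite by blast
qed

text \<open>
  The order of an element of maximal order is the exponent of \<open>U\<close>; it is a multiple of \<open>N\<close> since the
  corresponding power of every eigenvalue is 1, and a divisor of \<open>N\<close> since
  \<open>U\<close> consists of \<open>N\<close>-th roots of unity.
\<close>

lemma primitive_root_in_U: "\<exists>l\<in>carrier U. primitive_root N l"
proof -
  interpret U: comm_group U by (rule U_group)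
  obtain l where l: "l \<in> carrier U" "U.ord l > 0" "\<And>v. v \<in> carrier U \<Longrightarrow> v [^]\<^bsub>U\<^esub> U.ord l = \<one>\<^bsub>U\<^esub>"
    using U.max_order_element[OF finite_U] by blast
  have "N dvd U.ord l"
    using l(3) eigenvalue_in_U by (intro N_dvd_of_eigenvalues) auto
  moreover have "U.ord l dvd N"
    using U.pow_eq_id[OF l(1), of N] U_pow_N[OF l(1)] by simp
  ultimately have "U.ord l = N" by (rule dvd_antisym[symmetric])
  then have "l ^ i = 1 \<longleftrightarrow> N dvd i" for i
    using U.pow_eq_id[OF l(1), of i] by simp
  then have "primitive_root N l"
    using N_pos by (auto simp: primitive_root_def dest: dvd_imp_le)
  then show ?thesis using l(1) by blast
qed

lemma carrier_U: "carrier U = {v. v ^ N = 1}"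
proof (intro subset_antisym subsetI)
  interpret U: comm_group U by (rule U_group)
  fix v :: 'k assume "v \<in> {v. v ^ N = 1}"
  moreover obtain l where l: "l \<in> carrier U" "primitive_root N l" using primitive_root_in_U by blast
  ultimately obtain i where "v = l ^ i" using primitive_root_exhausts by blast
  then show "v \<in> carrier U" using U.nat_pow_closed[OF l(1), of i] by simp
qed (simp add: U_pow_N)

end


section \<open>The biproduct as an algebra of functions\<close>

text \<open>
  The bicharacter \<open>\<beta>\<close> identifies \<open>\<G>\<close> with its character group.
\<close>

locale dual_biproduct = finite_biproduct_data G \<G> \<mu> \<theta> \<U> e
  for G :: "'g monoid" and \<G> :: "'a monoid" and \<mu> :: "'g \<Rightarrow> 'a \<Rightarrow> 'a" and \<theta> :: "'a \<Rightarrow> 'a"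
    and \<U> :: "'g set" and e :: "'k::field \<Rightarrow> 'g" +
  fixes l :: 'k and \<beta> :: "'a \<Rightarrow> 'a \<Rightarrow> 'k"
  assumes l: "primitive_root N l" and \<beta>: "self_pairing \<G> \<beta>"
    and card_\<G>: "of_nat (card (carrier \<G>)) \<noteq> (0 :: 'k)"
begin

abbreviation H :: "'g monoid" where "H \<equiv> G\<lparr>carrier := \<U>\<rparr>"

text \<open>
  The discrete logarithm to base \<open>l\<close>; it is a homomorphism only modulo \<open>N\<close>.
\<close>

definition dlog :: "'k \<Rightarrow> nat" where "dlog v = (LEAST i. l ^ i = v)"

lemma l_in_U: "l \<in> carrier U"
  using l by (simp add: carrier_U primitive_root_def)

lemma pow_dlog: "v \<in> carrier U \<Longrightarrow> l ^ dlog v = v"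
  using primitive_root_exhausts[OF l, of v] unfolding carrier_U dlog_def
  by (metis (mono_tags, lifting) LeastI mem_Collect_eq)

lemma U_pow_cong: "v \<in> carrier U \<Longrightarrow> i mod N = j mod N \<Longrightarrow> v ^ i = v ^ j"
proof -
  assume v: "v \<in> carrier U" and "i mod N = j mod N"
  then have "l ^ i = l ^ j" by (simp add: primitive_root_pow_eq_iff[OF l])
  then have "(l ^ dlog v) ^ i = (l ^ dlog v) ^ j"
    by (simp add: mult.commute[of "dlog v"] power_mult flip: power_mult[of l "dlog v"])
  then show ?thesis by (simp add: pow_dlog[OF v])
qed

lemma dlog_mult:
  "v \<in> carrier U \<Longrightarrow> v' \<in> carrier U \<Longrightarrow> dlog (v * v') mod N = (dlog v + dlog v') mod N"
proof -
  interpret U: comm_group U by (rule U_group)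
  assume v: "v \<in> carrier U" "v' \<in> carrier U"
  then have "v * v' \<in> carrier U" using U.m_closed by force
  then have "l ^ dlog (v * v') = l ^ (dlog v + dlog v')"
    using v by (simp add: pow_dlog power_add)
  then show ?thesis by (simp add: primitive_root_pow_eq_iff[OF l])
qed

lemma H_group: "comm_group H"
proof (rule group.group_comm_groupI)
  show "group H" by (rule subgroup.subgroup_is_group[OF \<U>_subgroup group_G])
  show "x \<otimes>\<^bsub>H\<^esub> y = y \<otimes>\<^bsub>H\<^esub> x" if "x \<in> carrier H" "y \<in> carrier H" for x y
    using that \<U>_central[of x y] subgroup.subset[OF \<U>_subgroup] by auto
qed

abbreviation e_inv :: "'g \<Rightarrow> 'k" where "e_inv \<equiv> inv_into (carrier U) e"

lemma e_bij: "bij_betw e (carrier U) \<U>"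
  using e_iso by (simp add: iso_def)

lemma e_in: "v \<in> carrier U \<Longrightarrow> e v \<in> \<U>"
  using e_bij by (auto simp: bij_betw_def)

lemma e_mult: "v \<in> carrier U \<Longrightarrow> v' \<in> carrier U \<Longrightarrow> e (v * v') = e v \<otimes>\<^bsub>G\<^esub> e v'"
  using e_iso by (auto simp: iso_def hom_def)

lemma e_inv_e [simp]: "v \<in> carrier U \<Longrightarrow> e_inv (e v) = v"
  using e_bij by (rule bij_betw_inv_into_left)

lemma e_e_inv [simp]: "h \<in> \<U> \<Longrightarrow> e (e_inv h) = h"
  using e_bij by (rule bij_betw_inv_into_right)

lemma e_inv_in: "h \<in> \<U> \<Longrightarrow> e_inv h \<in> carrier U"
  using e_bij by (metis bij_betw_def inv_into_into)

lemma e_inv_mult: "h \<in> \<U> \<Longrightarrow> h' \<in> \<U> \<Longrightarrow> e_inv (h \<otimes>\<^bsub>G\<^esub> h') = e_inv h * e_inv h'"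
proof -
  interpret U: comm_group U by (rule U_group)
  assume h: "h \<in> \<U>" "h' \<in> \<U>"
  then have "e_inv h * e_inv h' \<in> carrier U" using U.m_closed e_inv_in by force
  moreover have "h \<otimes>\<^bsub>G\<^esub> h' = e (e_inv h * e_inv h')" using h by (simp add: e_mult e_inv_in)
  ultimately show ?thesis by (simp add: e_inv_e)
qed

text \<open>
  The pairing with \<open>\<gamma> (l ^ i) (e (l ^ j)) = l ^ (i j)\<close>.
\<close>

definition \<gamma> :: "'k \<Rightarrow> 'g \<Rightarrow> 'k" where "\<gamma> v h = e_inv h ^ dlog v"

lemma \<gamma>_pairing: "perfect_pairing U H \<gamma>"
proof -
  interpret U: comm_group U by (rule U_group)
  interpret H: comm_group H by (rule H_group)
  have nz: "e_inv h \<noteq> 0" if "h \<in> \<U>" for h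
    using e_inv_in[OF that] N_pos by (auto simp: carrier_U power_0_left)
  have "(\<lambda>i. l ^ i) ` {..<N} = carrier U"
    using primitive_root_exhausts[OF l] primitive_root_pow_order[OF l] by (auto simp: carrier_U)
  moreover have "inj_on (\<lambda>i. l ^ i) {..<N}"
    by (auto simp: inj_on_def primitive_root_pow_eq_iff[OF l])
  ultimately have card_U: "card (carrier U) = N" by (metis card_image card_lessThan)
  show ?thesis
  proof
    show "finite (carrier U)" by (rule finite_U)
    show "finite (carrier H)" using e_bij finite_U by (simp add: bij_betw_finite)
    show "of_nat (card (carrier U)) \<noteq> (0::'k)" "of_nat (card (carrier H)) \<noteq> (0::'k)"
      using primitive_root_of_nat_nonzero[OF l] bij_betw_same_card[OF e_bij] card_U by simp_all
  next
    fix v assume v: "v \<in> carrier U"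
    then show "\<gamma> v \<in> hom H units_group"
      by (simp add: hom_units_group_iff \<gamma>_def nz e_inv_mult power_mult_distrib)
  next
    fix h assume h: "h \<in> carrier H"
    have "e_inv h ^ dlog (v * v') = e_inv h ^ (dlog v + dlog v')"
      if "v \<in> carrier U" "v' \<in> carrier U" for v v'
      using h U_pow_cong[OF e_inv_in dlog_mult] that by simp
    then show "(\<lambda>v. \<gamma> v h) \<in> hom U units_group"
      using h by (simp add: hom_units_group_iff \<gamma>_def nz power_add)
  next
    fix v assume v: "v \<in> carrier U" and 1: "\<And>h. h \<in> carrier H \<Longrightarrow> \<gamma> v h = 1"
    have "v = \<gamma> v (e l)" using v l_in_U by (simp add: \<gamma>_def pow_dlog)
    then show "v = \<one>\<^bsub>U\<^esub>" using 1 e_in[OF l_in_U] by simp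
  next
    fix h assume h: "h \<in> carrier H" and 1: "\<And>v. v \<in> carrier U \<Longrightarrow> \<gamma> v h = 1"
    have hU: "h \<in> \<U>" using h by simp
    have "l ^ dlog l = l ^ 1" using l_in_U by (simp add: pow_dlog)
    then have "dlog l mod N = 1 mod N" unfolding primitive_root_pow_eq_iff[OF l] .
    from U_pow_cong[OF e_inv_in[OF hU] this] have "e_inv h = 1"
      using 1[OF l_in_U] by (simp add: \<gamma>_def)
    then have "h = e 1" using e_e_inv[OF hU] by simp
    also have "e 1 = \<one>\<^bsub>G\<^esub>"
    proof -
      have "e 1 \<in> carrier G"
        using e_in[of 1] U.one_closed subgroup.subset[OF \<U>_subgroup] by auto
      moreover have "e 1 \<otimes>\<^bsub>G\<^esub> e 1 = e 1" using e_mult[of 1 1] U.one_closed by simp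
      ultimately show ?thesis using group.l_cancel_one'[OF group_G, of "e 1" "e 1"] by simp
    qed
    finally show "h = \<one>\<^bsub>H\<^esub>" by simp
  qed
qed

lemma \<beta>_pairing: "perfect_pairing \<G> \<G> \<beta>"
proof
  fix x assume x: "x \<in> carrier \<G>"
  show "\<beta> x \<in> hom \<G> units_group" using \<beta> x by (simp add: self_pairing_def)
  have "\<beta> p x = \<beta> x p" if "p \<in> carrier \<G>" for p using \<beta> x that by (simp add: self_pairing_def)
  then show "(\<lambda>p. \<beta> p x) \<in> hom \<G> units_group"
    using \<beta> x by (simp add: self_pairing_def hom_units_group_iff)
  show "x = \<one>\<^bsub>\<G>\<^esub>" if "\<And>p. p \<in> carrier \<G> \<Longrightarrow> \<beta> x p = 1"
    using \<beta> x that by (simp add: self_pairing_def)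
  show "x = \<one>\<^bsub>\<G>\<^esub>" if "\<And>p. p \<in> carrier \<G> \<Longrightarrow> \<beta> p x = 1"
    using \<beta> x that by (simp add: self_pairing_def)
qed (use finite_\<G> card_\<G> in auto)

sublocale \<beta>: perfect_pairing \<G> \<G> \<beta> by (rule \<beta>_pairing)
sublocale \<gamma>: perfect_pairing U H \<gamma> by (rule \<gamma>_pairing)

lemma \<gamma>_e: "v' \<in> carrier U \<Longrightarrow> \<gamma> v (e v') = v' ^ dlog v"
  by (simp add: \<gamma>_def)

text \<open>
  The adjoint of \<open>\<theta>\<close> with respect to \<open>\<beta>\<close>.
\<close>

definition \<sigma> :: "'a \<Rightarrow> 'a"
  where "\<sigma> = (\<lambda>m\<in>carrier \<G>. SOME m'. m' \<in> carrier \<G> \<and> (\<forall>x\<in>carrier \<G>. \<beta> m (\<theta> x) = \<beta> m' x))"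

lemma \<sigma>_closed_\<beta>:
  assumes m: "m \<in> carrier \<G>"
  shows "\<sigma> m \<in> carrier \<G> \<and> (\<forall>x\<in>carrier \<G>. \<beta> m (\<theta> x) = \<beta> (\<sigma> m) x)"
proof -
  have "(\<lambda>x. \<beta> m (\<theta> x)) \<in> hom \<G> units_group"
    using m \<theta>_auto
    by (simp add: hom_units_group_iff \<beta>.B_nonzero auto_closed auto_mult \<beta>.B_mult_Y)
  from \<beta>.character_is_evaluation[OF this]
  have "\<exists>m'. m' \<in> carrier \<G> \<and> (\<forall>x\<in>carrier \<G>. \<beta> m (\<theta> x) = \<beta> m' x)" by auto
  moreover have "\<sigma> m = (SOME m'. m' \<in> carrier \<G> \<and> (\<forall>x\<in>carrier \<G>. \<beta> m (\<theta> x) = \<beta> m' x))"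
    using m by (simp add: \<sigma>_def)
  ultimately show ?thesis by (simp only:) (rule someI_ex)
qed

lemma \<sigma>_auto: "\<sigma> \<in> auto \<G>"
proof -
  have inj: "inj_on \<sigma> (carrier \<G>)"
  proof (rule inj_onI)
    fix m m' assume m: "m \<in> carrier \<G>" "m' \<in> carrier \<G>" "\<sigma> m = \<sigma> m'"
    show "m = m'"
    proof (rule \<beta>.B_inject[OF m(1,2)])
      fix x assume "x \<in> carrier \<G>"
      then obtain y where "y \<in> carrier \<G>" "x = \<theta> y"
        using \<theta>_auto by (auto simp: auto_def Bij_def bij_betw_def)
      then show "\<beta> m x = \<beta> m' x" using m \<sigma>_closed_\<beta> by metis
    qed
  qed
  have sub: "\<sigma> ` carrier \<G> \<subseteq> carrier \<G>" using \<sigma>_closed_\<beta> by blast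
  have "bij_betw \<sigma> (carrier \<G>) (carrier \<G>)"
    using inj sub finite_\<G> by (simp add: bij_betw_def endo_inj_surj)
  moreover have "\<sigma> (m \<otimes>\<^bsub>\<G>\<^esub> m') = \<sigma> m \<otimes>\<^bsub>\<G>\<^esub> \<sigma> m'" if m: "m \<in> carrier \<G>" "m' \<in> carrier \<G>" for m m'
  proof (rule \<beta>.B_inject)
    fix x assume x: "x \<in> carrier \<G>"
    then have "\<theta> x \<in> carrier \<G>" using \<theta>_auto auto_closed by blast
    then show "\<beta> (\<sigma> (m \<otimes>\<^bsub>\<G>\<^esub> m')) x = \<beta> (\<sigma> m \<otimes>\<^bsub>\<G>\<^esub> \<sigma> m') x"
      using m x \<sigma>_closed_\<beta> by (metis \<beta>.B_mult_P m_closed)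
  qed (use m \<sigma>_closed_\<beta> in auto)
  ultimately show ?thesis
    using \<sigma>_closed_\<beta> by (auto simp: auto_def hom_def Bij_def) (simp add: \<sigma>_def)
qed

lemma \<beta>_funpow_\<sigma>:
  "m \<in> carrier \<G> \<Longrightarrow> x \<in> carrier \<G> \<Longrightarrow> \<beta> ((\<sigma> ^^ i) m) x = \<beta> m ((\<theta> ^^ i) x)"
proof (induction i arbitrary: x)
  case (Suc i)
  then have "\<beta> ((\<sigma> ^^ Suc i) m) x = \<beta> ((\<sigma> ^^ i) m) (\<theta> x)"
    using \<sigma>_closed_\<beta> funpow_auto_closed[OF \<sigma>_auto] by simp
  also have "\<dots> = \<beta> m ((\<theta> ^^ Suc i) x)"
    using Suc \<theta>_auto by (simp add: auto_closed funpow_swap1)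
  finally show ?case .
qed simp

lemma ord_\<sigma>: "group.ord (AutoGroup \<G>) \<sigma> = N"
proof -
  have "group.ord (AutoGroup \<G>) \<sigma> dvd i \<longleftrightarrow> N dvd i" for i
  proof -
    have "(\<forall>m\<in>carrier \<G>. (\<sigma> ^^ i) m = m) \<longleftrightarrow> (\<forall>m\<in>carrier \<G>. \<forall>x\<in>carrier \<G>. \<beta> m ((\<theta> ^^ i) x) = \<beta> m x)"
      using \<beta>.B_inject funpow_auto_closed[OF \<sigma>_auto] \<beta>_funpow_\<sigma> by metis
    also have "\<dots> \<longleftrightarrow> (\<forall>x\<in>carrier \<G>. (\<theta> ^^ i) x = x)"
    proof (intro iffI ballI)
      fix x assume *: "\<forall>m\<in>carrier \<G>. \<forall>x\<in>carrier \<G>. \<beta> m ((\<theta> ^^ i) x) = \<beta> m x" and x: "x \<in> carrier \<G>"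
      have "\<beta> ((\<theta> ^^ i) x) m = \<beta> x m" if "m \<in> carrier \<G>" for m
        using * x that \<beta> funpow_auto_closed[OF \<theta>_auto x] by (simp add: self_pairing_def)
      then show "(\<theta> ^^ i) x = x"
        using x funpow_auto_closed[OF \<theta>_auto x] by (intro \<beta>.B_inject) auto
    qed auto
    finally show ?thesis
      by (simp add: funpow_auto_id_iff[OF \<sigma>_auto] funpow_auto_id_iff[OF \<theta>_auto] N_def)
  qed
  then show ?thesis by (meson dvd_antisym dvd_refl)
qed

abbreviation A' :: "('a \<times> 'g, 'k) hopf" where "A' \<equiv> group_biproduct H \<G> \<mu> \<theta> e"

definition pt :: "'a \<times> 'k \<Rightarrow> 'a \<times> 'g \<Rightarrow> 'k"
  where "pt = (\<lambda>(m, v) (x, h). \<beta> m x * \<gamma> v h)"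

text \<open>
  The multiplication of the semidirect product of \<open>\<G>\<close> and \<open>U\<close>, where \<open>l\<close> acts as \<open>\<sigma>\<close>.
\<close>

definition star :: "'a \<times> 'k \<Rightarrow> 'a \<times> 'k \<Rightarrow> 'a \<times> 'k" (infixl \<open>\<star>\<close> 70)
  where "p \<star> q = (fst p \<otimes>\<^bsub>\<G>\<^esub> (\<sigma> ^^ dlog (snd p)) (fst q), snd p * snd q)"

lemma pt_simp [simp]: "pt (m, v) (x, h) = \<beta> m x * \<gamma> v h"
  by (simp add: pt_def)

lemma star_simp [simp]: "(m, v) \<star> (m', v') = (m \<otimes>\<^bsub>\<G>\<^esub> (\<sigma> ^^ dlog v) m', v * v')"
  by (simp add: star_def)

lemma pt_pairing: "perfect_pairing (\<G> \<times>\<times> U) (\<G> \<times>\<times> H) pt"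
  unfolding pt_def by (rule perfect_pairing_product[OF \<beta>_pairing \<gamma>_pairing])

lemma A'_basis: "hbasis A' = carrier \<G> \<times> \<U>"
  by (simp add: group_biproduct_def biproduct_def group_algebra_def)

lemma \<mu>_trivial: "u \<in> \<U> \<Longrightarrow> x \<in> carrier \<G> \<Longrightarrow> \<mu> u x = x"
  using \<U>_kernel by (auto simp: kernel_def AutoGroup_def BijGroup_def)

lemma A'_mult:
  assumes "f \<in> hspace A'" "g \<in> hspace A'"
  shows "hmult A' f g = hmult (group_algebra (\<G> \<times>\<times> H)) f g"
proof -
  define \<phi> where "\<phi> = (\<lambda>a b. hmult A' (bvec a) (bvec b))"
  have "hmult A' = bilin_ext \<phi>"
    unfolding \<phi>_def group_biproduct_def biproduct_def by simp
  moreover have "\<phi> a b = bvec (a \<otimes>\<^bsub>\<G> \<times>\<times> H\<^esub> b)" if "a \<in> carrier \<G> \<times> \<U>" "b \<in> carrier \<G> \<times> \<U>" for a b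
    using that by (auto simp: \<phi>_def group_biproduct_mult_bvec \<mu>_trivial)
  moreover have "bilin_ext \<phi> f g = bilin_ext (\<lambda>a b. bvec (a \<otimes>\<^bsub>\<G> \<times>\<times> H\<^esub> b)) f g"
    using assms calculation(2) unfolding A'_basis by (rule bilin_ext_fspan_cong)
  ultimately show ?thesis by (simp add: group_algebra_def)
qed

definition comult_basis :: "'a \<times> 'g \<Rightarrow> (('a \<times> 'g) \<times> ('a \<times> 'g) \<Rightarrow>\<^sub>0 'k)"
  where "comult_basis = (\<lambda>(x, h).
    lin_ext (\<lambda>(u, y). bvec ((x, u \<otimes>\<^bsub>G\<^esub> h), (y, h))) (eigen_coaction \<G> \<theta> e (bvec x)))"

lemma A'_comult: "hcomult A' = lin_ext comult_basis"
  unfolding comult_basis_def group_biproduct_def biproduct_def group_algebra_def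
  by (simp add: case_prod_unfold)

text \<open>
  The coaction sends \<open>x\<close> to \<open>\<Sum>\<^sub>r e(r) \<otimes> x\<^sub>r\<close> with \<open>x\<^sub>r\<close> in the \<open>r\<close>-eigenspace.  If \<open>v = l\<^sup>i\<close>, then \<open>v\<close>
  takes the value \<open>r\<^sup>i\<close> on \<open>e(r)\<close>, so that the pairing with \<open>v\<close> turns the sum into \<open>\<theta>\<^sup>i x\<close>.
\<close>

lemma eigen_coaction_basis:
  assumes x: "x \<in> carrier \<G>"
  shows "eigen_coaction \<G> \<theta> e (bvec x) \<in> fspan (\<U> \<times> carrier \<G>)"
    "m \<in> carrier \<G> \<Longrightarrow> v \<in> carrier U \<Longrightarrow>
      lin_form (\<lambda>(u, y). \<gamma> v u * \<beta> m y) (eigen_coaction \<G> \<theta> e (bvec x)) = \<beta> ((\<sigma> ^^ dlog v) m) x"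
proof -
  obtain c :: "'k \<Rightarrow> ('a \<Rightarrow>\<^sub>0 'k)" where c: "eigen_decomp \<G> \<theta> (bvec x) c"
    using diagonalizable[of "bvec x"] x by auto
  then have "(THE c. eigen_decomp \<G> \<theta> (bvec x) c) = c"
    using eigen_decomp_unique by blast
  then have coact: "eigen_coaction \<G> \<theta> e (bvec x) = (\<Sum>l | c l \<noteq> 0. tens (bvec (e l)) (c l))"
    by (simp add: eigen_coaction_def)
  have c_in: "c l \<in> fspan (carrier \<G>)" for l
    using c by (simp add: eigen_decomp_def eigenspace_def)
  have U_in: "l \<in> carrier U" if "c l \<noteq> 0" for l
    using c that by (intro eigenvalue_in_U) (auto simp: eigen_decomp_def)
  show "eigen_coaction \<G> \<theta> e (bvec x) \<in> fspan (\<U> \<times> carrier \<G>)"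
    unfolding coact by (intro fspan_sum fspan_tens c_in) (simp add: e_in U_in)
  assume m: "m \<in> carrier \<G>" and v: "v \<in> carrier U"
  have "lin_form (\<lambda>(u, y). \<gamma> v u * \<beta> m y) (eigen_coaction \<G> \<theta> e (bvec x)) =
      (\<Sum>l | c l \<noteq> 0. \<gamma> v (e l) * lin_form (\<beta> m) (c l))"
    unfolding coact lin_form_sum lin_form_tens by simp
  also have "\<dots> = (\<Sum>l | c l \<noteq> 0. lin_form (\<beta> m) (scale (l ^ dlog v) (c l)))"
    by (intro sum.cong) (auto simp: \<gamma>_e U_in lin_form_scale)
  also have "\<dots> = lin_form (\<beta> m) (lin_ext (\<lambda>x. bvec ((\<theta> ^^ dlog v) x)) (bvec x))"
    unfolding eigen_decomp_funpow[OF c] by (simp add: lin_form_sum)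
  also have "\<dots> = \<beta> ((\<sigma> ^^ dlog v) m) x"
    using m x by (simp add: \<beta>_funpow_\<sigma>)
  finally show "lin_form (\<lambda>(u, y). \<gamma> v u * \<beta> m y) (eigen_coaction \<G> \<theta> e (bvec x)) =
    \<beta> ((\<sigma> ^^ dlog v) m) x" .
qed

text \<open>
  This is where the semidirect product appears: the coaction is the only source of the power of \<open>\<sigma>\<close>
  in the product of points.
\<close>

lemma comult_basis_pt:
  assumes x: "x \<in> carrier \<G>" and h: "h \<in> \<U>"
  shows "comult_basis (x, h) \<in> fspan ((carrier \<G> \<times> \<U>) \<times> (carrier \<G> \<times> \<U>))"
    "p \<in> carrier \<G> \<times> carrier U \<Longrightarrow> q \<in> carrier \<G> \<times> carrier U \<Longrightarrow>
      lin_form (\<lambda>(a, b). pt p a * pt q b) (comult_basis (x, h)) = pt (p \<star> q) (x, h)"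
proof -
  show "comult_basis (x, h) \<in> fspan ((carrier \<G> \<times> \<U>) \<times> (carrier \<G> \<times> \<U>))"
    unfolding comult_basis_def using x h \<gamma>.Y.m_closed
    by (auto intro!: fspan_lin_ext[OF eigen_coaction_basis(1)[OF x]])
  assume p: "p \<in> carrier \<G> \<times> carrier U" and q: "q \<in> carrier \<G> \<times> carrier U"
  obtain m v m' v' where mv: "p = (m, v)" "q = (m', v')" "m \<in> carrier \<G>" "v \<in> carrier U"
    "m' \<in> carrier \<G>" "v' \<in> carrier U" using p q by auto
  have "lin_form (\<lambda>(a, b). pt p a * pt q b) (comult_basis (x, h)) =
      lin_form (\<lambda>p. (\<beta> m x * \<gamma> v h * \<gamma> v' h) * (case p of (u, y) \<Rightarrow> \<gamma> v u * \<beta> m' y))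
        (eigen_coaction \<G> \<theta> e (bvec x))"
    unfolding comult_basis_def
    using mv h \<gamma>.B_mult_Y[of v _ h]
    by (auto intro!: lin_form_lin_ext_fspan_cong[OF eigen_coaction_basis(1)[OF x]] simp: mult_ac)
  also have "\<dots> = (\<beta> m x * \<gamma> v h * \<gamma> v' h) * \<beta> ((\<sigma> ^^ dlog v) m') x"
    unfolding lin_form_mult_left eigen_coaction_basis(2)[OF x mv(5,4)] ..
  also have "\<dots> = pt (p \<star> q) (x, h)"
    using mv x h \<gamma>.B_mult_P[of v v' h] funpow_auto_closed[OF \<sigma>_auto]
    by (simp add: \<beta>.B_mult_P mult_ac)
  finally show "lin_form (\<lambda>(a, b). pt p a * pt q b) (comult_basis (x, h)) = pt (p \<star> q) (x, h)" .
qed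

text \<open>
  The product is that of the group algebra because \<open>\<^bold>U\<close> acts trivially, and the coproduct is dual to
  the semidirect product because of the coaction.
\<close>

lemma A'_point_hopf: "point_hopf (\<G> \<times>\<times> U) (\<G> \<times>\<times> H) pt A' (\<star>) (\<one>\<^bsub>\<G>\<^esub>, 1)"
proof -
  interpret pt: perfect_pairing "\<G> \<times>\<times> U" "\<G> \<times>\<times> H" pt by (rule pt_pairing)
  show ?thesis
  proof
    show "hbasis A' = carrier (\<G> \<times>\<times> H)" by (simp add: A'_basis)
    show "hcomult A' f \<in> fspan (carrier (\<G> \<times>\<times> H) \<times> carrier (\<G> \<times>\<times> H))" if "f \<in> hspace A'" for f
      using that comult_basis_pt(1) unfolding A'_comult A'_basis
      by (intro fspan_lin_ext[of f "carrier \<G> \<times> \<U>"]) auto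
    show "lin_form (\<lambda>(x, y). pt p x * pt q y) (hcomult A' f) = pt.ev (p \<star> q) f"
      if "p \<in> carrier (\<G> \<times>\<times> U)" "q \<in> carrier (\<G> \<times>\<times> U)" "f \<in> hspace A'" for p q f
      using that comult_basis_pt(2) unfolding A'_comult A'_basis pt.ev_def
      by (intro lin_form_lin_ext_fspan_cong[of f "carrier \<G> \<times> \<U>"]) auto
    show "hcounit A' f = pt.ev (\<one>\<^bsub>\<G>\<^esub>, 1) f" if "f \<in> hspace A'" for f
    proof -
      have "hcounit A' f = lin_form (\<lambda>(b, h). 1) f"
        by (simp add: group_biproduct_def biproduct_def group_algebra_def)
      also have "\<dots> = pt.ev (\<one>\<^bsub>\<G>\<^esub>, 1) f"
        using that \<gamma>.B_one_P unfolding pt.ev_def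
        by (intro lin_form_fspan_cong[of f "carrier \<G> \<times> \<U>"]) (auto simp: A'_basis)
      finally show ?thesis .
    qed
    show "p \<star> q \<in> carrier (\<G> \<times>\<times> U)" if "p \<in> carrier (\<G> \<times>\<times> U)" "q \<in> carrier (\<G> \<times>\<times> U)" for p q
      using that funpow_auto_closed[OF \<sigma>_auto] \<gamma>.P.m_closed by (auto simp: star_def)
    show "(\<one>\<^bsub>\<G>\<^esub>, 1) \<in> carrier (\<G> \<times>\<times> U)" using \<gamma>.P.one_closed by simp
    show "hmult A' f g = hmult (group_algebra (\<G> \<times>\<times> H)) f g" if "f \<in> hspace A'" "g \<in> hspace A'" for f g
      using that by (rule A'_mult)
    show "hone A' = bvec \<one>\<^bsub>\<G> \<times>\<times> H\<^esub>"
      by (simp add: group_biproduct_def biproduct_def group_algebra_def)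
  qed
qed

sublocale A: point_hopf "\<G> \<times>\<times> U" "\<G> \<times>\<times> H" pt A' "(\<star>)" "(\<one>\<^bsub>\<G>\<^esub>, 1)"
  by (rule A'_point_hopf)

lemma group_algebra_point_coalgebra:
  "point_coalgebra \<G> \<G> \<beta> (group_algebra \<G>) (\<otimes>\<^bsub>\<G>\<^esub>) \<one>\<^bsub>\<G>\<^esub>"
proof
  show "hbasis (group_algebra \<G>) = carrier \<G>" by (simp add: group_algebra_def)
  show "hcomult (group_algebra \<G>) f \<in> fspan (carrier \<G> \<times> carrier \<G>)"
    if "f \<in> hspace (group_algebra \<G>)" for f :: "'a \<Rightarrow>\<^sub>0 'k"
    using that by (auto simp: group_algebra_def intro!: fspan_lin_ext)
  show "lin_form (\<lambda>(x, y). \<beta> p x * \<beta> q y) (hcomult (group_algebra \<G>) f) = \<beta>.ev (p \<otimes>\<^bsub>\<G>\<^esub> q) f"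
    if "p \<in> carrier \<G>" "q \<in> carrier \<G>" "f \<in> hspace (group_algebra \<G>)" for p q f
    using that unfolding group_algebra_def \<beta>.ev_def
    by (auto intro!: lin_form_lin_ext_fspan_cong[of f "carrier \<G>"] simp: \<beta>.B_mult_P)
  show "hcounit (group_algebra \<G>) f = \<beta>.ev \<one>\<^bsub>\<G>\<^esub> f" if "f \<in> hspace (group_algebra \<G>)" for f
    using that unfolding group_algebra_def \<beta>.ev_def
    by (auto intro!: lin_form_fspan_cong[of f "carrier \<G>"])
qed auto

sublocale B: point_coalgebra \<G> \<G> \<beta> "group_algebra \<G>" "(\<otimes>\<^bsub>\<G>\<^esub>)" "\<one>\<^bsub>\<G>\<^esub>"
  by (rule group_algebra_point_coalgebra)

text \<open>
  The projection is the restriction of functions to \<open>1 \<times> U\<close>.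
\<close>

lemma proj_iff_points:
  assumes "f \<in> hspace A'" "g \<in> hspace A'"
  shows "bip_proj (group_algebra \<G>) f = bip_proj (group_algebra \<G>) g \<longleftrightarrow>
    (\<forall>v\<in>carrier U. A.ev (\<one>\<^bsub>\<G>\<^esub>, v) f = A.ev (\<one>\<^bsub>\<G>\<^esub>, v) g)"
proof -
  let ?\<pi> = "bip_proj (group_algebra \<G>) :: ('a \<times> 'g \<Rightarrow>\<^sub>0 'k) \<Rightarrow> _"
  have \<pi>: "?\<pi> = lin_ext (\<lambda>(b, h). bvec h)"
    by (simp add: bip_proj_def group_algebra_def)
  have \<pi>_in: "?\<pi> f \<in> fspan (carrier H)" if "f \<in> hspace A'" for f
    using that unfolding \<pi> A'_basis by (auto intro!: fspan_lin_ext)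
  have ev: "\<gamma>.ev v (?\<pi> f) = A.ev (\<one>\<^bsub>\<G>\<^esub>, v) f" if "f \<in> hspace A'" for f v
    using that unfolding \<pi> \<gamma>.ev_def A.ev_def A'_basis
    by (auto intro!: lin_form_lin_ext_fspan_cong[of f "carrier \<G> \<times> \<U>"])
  show ?thesis
    using \<gamma>.ev_eqI[OF \<pi>_in[OF assms(1)] \<pi>_in[OF assms(2)]] ev[OF assms(1)] ev[OF assms(2)] by metis
qed

abbreviation embed :: "('a \<Rightarrow>\<^sub>0 'k) \<Rightarrow> ('a \<times> 'g \<Rightarrow>\<^sub>0 'k)"
  where "embed b \<equiv> tens b (hone (group_algebra H))"

text \<open>
  \<open>b \<mapsto> b \<times> 1\<close> is the pullback of functions along \<open>(m, v) \<mapsto> m\<close>.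
\<close>

lemma embed_points:
  assumes "b \<in> hspace (group_algebra \<G>)"
  shows "embed b \<in> hspace A'" "v \<in> carrier U \<Longrightarrow> A.ev (m, v) (embed b) = \<beta>.ev m b"
proof -
  show "embed b \<in> hspace A'"
    using assms \<gamma>.Y.one_closed by (auto simp: A'_basis group_algebra_def intro!: fspan_tens)
  assume "v \<in> carrier U"
  then show "A.ev (m, v) (embed b) = \<beta>.ev m b"
    using \<gamma>.B_one_Y[of v] lin_form_tens[of "\<beta> m" "\<gamma> v"]
    unfolding A.ev_def \<beta>.ev_def by (simp add: pt_def group_algebra_def)
qed

lemma linear_embed: "linear_on V embed"
  by (simp add: linear_on_def tens_def bilin_ext_def lin_ext_add lin_ext_scale)

text \<open>
  The left projection is the restriction of functions to \<open>\<G> \<times> 1\<close>.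
\<close>

lemma left_proj_points:
  assumes f: "f \<in> hspace A'"
  shows "bip_left_proj (group_algebra H) f \<in> hspace (group_algebra \<G>)"
    "\<beta>.ev m (bip_left_proj (group_algebra H) f) = A.ev (m, 1) f"
proof -
  have \<Pi>: "bip_left_proj (group_algebra H) = lin_ext (\<lambda>(b, h). bvec b)"
    by (simp add: bip_left_proj_def group_algebra_def)
  show "bip_left_proj (group_algebra H) f \<in> hspace (group_algebra \<G>)"
    using f unfolding \<Pi> A'_basis by (auto simp: group_algebra_def intro!: fspan_lin_ext)
  show "\<beta>.ev m (bip_left_proj (group_algebra H) f) = A.ev (m, 1) f"
    using f \<gamma>.B_one_P unfolding \<Pi> \<beta>.ev_def A.ev_def A'_basis
    by (auto intro!: lin_form_lin_ext_fspan_cong[of f "carrier \<G> \<times> \<U>"])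
qed

lemma left_part_points:
  assumes F: "F \<in> hspace A' \<rightarrow> hspace A'" "linear_on (hspace A') F"
  shows "left_part (group_algebra H) F \<in> hspace (group_algebra \<G>) \<rightarrow> hspace (group_algebra \<G>)"
    "linear_on (hspace (group_algebra \<G>)) (left_part (group_algebra H) F)"
    "b \<in> hspace (group_algebra \<G>) \<Longrightarrow>
      \<beta>.ev m (left_part (group_algebra H) F b) = A.ev (m, 1) (F (embed b))"
proof -
  have F_embed: "F (embed b) \<in> hspace A'" if "b \<in> hspace (group_algebra \<G>)" for b
    using F(1) embed_points(1)[OF that] by blast
  show "left_part (group_algebra H) F \<in> hspace (group_algebra \<G>) \<rightarrow> hspace (group_algebra \<G>)"
    using left_proj_points(1) F_embed by (simp add: left_part_def)
  show "linear_on (hspace (group_algebra \<G>)) (left_part (group_algebra H) F)"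
    using F(2) linear_embed[of "hspace (group_algebra \<G>)"] embed_points(1)
    by (simp add: linear_on_def left_part_def bip_left_proj_def lin_ext_add lin_ext_scale)
  show "\<beta>.ev m (left_part (group_algebra H) F b) = A.ev (m, 1) (F (embed b))"
    if "b \<in> hspace (group_algebra \<G>)"
    using left_proj_points(2)[OF F_embed[OF that]] by (simp add: left_part_def)
qed

end


section \<open>Twisted permutations\<close>

text \<open>
  With \<open>N = d q\<close>, where \<open>d\<close> is the length of the orbit of \<open>m\<close>, the equation that defines the exponent
  \<open>i\<close> reads \<open>l ^ (c q) = l ^ (i q)\<close>, that is \<open>i \<equiv> c\<close> modulo \<open>d\<close>; and only the class of \<open>c\<close> modulo \<open>d\<close> matters
  for \<open>\<sigma>\<^sup>c(m)\<close>.
\<close>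

lemma (in group) twist_exponent_funpow:
  assumes \<sigma>: "\<sigma> \<in> auto G" and fin: "finite (carrier G)" and m: "m \<in> carrier G"
    and l: "primitive_root (group.ord (AutoGroup G) \<sigma>) (l::'k::field)"
    and c: "\<alpha> s / \<alpha> m = l ^ c"
  shows "(\<sigma> ^^ twist_exponent G l \<sigma> \<alpha> s m) m = (\<sigma> ^^ c) m"
proof -
  define N where "N = group.ord (AutoGroup G) \<sigma>"
  define d where "d = card (aut_orbit G \<sigma> m)"
  note orb = funpow_eq_iff_mod_card_orbit[OF \<sigma> m fin, folded d_def]
  obtain q where q: "N = d * q" using orb(3) by (auto simp: N_def)
  have N: "N > 0" unfolding N_def by (rule auto_ord_pos[OF \<sigma> fin])
  then have q0: "q > 0" using q by simp
  have "(\<alpha> s / \<alpha> m) ^ (N div d) = (l ^ (N div d)) ^ i \<longleftrightarrow> i mod d = c mod d" for i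
  proof -
    have "(\<alpha> s / \<alpha> m) ^ (N div d) = (l ^ (N div d)) ^ i \<longleftrightarrow> l ^ (c * q) = l ^ (i * q)"
      using q orb(1) c by (simp add: mult.commute[of i] flip: power_mult)
    also have "\<dots> \<longleftrightarrow> (c * q) mod (d * q) = (i * q) mod (d * q)"
      using primitive_root_pow_eq_iff[OF l] q by (simp add: N_def)
    also have "\<dots> \<longleftrightarrow> i mod d = c mod d" using q0 by (auto simp: mod_mult_mult2)
    finally show ?thesis .
  qed
  then have "twist_exponent G l \<sigma> \<alpha> s m = (THE i. i < d \<and> i mod d = c mod d)"
    by (simp add: twist_exponent_def Let_def flip: N_def d_def)
  also have "\<dots> = c mod d" using orb(1) by (intro the_equality) auto
  finally show ?thesis using orb(2)[of "c mod d" c] by simp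
qed

context dual_biproduct
begin

lemma funpow_dlog_mult:
  assumes "v \<in> carrier U" "v' \<in> carrier U" "m \<in> carrier \<G>"
  shows "(\<sigma> ^^ dlog (v * v')) m = (\<sigma> ^^ dlog v) ((\<sigma> ^^ dlog v') m)"
  using funpow_auto_cong[OF \<sigma>_auto assms(3), of "dlog (v * v')" "dlog v + dlog v'"]
    dlog_mult[OF assms(1,2)] by (simp add: ord_\<sigma> funpow_add)

lemma funpow_dlog_one: "m \<in> carrier \<G> \<Longrightarrow> (\<sigma> ^^ dlog 1) m = m"
proof -
  have "l ^ dlog 1 = l ^ 0" using pow_dlog[of 1] \<gamma>.P.one_closed by simp
  then show "m \<in> carrier \<G> \<Longrightarrow> ?thesis"
    using funpow_auto_cong[OF \<sigma>_auto, of m "dlog 1" 0]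
    unfolding primitive_root_pow_eq_iff[OF l] ord_\<sigma> by simp
qed

lemma funpow_dlog_l: "m \<in> carrier \<G> \<Longrightarrow> (\<sigma> ^^ dlog l) m = \<sigma> m"
proof -
  have "l ^ dlog l = l ^ 1" using pow_dlog[OF l_in_U] by simp
  then show "m \<in> carrier \<G> \<Longrightarrow> ?thesis"
    using funpow_auto_cong[OF \<sigma>_auto, of m "dlog l" 1]
    unfolding primitive_root_pow_eq_iff[OF l] ord_\<sigma> by simp
qed

text \<open>
  The conditions under which \<open>(s, v) \<mapsto> (\<tau> s, \<alpha> s \<cdot> v)\<close> is an automorphism of the semidirect
  product: it has to preserve products of two elements of \<open>\<G>\<close>, and conjugation by the generator \<open>l\<close> of \<open>U\<close>.
\<close>

definition twisted_hom :: "('a \<Rightarrow> 'a) \<Rightarrow> ('a \<Rightarrow> 'k) \<Rightarrow> bool"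
  where "twisted_hom \<tau> \<alpha> \<longleftrightarrow> \<tau> \<in> Bij (carrier \<G>) \<and> \<alpha> \<in> extensional (carrier \<G>) \<and>
    (\<forall>s\<in>carrier \<G>. \<alpha> s \<in> carrier U) \<and>
    (\<forall>s\<in>carrier \<G>. \<forall>m\<in>carrier \<G>. \<alpha> (s \<otimes>\<^bsub>\<G>\<^esub> m) = \<alpha> s * \<alpha> m) \<and>
    (\<forall>m\<in>carrier \<G>. \<tau> (\<sigma> m) = \<sigma> (\<tau> m)) \<and> (\<forall>m\<in>carrier \<G>. \<alpha> (\<sigma> m) = \<alpha> m) \<and>
    (\<forall>s\<in>carrier \<G>. \<forall>m\<in>carrier \<G>. \<tau> (s \<otimes>\<^bsub>\<G>\<^esub> m) = \<tau> s \<otimes>\<^bsub>\<G>\<^esub> (\<sigma> ^^ dlog (\<alpha> s)) (\<tau> m))"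

lemma funpow_commute:
  assumes "\<tau> \<in> Bij (carrier \<G>)" "\<forall>m\<in>carrier \<G>. \<tau> (\<sigma> m) = \<sigma> (\<tau> m)" "m \<in> carrier \<G>"
  shows "\<tau> ((\<sigma> ^^ i) m) = (\<sigma> ^^ i) (\<tau> m)"
  using assms by (induction i) (auto simp: funpow_auto_closed[OF \<sigma>_auto])

text \<open>
  The identity for \<open>\<tau>(s m)\<close> is the one for \<open>\<tau>(s' m\<^sup>-\<^sup>1)\<close> with \<open>s' = s m\<close>, since then
  \<open>\<alpha>(s') / \<alpha>(m) = \<alpha>(s)\<close>.
\<close>

lemma twisted_hom_iff: "twisted_hom \<tau> \<alpha> \<longleftrightarrow> (\<tau>, \<alpha>) \<in> twist_pairs \<G> \<sigma> l"
proof -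
  let ?sub = "\<forall>s\<in>carrier \<G>. \<forall>m\<in>carrier \<G>. \<tau> (s \<otimes>\<^bsub>\<G>\<^esub> inv\<^bsub>\<G>\<^esub> m) =
      \<tau> s \<otimes>\<^bsub>\<G>\<^esub> inv\<^bsub>\<G>\<^esub> (\<tau> ((\<sigma> ^^ twist_exponent \<G> l \<sigma> \<alpha> s m) m))"
  let ?add = "\<forall>s\<in>carrier \<G>. \<forall>m\<in>carrier \<G>. \<tau> (s \<otimes>\<^bsub>\<G>\<^esub> m) = \<tau> s \<otimes>\<^bsub>\<G>\<^esub> (\<sigma> ^^ dlog (\<alpha> s)) (\<tau> m)"
  have sub_iff_add: "?sub \<longleftrightarrow> ?add"
    if \<tau>: "\<tau> \<in> Bij (carrier \<G>)" "\<forall>m\<in>carrier \<G>. \<tau> (\<sigma> m) = \<sigma> (\<tau> m)"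
      and \<alpha>: "\<alpha> \<in> hom \<G> units_group" and \<alpha>U: "\<forall>s\<in>carrier \<G>. \<alpha> s \<in> carrier U"
  proof -
    have \<tau>c: "\<tau> m \<in> carrier \<G>" if "m \<in> carrier \<G>" for m
      using \<tau>(1) that Bij_imp_funcset by blast
    have exponent: "\<tau> ((\<sigma> ^^ twist_exponent \<G> l \<sigma> \<alpha> (s \<otimes>\<^bsub>\<G>\<^esub> m) m) m) = (\<sigma> ^^ dlog (\<alpha> s)) (\<tau> m)"
      if sm: "s \<in> carrier \<G>" "m \<in> carrier \<G>" for s m
    proof -
      have "\<alpha> (s \<otimes>\<^bsub>\<G>\<^esub> m) / \<alpha> m = l ^ dlog (\<alpha> s)"
        using sm \<alpha> \<alpha>U by (simp add: hom_units_group_iff pow_dlog)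
      from twist_exponent_funpow[OF \<sigma>_auto finite_\<G> sm(2) l[folded ord_\<sigma>] this]
      show ?thesis using funpow_commute[OF \<tau> sm(2)] by simp
    qed
    have step: "\<tau> ((s \<otimes>\<^bsub>\<G>\<^esub> m) \<otimes>\<^bsub>\<G>\<^esub> inv\<^bsub>\<G>\<^esub> m) = \<tau> (s \<otimes>\<^bsub>\<G>\<^esub> m) \<otimes>\<^bsub>\<G>\<^esub>
        inv\<^bsub>\<G>\<^esub> (\<tau> ((\<sigma> ^^ twist_exponent \<G> l \<sigma> \<alpha> (s \<otimes>\<^bsub>\<G>\<^esub> m) m) m)) \<longleftrightarrow>
        \<tau> (s \<otimes>\<^bsub>\<G>\<^esub> m) = \<tau> s \<otimes>\<^bsub>\<G>\<^esub> (\<sigma> ^^ dlog (\<alpha> s)) (\<tau> m)"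
      if sm: "s \<in> carrier \<G>" "m \<in> carrier \<G>" for s m
    proof -
      have "(s \<otimes>\<^bsub>\<G>\<^esub> m) \<otimes>\<^bsub>\<G>\<^esub> inv\<^bsub>\<G>\<^esub> m = s" using sm by (simp add: m_assoc)
      then show ?thesis
        unfolding exponent[OF sm]
        using sm \<tau>c funpow_auto_closed[OF \<sigma>_auto] by (auto simp: inv_solve_right)
    qed
    show ?thesis
    proof (intro iffI ballI)
      fix s m assume ?sub and sm: "s \<in> carrier \<G>" "m \<in> carrier \<G>"
      then show "\<tau> (s \<otimes>\<^bsub>\<G>\<^esub> m) = \<tau> s \<otimes>\<^bsub>\<G>\<^esub> (\<sigma> ^^ dlog (\<alpha> s)) (\<tau> m)"
        using step[OF sm] by simp
    next
      fix s m assume add: ?add and sm: "s \<in> carrier \<G>" "m \<in> carrier \<G>"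
      define t where "t = s \<otimes>\<^bsub>\<G>\<^esub> inv\<^bsub>\<G>\<^esub> m"
      have t: "t \<in> carrier \<G>" "t \<otimes>\<^bsub>\<G>\<^esub> m = s" using sm by (simp_all add: t_def m_assoc)
      from add t(1) sm(2) have "\<tau> (t \<otimes>\<^bsub>\<G>\<^esub> m) = \<tau> t \<otimes>\<^bsub>\<G>\<^esub> (\<sigma> ^^ dlog (\<alpha> t)) (\<tau> m)" by blast
      from step[OF t(1) sm(2), THEN iffD2, OF this] show "\<tau> (s \<otimes>\<^bsub>\<G>\<^esub> inv\<^bsub>\<G>\<^esub> m) =
          \<tau> s \<otimes>\<^bsub>\<G>\<^esub> inv\<^bsub>\<G>\<^esub> (\<tau> ((\<sigma> ^^ twist_exponent \<G> l \<sigma> \<alpha> s m) m))"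
        unfolding t(2) .
    qed
  qed
  let ?common = "\<tau> \<in> Bij (carrier \<G>) \<and> \<alpha> \<in> extensional (carrier \<G>) \<and> \<alpha> \<in> hom \<G> units_group \<and>
    (\<forall>s\<in>carrier \<G>. \<alpha> s \<in> carrier U) \<and> (\<forall>m\<in>carrier \<G>. \<tau> (\<sigma> m) = \<sigma> (\<tau> m)) \<and>
    (\<forall>m\<in>carrier \<G>. \<alpha> (\<sigma> m) = \<alpha> m)"
  have "(\<tau>, \<alpha>) \<in> twist_pairs \<G> \<sigma> l \<longleftrightarrow> ?common \<and> ?sub"
    unfolding twist_pairs_def characters_def ord_\<sigma> carrier_U by auto
  moreover have "v \<noteq> 0" if "v \<in> carrier U" for v
    using that N_pos by (auto simp: carrier_U power_0_left)
  then have "twisted_hom \<tau> \<alpha> \<longleftrightarrow> ?common \<and> ?add"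
    unfolding twisted_hom_def hom_units_group_iff by blast
  ultimately show ?thesis using sub_iff_add by blast
qed

lemma twisted_hom_one:
  assumes "twisted_hom \<tau> \<alpha>"
  shows "\<tau> \<one>\<^bsub>\<G>\<^esub> = \<one>\<^bsub>\<G>\<^esub>" "\<alpha> \<one>\<^bsub>\<G>\<^esub> = 1"
proof -
  let ?c = "(\<sigma> ^^ dlog (\<alpha> \<one>\<^bsub>\<G>\<^esub>))"
  have \<tau>1: "\<tau> \<one>\<^bsub>\<G>\<^esub> \<in> carrier \<G>"
    using assms Bij_imp_funcset by (fastforce simp: twisted_hom_def)
  have "\<tau> (\<one>\<^bsub>\<G>\<^esub> \<otimes>\<^bsub>\<G>\<^esub> \<one>\<^bsub>\<G>\<^esub>) = \<tau> \<one>\<^bsub>\<G>\<^esub> \<otimes>\<^bsub>\<G>\<^esub> ?c (\<tau> \<one>\<^bsub>\<G>\<^esub>)"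
    using assms unfolding twisted_hom_def by blast
  then have "?c (\<tau> \<one>\<^bsub>\<G>\<^esub>) = \<one>\<^bsub>\<G>\<^esub>"
    using \<tau>1 funpow_auto_closed[OF \<sigma>_auto \<tau>1] l_cancel_one' by (metis l_one one_closed)
  then show "\<tau> \<one>\<^bsub>\<G>\<^esub> = \<one>\<^bsub>\<G>\<^esub>"
    using funpow_auto_inj[OF \<sigma>_auto \<tau>1 one_closed] funpow_auto_one[OF \<sigma>_auto] by metis
  have "\<alpha> (\<one>\<^bsub>\<G>\<^esub> \<otimes>\<^bsub>\<G>\<^esub> \<one>\<^bsub>\<G>\<^esub>) = \<alpha> \<one>\<^bsub>\<G>\<^esub> * \<alpha> \<one>\<^bsub>\<G>\<^esub>" "\<alpha> \<one>\<^bsub>\<G>\<^esub> \<in> carrier U"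
    using assms unfolding twisted_hom_def by blast+
  moreover have "\<alpha> \<one>\<^bsub>\<G>\<^esub> \<noteq> 0" using calculation(2) N_pos by (auto simp: carrier_U power_0_left)
  ultimately show "\<alpha> \<one>\<^bsub>\<G>\<^esub> = 1" by simp
qed

text \<open>
  The identity for \<open>\<tau> (s m)\<close> determines the power of \<open>\<sigma>\<close> that belongs to \<open>\<alpha> s\<close> on the range of \<open>\<tau>\<close>,
  which is everything.  As \<open>\<sigma>\<close> has order \<open>N\<close>, this power determines \<open>\<alpha> s\<close>.
\<close>

lemma twisted_hom_unique:
  assumes "twisted_hom \<tau> \<alpha>" "twisted_hom \<tau> \<alpha>'"
  shows "\<alpha> = \<alpha>'"
proof (rule extensionalityI)
  show "\<alpha> \<in> extensional (carrier \<G>)" "\<alpha>' \<in> extensional (carrier \<G>)"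
    using assms by (auto simp: twisted_hom_def)
  fix s assume s: "s \<in> carrier \<G>"
  have \<tau>: "\<tau> ` carrier \<G> = carrier \<G>"
    using assms(1) by (simp add: twisted_hom_def Bij_def bij_betw_def)
  have \<alpha>U: "\<alpha> s \<in> carrier U" "\<alpha>' s \<in> carrier U" using assms s by (auto simp: twisted_hom_def)
  have eq: "(\<sigma> ^^ dlog (\<alpha> s)) m = (\<sigma> ^^ dlog (\<alpha>' s)) m" if m: "m \<in> carrier \<G>" for m
  proof -
    obtain n where n: "n \<in> carrier \<G>" "m = \<tau> n" using m \<tau> by blast
    have "\<tau> s \<otimes>\<^bsub>\<G>\<^esub> (\<sigma> ^^ dlog (\<alpha> s)) m = \<tau> s \<otimes>\<^bsub>\<G>\<^esub> (\<sigma> ^^ dlog (\<alpha>' s)) m"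
      using assms s n unfolding twisted_hom_def by metis
    moreover have "\<tau> s \<in> carrier \<G>" using \<tau> s by blast
    ultimately show ?thesis using m funpow_auto_closed[OF \<sigma>_auto] by simp
  qed
  have "i mod N = j mod N" if "\<forall>m\<in>carrier \<G>. (\<sigma> ^^ i) m = (\<sigma> ^^ j) m" for i j
    using that
  proof (induction i j rule: linorder_wlog)
    case (le i j)
    have "(\<sigma> ^^ (j - i)) m = m" if m: "m \<in> carrier \<G>" for m
    proof -
      have "(\<sigma> ^^ i) ((\<sigma> ^^ (j - i)) m) = (\<sigma> ^^ i) m"
        using le m funpow_add[of i "j - i" \<sigma>] by simp
      then show ?thesis using funpow_auto_inj[OF \<sigma>_auto] funpow_auto_closed[OF \<sigma>_auto m] m by blast
    qed
    then have "N dvd j - i" using funpow_auto_id_iff[OF \<sigma>_auto, of "j - i"] ord_\<sigma> by simp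
    then show ?case using le by (metis mod_eq_dvd_iff_nat)
  qed (metis)
  then have "l ^ dlog (\<alpha> s) = l ^ dlog (\<alpha>' s)" using eq by (simp add: primitive_root_pow_eq_iff[OF l])
  then show "\<alpha> s = \<alpha>' s" using \<alpha>U by (simp add: pow_dlog)
qed


section \<open>Automorphisms and twisted permutations\<close>

abbreviation Pts :: "('a \<times> 'k) set" where "Pts \<equiv> carrier \<G> \<times> carrier U"

text \<open>
  The map on points is taken in the direction opposite to the transpose of \<open>F\<close>: the point \<open>q\<close> goes to
  the point \<open>p\<close> whose pullback along \<open>F\<close> is \<open>q\<close>.  In this way composition of automorphisms
  corresponds to composition of maps on points in the same order.
\<close>

definition moves :: "(('a \<times> 'g \<Rightarrow>\<^sub>0 'k) \<Rightarrow> ('a \<times> 'g \<Rightarrow>\<^sub>0 'k)) \<Rightarrow> 'a \<times> 'k \<Rightarrow> 'a \<times> 'k \<Rightarrow> bool"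
  where "moves F q p \<longleftrightarrow> p \<in> Pts \<and> q \<in> Pts \<and> (\<forall>f\<in>hspace A'. A.ev p (F f) = A.ev q f)"

definition twist_map :: "('a \<Rightarrow> 'a) \<Rightarrow> ('a \<Rightarrow> 'k) \<Rightarrow> 'a \<times> 'k \<Rightarrow> 'a \<times> 'k"
  where "twist_map \<tau> \<alpha> = (\<lambda>(s, v). (\<tau> s, \<alpha> s * v))"

definition realizes where "realizes F \<tau> \<alpha> \<longleftrightarrow> twisted_hom \<tau> \<alpha> \<and> (\<forall>q\<in>Pts. moves F q (twist_map \<tau> \<alpha> q))"

abbreviation Aut where
  "Aut \<equiv> Aut_Hopf A' (bip_proj (group_algebra \<G>) :: ('a \<times> 'g \<Rightarrow>\<^sub>0 'k) \<Rightarrow> ('g \<Rightarrow>\<^sub>0 'k))"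

lemma Aut_iff: "F \<in> carrier Aut \<longleftrightarrow> F \<in> Bij (hspace A') \<and> hopf_map A' A' F \<and>
    (\<forall>f\<in>hspace A'. \<forall>v\<in>carrier U. A.ev (\<one>\<^bsub>\<G>\<^esub>, v) (F f) = A.ev (\<one>\<^bsub>\<G>\<^esub>, v) f)"
proof -
  have "bip_proj (group_algebra \<G>) (F f) = bip_proj (group_algebra \<G>) f \<longleftrightarrow>
      (\<forall>v\<in>carrier U. A.ev (\<one>\<^bsub>\<G>\<^esub>, v) (F f) = A.ev (\<one>\<^bsub>\<G>\<^esub>, v) f)"
    if "F \<in> Bij (hspace A')" "f \<in> hspace A'" for f
    using that by (intro proj_iff_points) (auto simp: Bij_def bij_betw_def)
  then show ?thesis by (auto simp: Aut_Hopf_def)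
qed

lemma twist_map_bij:
  assumes "twisted_hom \<tau> \<alpha>"
  shows "bij_betw (twist_map \<tau> \<alpha>) Pts Pts"
proof -
  have \<tau>: "bij_betw \<tau> (carrier \<G>) (carrier \<G>)" and \<alpha>: "\<And>s. s \<in> carrier \<G> \<Longrightarrow> \<alpha> s \<in> carrier U"
    using assms by (auto simp: twisted_hom_def Bij_def)
  have \<alpha>0: "\<alpha> s \<noteq> 0" if "s \<in> carrier \<G>" for s
    using \<alpha>[OF that] N_pos by (auto simp: carrier_U power_0_left)
  have "twist_map \<tau> \<alpha> ` Pts \<subseteq> Pts"
    using \<tau> \<alpha> \<gamma>.P.m_closed by (auto simp: twist_map_def bij_betw_def)
  moreover have "inj_on (twist_map \<tau> \<alpha>) Pts"
    using \<tau> \<alpha>0 by (auto simp: twist_map_def inj_on_def bij_betw_def)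
  ultimately show ?thesis
    using finite_\<G> finite_U by (simp add: bij_betw_def endo_inj_surj)
qed

text \<open>
  The second coordinate of \<open>twist_map \<tau> \<alpha> (s, v)\<close> is \<open>\<alpha> s \<cdot> v\<close>, so it acts as the power of \<open>\<sigma>\<close>
  for \<open>\<alpha> s\<close> composed with that for \<open>v\<close>.  The former makes up for the failure of \<open>\<tau>\<close> to be
  multiplicative, the latter commutes with \<open>\<tau>\<close>.
\<close>

lemma twist_map_star:
  assumes tw: "twisted_hom \<tau> \<alpha>" and pq: "p \<in> Pts" "q \<in> Pts"
  shows "twist_map \<tau> \<alpha> (p \<star> q) = twist_map \<tau> \<alpha> p \<star> twist_map \<tau> \<alpha> q"
proof -
  obtain s v s' v' where sv: "p = (s, v)" "q = (s', v')" "s \<in> carrier \<G>" "v \<in> carrier U"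
    "s' \<in> carrier \<G>" "v' \<in> carrier U" using pq by auto
  let ?n = "(\<sigma> ^^ dlog v) s'"
  have n: "?n \<in> carrier \<G>" using sv funpow_auto_closed[OF \<sigma>_auto] by blast
  have \<tau>: "\<tau> \<in> Bij (carrier \<G>)" "\<forall>m\<in>carrier \<G>. \<tau> (\<sigma> m) = \<sigma> (\<tau> m)"
    "\<forall>m\<in>carrier \<G>. \<alpha> (\<sigma> m) = \<alpha> m" "\<alpha> s \<in> carrier U" "\<tau> s' \<in> carrier \<G>"
    using tw sv by (auto simp: twisted_hom_def dest: Bij_imp_funcset)
  have "\<alpha> ((\<sigma> ^^ i) s') = \<alpha> s'" for i
    using \<tau>(3) sv(5) by (induction i) (auto simp: funpow_auto_closed[OF \<sigma>_auto])
  moreover have "\<tau> (s \<otimes>\<^bsub>\<G>\<^esub> ?n) = \<tau> s \<otimes>\<^bsub>\<G>\<^esub> (\<sigma> ^^ dlog (\<alpha> s)) (\<tau> ?n)" "\<alpha> (s \<otimes>\<^bsub>\<G>\<^esub> ?n) = \<alpha> s * \<alpha> ?n"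
    using tw sv n by (auto simp: twisted_hom_def)
  ultimately show ?thesis
    using sv \<tau> funpow_dlog_mult[OF \<tau>(4) sv(4) \<tau>(5)]
    by (simp add: twist_map_def funpow_commute[OF \<tau>(1,2)] mult_ac)
qed

lemma moves_compose:
  assumes "F \<in> hspace A' \<rightarrow> hspace A'" "F' \<in> hspace A' \<rightarrow> hspace A'" "moves F' r q" "moves F q p"
  shows "moves (compose (hspace A') F F') r p"
  using assms by (auto simp: moves_def compose_def Pi_iff)

lemma moves_source_unique: "moves F q p \<Longrightarrow> moves F q' p \<Longrightarrow> q = q'"
  by (rule A.points_eqI) (auto simp: moves_def)

lemma moves_target_unique:
  assumes F: "F ` hspace A' = hspace A'" and "moves F q p" "moves F q p'"
  shows "p = p'"
proof (rule A.points_eqI)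
  show "A.ev p f = A.ev p' f" if "f \<in> hspace A'" for f
  proof -
    have "f \<in> F ` hspace A'" using F that by simp
    then obtain g where "g \<in> hspace A'" "f = F g" by blast
    then show ?thesis using assms by (simp add: moves_def)
  qed
qed (use assms in \<open>auto simp: moves_def\<close>)

lemma moves_star:
  "coalg_map A' A' F \<Longrightarrow> moves F q p \<Longrightarrow> moves F q' p' \<Longrightarrow> moves F (q \<star> q') (p \<star> p')"
  using A.star_closed A.coalg_map_mult_points[of F] unfolding moves_def by simp

lemma realizes_moves: "realizes F \<tau> \<alpha> \<Longrightarrow> q \<in> Pts \<Longrightarrow> moves F q (twist_map \<tau> \<alpha> q)"
  unfolding realizes_def by (drule conjunct2) (rule bspec)

text \<open>
  Let \<open>(\<tau> s, \<alpha> s)\<close> be the image of \<open>(s, 1)\<close>.  The points \<open>(1, v)\<close> are fixed, so \<open>(s, v) = (s, 1)(1, v)\<close>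
  goes to \<open>(\<tau> s, \<alpha> s \<cdot> v)\<close>.  The identities for \<open>\<tau>\<close> and \<open>\<alpha>\<close> result from \<open>(s, 1)(m, 1) = (s m, 1)\<close>
  and from \<open>(1, l)(m, 1) = (\<sigma> m, l)\<close>.
\<close>

lemma realizes_exists:
  assumes F: "F \<in> carrier Aut"
  shows "\<exists>\<tau> \<alpha>. realizes F \<tau> \<alpha>"
proof -
  have bij: "F ` hspace A' = hspace A'" and hopf: "hopf_map A' A' F"
    and \<pi>: "\<And>v. v \<in> carrier U \<Longrightarrow> moves F (\<one>\<^bsub>\<G>\<^esub>, v) (\<one>\<^bsub>\<G>\<^esub>, v)"
    using F by (auto simp: Aut_iff Bij_def bij_betw_def moves_def)
  have co: "coalg_map A' A' F" using hopf by (simp add: hopf_map_def)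
  have "\<forall>p\<in>Pts. \<exists>q. moves F q p"
  proof
    fix p assume p: "p \<in> Pts"
    then obtain q where "q \<in> Pts" "\<forall>f\<in>hspace A'. A.ev p (F f) = A.ev q f"
      using A.hopf_map_points[OF hopf, of p] by auto
    then show "\<exists>q. moves F q p" using p unfolding moves_def by blast
  qed
  then obtain \<rho> where \<rho>: "\<And>p. p \<in> Pts \<Longrightarrow> moves F (\<rho> p) p" by metis
  have "\<rho> p \<in> Pts" if "p \<in> Pts" for p using \<rho>[OF that] unfolding moves_def by blast
  then have "\<rho> ` Pts \<subseteq> Pts" by blast
  moreover have "inj_on \<rho> Pts"
    using \<rho> moves_target_unique[OF bij] by (metis inj_onI)
  ultimately have surj: "\<rho> ` Pts = Pts" using finite_\<G> finite_U by (simp add: endo_inj_surj)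
  have "\<forall>q\<in>Pts. \<exists>p. moves F q p"
  proof
    fix q assume "q \<in> Pts"
    then obtain p where "p \<in> Pts" "q = \<rho> p" using surj by blast
    then show "\<exists>p. moves F q p" using \<rho> by blast
  qed
  then obtain \<phi> where \<phi>: "\<And>q. q \<in> Pts \<Longrightarrow> moves F q (\<phi> q)" by metis
  note \<phi>_eq = moves_target_unique[OF bij \<phi>]
  define \<tau> where "\<tau> = (\<lambda>s\<in>carrier \<G>. fst (\<phi> (s, 1)))"
  define \<alpha> where "\<alpha> = (\<lambda>s\<in>carrier \<G>. snd (\<phi> (s, 1)))"
  have one: "1 \<in> carrier U" using \<gamma>.P.one_closed by simp
  have \<phi>1: "moves F (s, 1) (\<tau> s, \<alpha> s)" if "s \<in> carrier \<G>" for s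
    using \<phi>[of "(s, 1)"] that one by (simp add: \<tau>_def \<alpha>_def)
  have cl: "\<tau> s \<in> carrier \<G>" "\<alpha> s \<in> carrier U" if "s \<in> carrier \<G>" for s
    using \<phi>1[OF that] by (auto simp: moves_def)
  have tw: "moves F (s, v) (twist_map \<tau> \<alpha> (s, v))" if "s \<in> carrier \<G>" "v \<in> carrier U" for s v
    using moves_star[OF co \<phi>1[OF that(1)] \<pi>[OF that(2)]] that cl
    by (simp add: twist_map_def funpow_auto_one[OF \<sigma>_auto])
  have mult: "(\<tau> (s \<otimes>\<^bsub>\<G>\<^esub> m), \<alpha> (s \<otimes>\<^bsub>\<G>\<^esub> m)) = (\<tau> s, \<alpha> s) \<star> (\<tau> m, \<alpha> m)"
    if "s \<in> carrier \<G>" "m \<in> carrier \<G>" for s m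
  proof (rule moves_target_unique[OF bij])
    show "moves F (s \<otimes>\<^bsub>\<G>\<^esub> m, 1) (\<tau> (s \<otimes>\<^bsub>\<G>\<^esub> m), \<alpha> (s \<otimes>\<^bsub>\<G>\<^esub> m))" using that by (simp add: \<phi>1)
    show "moves F (s \<otimes>\<^bsub>\<G>\<^esub> m, 1) ((\<tau> s, \<alpha> s) \<star> (\<tau> m, \<alpha> m))"
      using moves_star[OF co \<phi>1 \<phi>1] that by (simp add: funpow_dlog_one)
  qed
  have conj: "(\<tau> (\<sigma> m), \<alpha> (\<sigma> m) * l) = (\<one>\<^bsub>\<G>\<^esub>, l) \<star> (\<tau> m, \<alpha> m)" if m: "m \<in> carrier \<G>" for m
  proof (rule moves_target_unique[OF bij])
    have \<sigma>m: "\<sigma> m \<in> carrier \<G>" using auto_closed[OF \<sigma>_auto m] .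
    show "moves F (\<sigma> m, l) (\<tau> (\<sigma> m), \<alpha> (\<sigma> m) * l)"
      using tw[OF \<sigma>m l_in_U] by (simp add: twist_map_def)
    show "moves F (\<sigma> m, l) ((\<one>\<^bsub>\<G>\<^esub>, l) \<star> (\<tau> m, \<alpha> m))"
      using moves_star[OF co \<pi>[OF l_in_U] \<phi>1[OF m]] m \<sigma>m by (simp add: funpow_dlog_l)
  qed
  have "inj_on \<tau> (carrier \<G>)"
  proof (rule inj_onI)
    fix s m assume sm: "s \<in> carrier \<G>" "m \<in> carrier \<G>" "\<tau> s = \<tau> m"
    have nz: "\<alpha> s \<noteq> 0" "\<alpha> m \<noteq> 0"
      using cl(2)[OF sm(1)] cl(2)[OF sm(2)] N_pos by (auto simp: carrier_U power_0_left)
    \<comment> \<open>The points \<open>(s, 1)\<close> and \<open>(m, v)\<close> have the same image.\<close>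
    define v where "v = \<alpha> s / \<alpha> m"
    have "v \<in> carrier U" using cl sm by (simp add: v_def carrier_U power_divide)
    moreover have "twist_map \<tau> \<alpha> (m, v) = twist_map \<tau> \<alpha> (s, 1)"
      using sm nz by (simp add: twist_map_def v_def)
    ultimately have "(m, v) = (s, 1)"
      using tw[OF sm(1) one] tw[OF sm(2)] moves_source_unique by metis
    then show "s = m" by simp
  qed
  moreover have "\<tau> ` carrier \<G> \<subseteq> carrier \<G>" using cl by blast
  ultimately have "bij_betw \<tau> (carrier \<G>) (carrier \<G>)"
    using finite_\<G> by (simp add: bij_betw_def endo_inj_surj)
  then have "\<tau> \<in> Bij (carrier \<G>)" by (simp add: Bij_def \<tau>_def)
  moreover have "\<tau> (\<sigma> m) = \<sigma> (\<tau> m)" "\<alpha> (\<sigma> m) = \<alpha> m" if "m \<in> carrier \<G>" for m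
    using conj[OF that] cl[OF that] auto_closed[OF \<sigma>_auto] primitive_root_nonzero[OF l]
    by (auto simp: funpow_dlog_l)
  moreover have "\<alpha> \<in> extensional (carrier \<G>)" by (simp add: \<alpha>_def)
  ultimately have "twisted_hom \<tau> \<alpha>"
    using mult cl by (simp add: twisted_hom_def)
  then have "realizes F \<tau> \<alpha>" using tw by (auto simp: realizes_def)
  then show ?thesis by blast
qed

lemma realizes_unique:
  assumes F: "F \<in> carrier Aut" and "realizes F \<tau> \<alpha>" "realizes F \<tau>' \<alpha>'"
  shows "\<tau> = \<tau>'"
proof (rule extensionalityI)
  show "\<tau> \<in> extensional (carrier \<G>)" "\<tau>' \<in> extensional (carrier \<G>)"
    using assms by (auto simp: realizes_def twisted_hom_def Bij_def)
  fix s assume "s \<in> carrier \<G>"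
  then have "(s, 1) \<in> Pts" using \<gamma>.P.one_closed by simp
  then have "moves F (s, 1) (twist_map \<tau> \<alpha> (s, 1))" "moves F (s, 1) (twist_map \<tau>' \<alpha>' (s, 1))"
    using realizes_moves[OF assms(2)] realizes_moves[OF assms(3)] by simp_all
  moreover have "F ` hspace A' = hspace A'" using F by (simp add: Aut_iff Bij_def bij_betw_def)
  ultimately have "twist_map \<tau> \<alpha> (s, 1) = twist_map \<tau>' \<alpha>' (s, 1)" by (metis moves_target_unique)
  then show "\<tau> s = \<tau>' s" by (simp add: twist_map_def)
qed

lemma realizes_inject:
  assumes "F \<in> carrier Aut" "F' \<in> carrier Aut" "realizes F \<tau> \<alpha>" "realizes F' \<tau> \<alpha>'"
  shows "F = F'"
proof (rule extensionalityI)
  show "F \<in> extensional (hspace A')" "F' \<in> extensional (hspace A')"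
    using assms by (auto simp: Aut_iff Bij_def)
  fix f assume f: "f \<in> hspace A'"
  have "\<alpha> = \<alpha>'" using assms twisted_hom_unique by (auto simp: realizes_def)
  have tw: "twisted_hom \<tau> \<alpha>" using assms by (simp add: realizes_def)
  have "F f \<in> hspace A'" "F' f \<in> hspace A'"
    using assms f by (auto simp: Aut_iff Bij_def bij_betw_def)
  then show "F f = F' f"
  proof (intro A.ev_eqI)
    fix p assume "p \<in> carrier (\<G> \<times>\<times> U)"
    then have "p \<in> twist_map \<tau> \<alpha> ` Pts" using twist_map_bij[OF tw] by (simp add: bij_betw_def)
    then obtain q where q: "q \<in> Pts" "p = twist_map \<tau> \<alpha> q" by blast
    then have "moves F q p" "moves F' q p"
      using realizes_moves[OF assms(3)] realizes_moves[OF assms(4)] \<open>\<alpha> = \<alpha>'\<close> by simp_all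
    then show "A.ev p (F f) = A.ev p (F' f)" using f by (simp add: moves_def)
  qed (auto simp: A'_basis)
qed

text \<open>
  \<open>F\<close> is the pullback of functions along the inverse of \<open>twist_map \<tau> \<alpha>\<close>.
\<close>

lemma realizes_surj:
  assumes tw: "twisted_hom \<tau> \<alpha>"
  shows "\<exists>F\<in>carrier Aut. realizes F \<tau> \<alpha>"
proof -
  let ?\<phi> = "twist_map \<tau> \<alpha>"
  define \<rho> where "\<rho> = inv_into Pts ?\<phi>"
  have bij: "bij_betw ?\<phi> Pts Pts" by (rule twist_map_bij[OF tw])
  then have \<rho>: "bij_betw \<rho> Pts Pts" by (simp add: \<rho>_def bij_betw_inv_into)
  have \<rho>\<phi>: "\<rho> (?\<phi> q) = q" if "q \<in> Pts" for q
    using bij_betw_inv_into_left[OF bij that] by (simp add: \<rho>_def)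
  have \<phi>\<rho>: "?\<phi> (\<rho> p) = p" if "p \<in> Pts" for p
    using bij_betw_inv_into_right[OF bij that] by (simp add: \<rho>_def)
  have \<rho>c: "\<rho> p \<in> Pts" if "p \<in> Pts" for p using \<rho> that by (metis bij_betwE)
  have star_c: "p \<star> q \<in> Pts" if "p \<in> Pts" "q \<in> Pts" for p q
    using A.star_closed that by simp
  have hom: "\<rho> (p \<star> q) = \<rho> p \<star> \<rho> q" if pq: "p \<in> Pts" "q \<in> Pts" for p q
    using twist_map_star[OF tw \<rho>c[OF pq(1)] \<rho>c[OF pq(2)]] \<rho>\<phi>[OF star_c[OF \<rho>c[OF pq(1)] \<rho>c[OF pq(2)]]]
      \<phi>\<rho> pq by simp
  have fix_\<phi>: "?\<phi> (\<one>\<^bsub>\<G>\<^esub>, v) = (\<one>\<^bsub>\<G>\<^esub>, v)" for v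
    using twisted_hom_one[OF tw] by (simp add: twist_map_def)
  then have fix_\<rho>: "\<rho> (\<one>\<^bsub>\<G>\<^esub>, v) = (\<one>\<^bsub>\<G>\<^esub>, v)" if "v \<in> carrier U" for v
    using \<rho>\<phi>[of "(\<one>\<^bsub>\<G>\<^esub>, v)"] that by simp
  have one: "1 \<in> carrier U" using \<gamma>.P.one_closed by simp
  have ex: "\<exists>F. F \<in> Bij (hspace A') \<and> hopf_map A' A' F \<and>
      (\<forall>p\<in>carrier (\<G> \<times>\<times> U). \<forall>f\<in>hspace A'. A.ev p (F f) = A.ev (\<rho> p) f)"
    using \<rho> hom fix_\<rho>[OF one] by (intro A.hopf_map_of_points) auto
  then obtain F where F: "F \<in> Bij (hspace A')" "hopf_map A' A' F"
    "\<And>p f. p \<in> Pts \<Longrightarrow> f \<in> hspace A' \<Longrightarrow> A.ev p (F f) = A.ev (\<rho> p) f" by auto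
  have "F \<in> carrier Aut"
    using F fix_\<rho> by (simp add: Aut_iff)
  moreover have "moves F q (?\<phi> q)" if q: "q \<in> Pts" for q
  proof -
    have "?\<phi> q \<in> Pts" using bij q by (metis bij_betwE)
    then show ?thesis using F(3)[of "?\<phi> q"] \<rho>\<phi>[OF q] q unfolding moves_def by simp
  qed
  then have "realizes F \<tau> \<alpha>" using tw unfolding realizes_def by blast
  ultimately show ?thesis by blast
qed

definition \<Phi> where "\<Phi> F = (THE \<tau>. \<exists>\<alpha>. realizes F \<tau> \<alpha>)"

lemma \<Phi>_eqI: "F \<in> carrier Aut \<Longrightarrow> realizes F \<tau> \<alpha> \<Longrightarrow> \<Phi> F = \<tau>"
  unfolding \<Phi>_def using realizes_unique by (intro the_equality) blast+

lemma realizes_\<Phi>: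
  assumes "F \<in> carrier Aut"
  shows "\<exists>\<alpha>. realizes F (\<Phi> F) \<alpha>"
  using realizes_exists[OF assms] \<Phi>_eqI[OF assms] by blast

lemma Aut_mult:
  assumes "F \<in> carrier Aut" "F' \<in> carrier Aut"
  shows "F \<otimes>\<^bsub>Aut\<^esub> F' = compose (hspace A') F F'" "F \<otimes>\<^bsub>Aut\<^esub> F' \<in> carrier Aut"
proof -
  have mult: "F \<otimes>\<^bsub>Aut\<^esub> F' = compose (hspace A') F F'"
    using assms by (simp add: Aut_iff) (simp add: Aut_Hopf_def BijGroup_def)
  then show "F \<otimes>\<^bsub>Aut\<^esub> F' = compose (hspace A') F F'" .
  have "F' f \<in> hspace A'" if "f \<in> hspace A'" for f
    using assms(2) that by (auto simp: Aut_iff Bij_def bij_betw_def)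
  then show "F \<otimes>\<^bsub>Aut\<^esub> F' \<in> carrier Aut"
    unfolding mult using assms A.hopf_map_compose[of F F']
    by (simp add: Aut_iff compose_Bij) (simp add: compose_def)
qed

lemma \<Phi>_mult:
  assumes F: "F \<in> carrier Aut" and F': "F' \<in> carrier Aut"
  shows "\<Phi> (F \<otimes>\<^bsub>Aut\<^esub> F') = compose (carrier \<G>) (\<Phi> F) (\<Phi> F')"
proof (rule extensionalityI)
  let ?FF = "F \<otimes>\<^bsub>Aut\<^esub> F'"
  obtain \<alpha> where \<alpha>: "realizes F (\<Phi> F) \<alpha>" using realizes_\<Phi>[OF F] by blast
  obtain \<alpha>' where \<alpha>': "realizes F' (\<Phi> F') \<alpha>'" using realizes_\<Phi>[OF F'] by blast
  obtain \<alpha>'' where \<alpha>'': "realizes ?FF (\<Phi> ?FF) \<alpha>''" using realizes_\<Phi>[OF Aut_mult(2)[OF F F']] by blast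
  show "\<Phi> ?FF \<in> extensional (carrier \<G>)"
    using \<alpha>'' by (simp add: realizes_def twisted_hom_def Bij_def)
  show "compose (carrier \<G>) (\<Phi> F) (\<Phi> F') \<in> extensional (carrier \<G>)" by simp
  fix s assume s: "s \<in> carrier \<G>"
  then have q: "(s, 1) \<in> Pts" using \<gamma>.P.one_closed by simp
  let ?q' = "twist_map (\<Phi> F') \<alpha>' (s, 1)"
  have m': "moves F' (s, 1) ?q'" by (rule realizes_moves[OF \<alpha>' q])
  then have "?q' \<in> Pts" unfolding moves_def by blast
  then have "moves F ?q' (twist_map (\<Phi> F) \<alpha> ?q')" by (rule realizes_moves[OF \<alpha>])
  with m' have "moves ?FF (s, 1) (twist_map (\<Phi> F) \<alpha> ?q')"
    unfolding Aut_mult(1)[OF F F'] using F F'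
    by (intro moves_compose) (auto simp: Aut_iff Bij_def bij_betw_def)
  moreover have "moves ?FF (s, 1) (twist_map (\<Phi> ?FF) \<alpha>'' (s, 1))"
    by (rule realizes_moves[OF \<alpha>'' q])
  moreover have "?FF ` hspace A' = hspace A'"
    using Aut_mult(2)[OF F F'] by (simp add: Aut_iff Bij_def bij_betw_def)
  ultimately have "twist_map (\<Phi> F) \<alpha> ?q' = twist_map (\<Phi> ?FF) \<alpha>'' (s, 1)"
    using moves_target_unique by blast
  then show "\<Phi> ?FF s = compose (carrier \<G>) (\<Phi> F) (\<Phi> F') s"
    using s by (simp add: twist_map_def compose_def)
qed

lemma \<Phi>_iso: "\<Phi> \<in> iso Aut (\<Gamma>_group \<G> l \<sigma>)"
proof -
  have car: "\<tau> \<in> carrier (\<Gamma>_group \<G> l \<sigma>) \<longleftrightarrow> (\<exists>\<alpha>. twisted_hom \<tau> \<alpha>)" for \<tau>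
    by (simp add: \<Gamma>_group_def twisted_hom_iff)
  have into: "\<Phi> F \<in> carrier (\<Gamma>_group \<G> l \<sigma>)" if F: "F \<in> carrier Aut" for F
  proof -
    obtain \<alpha> where "realizes F (\<Phi> F) \<alpha>" using realizes_\<Phi>[OF F] by blast
    then show ?thesis unfolding car realizes_def by blast
  qed
  have Bij: "\<Phi> F \<in> Bij (carrier \<G>)" if "F \<in> carrier Aut" for F
    using into[OF that] unfolding car twisted_hom_def by blast
  have "\<Phi> (F \<otimes>\<^bsub>Aut\<^esub> F') = \<Phi> F \<otimes>\<^bsub>\<Gamma>_group \<G> l \<sigma>\<^esub> \<Phi> F'"
    if F: "F \<in> carrier Aut" "F' \<in> carrier Aut" for F F'
    using Bij[OF F(1)] Bij[OF F(2)] \<Phi>_mult[OF F] by (simp add: \<Gamma>_group_def BijGroup_def)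
  then have "\<Phi> \<in> hom Aut (\<Gamma>_group \<G> l \<sigma>)"
    using into by (simp add: hom_def)
  moreover have "inj_on \<Phi> (carrier Aut)"
  proof (rule inj_onI)
    fix F F' assume F: "F \<in> carrier Aut" "F' \<in> carrier Aut" "\<Phi> F = \<Phi> F'"
    obtain \<alpha> where "realizes F (\<Phi> F) \<alpha>" using realizes_\<Phi>[OF F(1)] by blast
    moreover obtain \<alpha>' where "realizes F' (\<Phi> F') \<alpha>'" using realizes_\<Phi>[OF F(2)] by blast
    ultimately show "F = F'" using realizes_inject[OF F(1,2)] F(3) by simp
  qed
  moreover have "carrier (\<Gamma>_group \<G> l \<sigma>) \<subseteq> \<Phi> ` carrier Aut"
  proof
    fix \<tau> assume "\<tau> \<in> carrier (\<Gamma>_group \<G> l \<sigma>)"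
    then obtain \<alpha> F where "F \<in> carrier Aut" "realizes F \<tau> \<alpha>"
      using realizes_surj unfolding car by blast
    then show "\<tau> \<in> \<Phi> ` carrier Aut" using \<Phi>_eqI by blast
  qed
  ultimately show ?thesis using into by (auto simp: iso_def bij_betw_def)
qed

text \<open>
  \<open>F\<^sub>L\<close> is the pullback of functions along the inverse of \<open>\<tau>\<close>: the point \<open>(m, 1)\<close> is the image of
  \<open>(s, \<alpha>(s)\<^sup>-\<^sup>1)\<close> with \<open>\<tau> s = m\<close>, and functions of the form \<open>b \<times> 1\<close> see only the first coordinate.
\<close>

lemma left_part_coalg_map_iff:
  assumes F: "F \<in> carrier Aut"
  shows "coalg_map (group_algebra \<G>) (group_algebra \<G>) (left_part (group_algebra H) F) \<longleftrightarrow>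
    \<Phi> F \<in> auto \<G>"
proof -
  define \<tau> where "\<tau> = \<Phi> F"
  obtain \<alpha> where \<alpha>: "realizes F \<tau> \<alpha>" using realizes_\<Phi>[OF F] unfolding \<tau>_def by blast
  then have tw: "twisted_hom \<tau> \<alpha>" by (simp add: realizes_def)
  then have Bij: "\<tau> \<in> Bij (carrier \<G>)" and \<alpha>U: "\<And>s. s \<in> carrier \<G> \<Longrightarrow> \<alpha> s \<in> carrier U"
    by (auto simp: twisted_hom_def)
  then have bij: "bij_betw \<tau> (carrier \<G>) (carrier \<G>)" by (simp add: Bij_def)
  define \<rho> where "\<rho> = inv_into (carrier \<G>) \<tau>"
  have \<rho>: "\<rho> m \<in> carrier \<G>" "\<tau> (\<rho> m) = m" if "m \<in> carrier \<G>" for m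
    using bij that by (auto simp: \<rho>_def bij_betw_inv_into_right bij_betw_def inv_into_into)
  have \<rho>\<tau>: "\<rho> (\<tau> s) = s" if "s \<in> carrier \<G>" for s
    using bij that by (simp add: \<rho>_def bij_betw_inv_into_left)
  have \<tau>c: "\<tau> s \<in> carrier \<G>" if "s \<in> carrier \<G>" for s using Bij that Bij_imp_funcset by blast
  have F': "F \<in> hspace A' \<rightarrow> hspace A'" "linear_on (hspace A') F"
    using F by (auto simp: Aut_iff hopf_map_def coalg_map_def)
  have dual: "\<beta>.ev m (left_part (group_algebra H) F b) = \<beta>.ev (\<rho> m) b"
    if m: "m \<in> carrier \<G>" and b: "b \<in> hspace (group_algebra \<G>)" for m b
  proof -
    let ?v = "inverse (\<alpha> (\<rho> m))"
    have v: "?v \<in> carrier U" using \<alpha>U[OF \<rho>(1)[OF m]] by (simp add: carrier_U power_inverse)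
    then have "?v \<noteq> 0" using N_pos by (auto simp: carrier_U power_0_left)
    then have "twist_map \<tau> \<alpha> (\<rho> m, ?v) = (m, 1)" using \<rho>(2)[OF m] by (simp add: twist_map_def)
    moreover have "moves F (\<rho> m, ?v) (twist_map \<tau> \<alpha> (\<rho> m, ?v))"
      using v \<rho>(1)[OF m] by (intro realizes_moves[OF \<alpha>]) simp
    ultimately have "A.ev (m, 1) (F (embed b)) = A.ev (\<rho> m, ?v) (embed b)"
      using embed_points(1)[OF b] unfolding moves_def by simp
    then show ?thesis using left_part_points(3)[OF F' b] embed_points(2)[OF b v] by simp
  qed
  have "coalg_map (group_algebra \<G>) (group_algebra \<G>) (left_part (group_algebra H) F) \<longleftrightarrow>
      (\<forall>p\<in>carrier \<G>. \<forall>q\<in>carrier \<G>. \<rho> (p \<otimes>\<^bsub>\<G>\<^esub> q) = \<rho> p \<otimes>\<^bsub>\<G>\<^esub> \<rho> q) \<and> \<rho> \<one>\<^bsub>\<G>\<^esub> = \<one>\<^bsub>\<G>\<^esub>"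
    using \<rho>(1) dual by (intro B.coalg_map_iff_points left_part_points(1,2)[OF F'])
  also have "\<dots> \<longleftrightarrow> (\<forall>s\<in>carrier \<G>. \<forall>m\<in>carrier \<G>. \<tau> (s \<otimes>\<^bsub>\<G>\<^esub> m) = \<tau> s \<otimes>\<^bsub>\<G>\<^esub> \<tau> m)"
  proof (intro iffI conjI ballI)
    fix s m assume *: "(\<forall>p\<in>carrier \<G>. \<forall>q\<in>carrier \<G>. \<rho> (p \<otimes>\<^bsub>\<G>\<^esub> q) = \<rho> p \<otimes>\<^bsub>\<G>\<^esub> \<rho> q) \<and> \<rho> \<one>\<^bsub>\<G>\<^esub> = \<one>\<^bsub>\<G>\<^esub>"
      and sm: "s \<in> carrier \<G>" "m \<in> carrier \<G>"
    then have "\<rho> (\<tau> s \<otimes>\<^bsub>\<G>\<^esub> \<tau> m) = s \<otimes>\<^bsub>\<G>\<^esub> m" using \<tau>c \<rho>\<tau> by simp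
    then show "\<tau> (s \<otimes>\<^bsub>\<G>\<^esub> m) = \<tau> s \<otimes>\<^bsub>\<G>\<^esub> \<tau> m" using \<rho>(2)[of "\<tau> s \<otimes>\<^bsub>\<G>\<^esub> \<tau> m"] \<tau>c sm by simp
  next
    fix p q assume *: "\<forall>s\<in>carrier \<G>. \<forall>m\<in>carrier \<G>. \<tau> (s \<otimes>\<^bsub>\<G>\<^esub> m) = \<tau> s \<otimes>\<^bsub>\<G>\<^esub> \<tau> m"
      and pq: "p \<in> carrier \<G>" "q \<in> carrier \<G>"
    then have "\<tau> (\<rho> p \<otimes>\<^bsub>\<G>\<^esub> \<rho> q) = p \<otimes>\<^bsub>\<G>\<^esub> q" using \<rho> by simp
    then show "\<rho> (p \<otimes>\<^bsub>\<G>\<^esub> q) = \<rho> p \<otimes>\<^bsub>\<G>\<^esub> \<rho> q" using \<rho>\<tau>[of "\<rho> p \<otimes>\<^bsub>\<G>\<^esub> \<rho> q"] \<rho>(1) pq by simp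
  next
    show "\<rho> \<one>\<^bsub>\<G>\<^esub> = \<one>\<^bsub>\<G>\<^esub>" using \<rho>\<tau>[of "\<one>\<^bsub>\<G>\<^esub>"] twisted_hom_one(1)[OF tw] by simp
  qed
  also have "\<dots> \<longleftrightarrow> \<tau> \<in> auto \<G>" using Bij \<tau>c by (auto simp: auto_def hom_def)
  finally show ?thesis by (simp add: \<tau>_def)
qed

end

theorem theorem9:
  fixes G :: "'g monoid" and \<G> :: "'a monoid" and \<mu> :: "'g \<Rightarrow> 'a \<Rightarrow> 'a" and \<theta> :: "'a \<Rightarrow> 'a"
    and \<U> :: "'g set" and e :: "'k::field \<Rightarrow> 'g"
  assumes "biproduct_data G \<G> \<mu> \<theta> \<U> e"
    and "comm_group \<G>" and "finite (carrier \<G>)"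
  defines "N \<equiv> group.ord (AutoGroup \<G>) \<theta>"
    and "kU \<equiv> group_algebra (G\<lparr>carrier := \<U>\<rparr>) :: ('g, 'k) hopf"
    and "A' \<equiv> group_biproduct (G\<lparr>carrier := \<U>\<rparr>) \<G> \<mu> \<theta> e"
    and "\<pi>' \<equiv> bip_proj (group_algebra \<G>) :: ('a \<times> 'g \<Rightarrow>\<^sub>0 'k) \<Rightarrow> ('g \<Rightarrow>\<^sub>0 'k)"
  shows "(\<exists>l::'k. primitive_root N l) \<and>
    (\<forall>l::'k. primitive_root N l \<longrightarrow> (\<exists>w::'k. primitive_root (card (carrier \<G>)) w) \<longrightarrow>
      (\<exists>\<sigma> \<Phi>. \<sigma> \<in> auto \<G> \<and> group.ord (AutoGroup \<G>) \<sigma> = N \<and>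
        \<Phi> \<in> iso (Aut_Hopf A' \<pi>') (\<Gamma>_group \<G> l \<sigma>) \<and>
        (\<forall>F\<in>carrier (Aut_Hopf A' \<pi>').
          coalg_map (group_algebra \<G>) (group_algebra \<G>) (left_part kU F) \<longleftrightarrow> \<Phi> F \<in> auto \<G>)))"
proof -
  interpret D: finite_biproduct_data G \<G> \<mu> \<theta> \<U> e
    using assms(1-3) by (simp add: finite_biproduct_data_def finite_biproduct_data_axioms_def)
  have N: "D.N = N" by (simp add: D.N_def N_def)
  show ?thesis
  proof (intro conjI allI impI)
    show "\<exists>l::'k. primitive_root N l" using D.primitive_root_in_U N by auto
  next
    fix l :: 'k assume l: "primitive_root N l" and "\<exists>w::'k. primitive_root (card (carrier \<G>)) w"
    then obtain w :: 'k where w: "primitive_root (card (carrier \<G>)) w" by blast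
    have "x [^]\<^bsub>\<G>\<^esub> card (carrier \<G>) = \<one>\<^bsub>\<G>\<^esub>" if "x \<in> carrier \<G>" for x
      using D.pow_order_eq_1[OF that] by (simp add: Coset.order_def)
    then obtain \<beta> :: "'a \<Rightarrow> 'a \<Rightarrow> 'k" where \<beta>: "self_pairing \<G> \<beta>"
      using self_pairing_exists[OF assms(2,3) w] by blast
    interpret E: dual_biproduct G \<G> \<mu> \<theta> \<U> e l \<beta>
      using l \<beta> primitive_root_of_nat_nonzero[OF w] N by unfold_locales auto
    show "\<exists>\<sigma> \<Phi>. \<sigma> \<in> auto \<G> \<and> group.ord (AutoGroup \<G>) \<sigma> = N \<and>
        \<Phi> \<in> iso (Aut_Hopf A' \<pi>') (\<Gamma>_group \<G> l \<sigma>) \<and>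
        (\<forall>F\<in>carrier (Aut_Hopf A' \<pi>').
          coalg_map (group_algebra \<G>) (group_algebra \<G>) (left_part kU F) \<longleftrightarrow> \<Phi> F \<in> auto \<G>)"
      unfolding A'_def \<pi>'_def kU_def
      using E.\<sigma>_auto E.ord_\<sigma> E.\<Phi>_iso E.left_part_coalg_map_iff N by blast
  qed
qed

end
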